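(* Let $X$ be a compact complex manifold, $E\to X$ a holomorphic vector bundle of rank $r$, and $F$ a strongly pseudoconvex Finsler metric on $E$ with $G=F^2$. For $z_0\in X$, $v\in T^{1,0}_{z_0}X$ and $0\neq\zeta\in E_{z_0}$, define $$K_v(\zeta)=-\inf_{\phi}\ \partial\bar\partial\log G(\phi)\big|_{z_0}(v,\bar v),$$ where the infimum is taken over all local holomorphic sections $\phi$ of $E$ (defined near $z_0$) such that $\phi(z_0)=\zeta$. Then $$K_v(\zeta)=\Theta|_{O_{P(E)}(-1)}(v,\bar v),$$ where the right-hand side is the Kobayashi curvature of $F$ at the point $(z_0,[\zeta])\in P(E)$, evaluated on any $(1,0)$-tangent vector $\tilde v$ to $P(E)$ at $(z_0,[\zeta])$ with $p_*\tilde v=v$ (the value $\Theta|_{O_{P(E)}(-1)}(\tilde v,\overline{\tilde v})$ being independent of the choice of the lift $\tilde v$).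
   Context: Let $n=\dim X$. $G(\phi)$ denotes the function $z\mapsto G(z,\phi(z))$ near $z_0$, and for $v=\sum_\alpha v_\alpha\,\partial/\partial z_\alpha$ one has $\partial\bar\partial f(v,\bar v)=\sum_{\alpha,\beta}\frac{\partial^2 f}{\partial z_\alpha\partial\bar z_\beta}v_\alpha\bar v_\beta$. **Projectivization.** $p:P(E)\to X$ is the projectivized bundle of $E$: the fiber $P(E_z)$ is the space of lines $[\zeta]$, $0\ne\zeta\in E_z$. $O_{P(E)}(-1)\subset \tilde E:=p^*E$ is the tautological line bundle (its fiber over $(z,[\zeta])$ is the line $\mathbb{C}\zeta$). **Finsler metrics.** A (smooth) Finsler metric $F$ on $E$ is a function $F:E\to\mathbb{R}$ that is continuous on $E$ and smooth off the zero section, satisfies $F(z,\zeta)\ge 0$ with equality iff $\zeta=0$, and $F(z,\lambda\zeta)=|\lambda|F(z,\zeta)$ for $\lambda\in\mathbb{C}$. In local fiber coordinates $\zeta_1,\dots,\zeta_r$ with respect to a holomorphic frame, write $F_{i\bar j}=\partial^2F/\partial\zeta_i\partial\bar\zeta_j$, $G_{i\bar j}=\partial^2G/\partial\zeta_i\partial\bar\zeta_j$. $F$ is *strongly pseudoconvex* if $(F_{i\bar j})$ is positive definite on $E\setminus\{\text{zero section}\}$ (equivalently $(G_{i\bar j})$ is positive definite there). **Kobayashi curvature.** For a strongly pseudoconvex Finsler metric $F$ on $E$, the bundle $\tilde E=p^*E\to P(E)$ carries the Hermitian metric $$\tilde G_{(z,[\zeta])}(Z,Z)=\sum_{i,j}G_{i\bar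 j}(z,\zeta)Z_i\bar Z_j,\qquad Z=\sum_i Z_is_i(z)\in E_z,$$ where $\{s_i\}$ is a local holomorphic frame of $E$; this is well defined since $G_{i\bar j}(z,\lambda\zeta)=G_{i\bar j}(z,\zeta)$ for $\lambda\in\mathbb{C}\setminus\{0\}$. Let $\Theta$ be the Chern curvature of $(\tilde E,\tilde G)$, an $\mathrm{End}(\tilde E)$-valued $(1,1)$-form on $P(E)$ (convention: for a line bundle with metric $g$ the curvature is $-\partial\bar\partial\log g$). With respect to the $\tilde G$-orthogonal decomposition $\tilde E=O_{P(E)}(-1)\oplus O_{P(E)}(-1)^\perp$, $\Theta|_{O_{P(E)}(-1)}$ denotes the diagonal block of $\Theta$ in $\mathrm{End}(O_{P(E)}(-1))$; it is a scalar $(1,1)$-form on $P(E)$, equal at $(z,[\zeta])$ to $\tilde G(\Theta\zeta,\zeta)/\tilde G(\zeta,\zeta)$, and is called the Kobayashi curvature of $F$. In local coordinates $(z_1,\dots,z_n,w_1,\dots,w_{r-1})$ on $P(E)$ (with $w_i=\zeta_i/\zeta_r$ where $\zeta_r\ne0$), it is known that only the $dz_\alpha\wedge d\bar z_\beta$ terms of this form are nonzero: $$\Theta|_{O_{P(E)}(-1)}=\sum_{\alpha,\beta}\frac{\tilde G(R_{\alpha\bar\beta}\zeta,\zeta)}{\tilde G(\zeta,\zeta)}\,dz_\alpha\wedge d\bar z_\beta,$$ where $R_{\alpha\bar\beta}\in\mathrm{End}(\tilde E)$ is the $dz_\alpha\wedge d\bar z_\beta$ coefficient of $\Theta$. Here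 $(dz_\alpha\wedge d\bar z_\beta)(\tilde v,\overline{\tilde v})=v_\alpha\bar v_\beta$ when $p_*\tilde v=\sum_\alpha v_\alpha\,\partial/\partial z_\alpha$. *)

theory Defs
  imports "HOL-Analysis.Analysis"
begin

section \<open>Calculus on complex coordinate space\<close>

text \<open>
  For open \<open>S\<close>: complex Frechet differentiability of a scalar function. Vector and matrix valued maps
  are holomorphic when their entries are.
\<close>

definition holo_on :: "(complex^'m \<Rightarrow> complex) \<Rightarrow> (complex^'m) set \<Rightarrow> bool" where
  "holo_on f S \<longleftrightarrow>
     (\<forall>x\<in>S. \<exists>a :: complex^'m. (f has_derivative (\<lambda>h. \<Sum>k\<in>UNIV. a $ k * h $ k)) (at x))"

primrec cont_diff_on ::
  "nat \<Rightarrow> ('a::real_normed_vector \<Rightarrow> 'b::real_normed_vector) \<Rightarrow> 'a set \<Rightarrow> bool" where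
  "cont_diff_on 0 f S \<longleftrightarrow> continuous_on S f"
| "cont_diff_on (Suc k) f S \<longleftrightarrow>
     (\<forall>x\<in>S. f differentiable (at x)) \<and>
     (\<forall>v. cont_diff_on k (\<lambda>x. frechet_derivative f (at x) v) S)"

definition smooth_on :: "('a::real_normed_vector \<Rightarrow> 'b::real_normed_vector) \<Rightarrow> 'a set \<Rightarrow> bool" where
  "smooth_on f S \<longleftrightarrow> (\<forall>k. cont_diff_on k f S)"

text \<open>
  The Wirtinger operators \<open>\<partial>/\<partial>z\<^sub>a = (\<partial>/\<partial>x\<^sub>a - \<i> \<partial>/\<partial>y\<^sub>a)/2\<close> and \<open>\<partial>/\<partial>z\<^sub>a\<close>-bar
  \<open>= (\<partial>/\<partial>x\<^sub>a + \<i> \<partial>/\<partial>y\<^sub>a)/2\<close>, where \<open>z\<^sub>a = x\<^sub>a + \<i> y\<^sub>a\<close>.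
\<close>

definition wirt :: "'m \<Rightarrow> (complex^'m \<Rightarrow> complex) \<Rightarrow> complex^'m \<Rightarrow> complex" where
  "wirt a f x =
     (frechet_derivative f (at x) (axis a 1) - \<i> * frechet_derivative f (at x) (axis a \<i>)) / 2"

definition wirt_bar :: "'m \<Rightarrow> (complex^'m \<Rightarrow> complex) \<Rightarrow> complex^'m \<Rightarrow> complex" where
  "wirt_bar a f x =
     (frechet_derivative f (at x) (axis a 1) + \<i> * frechet_derivative f (at x) (axis a \<i>)) / 2"

definition herm :: "complex^'r^'r \<Rightarrow> complex^'r \<Rightarrow> complex^'r \<Rightarrow> complex" where
  "herm H Z W = (\<Sum>i\<in>UNIV. \<Sum>j\<in>UNIV. H $ i $ j * Z $ i * cnj (W $ j))"

definition pos_def_hermitian :: "complex^'r^'r \<Rightarrow> bool" where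
  "pos_def_hermitian H \<longleftrightarrow>
     (\<forall>i j. H $ j $ i = cnj (H $ i $ j)) \<and> (\<forall>Z. Z \<noteq> 0 \<longrightarrow> 0 < Re (herm H Z Z))"

text \<open>
  Chern connection and curvature of a Hermitian metric with matrix \<open>H\<^sub>i\<^sub>j = h(s\<^sub>i, s\<^sub>j)\<close> in a
  holomorphic frame \<open>s\<close>. The connection matrix \<open>\<theta>\<close>, with \<open>D s\<^sub>i = \<Sum>\<^sub>j \<theta>\<^sub>i\<^sub>j s\<^sub>j\<close>, is \<open>(\<partial>H) H\<inverse>\<close>, and the
  curvature is \<open>\<Theta> = d\<theta> - \<theta>\<and>\<theta>\<close>, which is \<open>\<theta>\<close> differentiated by d-bar. Moving \<open>dz\<^sub>a\<close> in front of the
  conjugate differential of \<open>z\<^sub>b\<close> produces the minus sign in the coefficient. The curvature maps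
  \<open>\<Sum>\<^sub>i Z\<^sub>i s\<^sub>i\<close> to \<open>\<Sum>\<^sub>j (\<Sum>\<^sub>i Z\<^sub>i \<Theta>\<^sub>i\<^sub>j) s\<^sub>j\<close>, that is, the row vector \<open>Z\<close> to \<open>Z v* \<Theta>\<close>.
\<close>

definition chern_connection ::
  "(complex^'m \<Rightarrow> complex^'r^'r) \<Rightarrow> 'm \<Rightarrow> complex^'m \<Rightarrow> complex^'r^'r" where
  "chern_connection H a u = (\<chi> i j. wirt a (\<lambda>x. H x $ i $ j) u) ** matrix_inv (H u)"

definition chern_curvature ::
  "(complex^'m \<Rightarrow> complex^'r^'r) \<Rightarrow> 'm \<Rightarrow> 'm \<Rightarrow> complex^'m \<Rightarrow> complex^'r^'r" where
  "chern_curvature H a b u = (\<chi> i j. - wirt_bar b (\<lambda>x. chern_connection H a x $ i $ j) u)"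


section \<open>Complex manifolds and holomorphic vector bundles\<close>

type_synonym ('x, 'n) chart = "'x set \<times> ('x \<Rightarrow> complex^'n)"

definition chart_inv :: "('x, 'n::finite) chart \<Rightarrow> complex^'n \<Rightarrow> 'x" where
  "chart_inv c = inv_into (fst c) (snd c)"

definition complex_manifold :: "('x::t2_space, 'n::finite) chart set \<Rightarrow> bool" where
  "complex_manifold A \<longleftrightarrow>
     (\<Union>c\<in>A. fst c) = UNIV \<and>
     (\<forall>c\<in>A. open (fst c) \<and> open (snd c ` fst c) \<and>
        (\<exists>\<psi>. homeomorphism (fst c) (snd c ` fst c) (snd c) \<psi>)) \<and>
     (\<forall>c\<in>A. \<forall>d\<in>A. \<forall>\<alpha>.
        holo_on (\<lambda>x. snd d (chart_inv c x) $ \<alpha>) (snd c ` (fst c \<inter> fst d)))"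

text \<open>
  A \<open>(1,0)\<close>-tangent vector at \<open>z\<close> is given by its components \<open>v\<^sub>\<alpha>\<close> with respect to
  \<open>\<partial>/\<partial>z\<^sub>\<alpha>\<close> in every chart around \<open>z\<close>, related by the Jacobians of the coordinate changes.
\<close>

definition tangent_vector ::
  "('x::t2_space, 'n::finite) chart set \<Rightarrow> 'x \<Rightarrow> (('x, 'n) chart \<Rightarrow> complex^'n) \<Rightarrow> bool" where
  "tangent_vector A z v \<longleftrightarrow>
     (\<forall>c\<in>A. \<forall>d\<in>A. z \<in> fst c \<longrightarrow> z \<in> fst d \<longrightarrow>
        v d = frechet_derivative (\<lambda>x. snd d (chart_inv c x)) (at (snd c z)) (v c))"

text \<open>The value of \<open>\<partial>\<close> d-bar \<open>f\<close> at \<open>z\<close> on the tangent vector with components \<open>v\<close> in the chart \<open>c\<close>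
  and on its conjugate.\<close>

definition ddbar ::
  "('x, 'n::finite) chart \<Rightarrow> ('x \<Rightarrow> real) \<Rightarrow> 'x \<Rightarrow> complex^'n \<Rightarrow> complex" where
  "ddbar c f z v =
     (\<Sum>\<alpha>\<in>UNIV. \<Sum>\<beta>\<in>UNIV.
        wirt \<alpha> (wirt_bar \<beta> (\<lambda>x. complex_of_real (f (chart_inv c x)))) (snd c z)
          * v $ \<alpha> * cnj (v $ \<beta>))"

text \<open>
  In a local trivialization \<open>(V, t)\<close> the function \<open>t\<close> gives the fiber coordinates with respect to the
  holomorphic frame over \<open>V\<close> that the trivialization defines.
\<close>

type_synonym ('x, 'e, 'r) triv = "'x set \<times> ('e \<Rightarrow> complex^'r)"

record ('x, 'e, 'n::finite, 'r::finite) hbundle =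
  charts :: "('x, 'n) chart set"
  proj :: "'e \<Rightarrow> 'x"
  vadd :: "'e \<Rightarrow> 'e \<Rightarrow> 'e"
  vscale :: "complex \<Rightarrow> 'e \<Rightarrow> 'e"
  trivs :: "('x, 'e, 'r) triv set"

text \<open>
  The vector space axioms in the fibers follow, since the trivializations are bijective on
  fibers and respect both operations.
\<close>

definition holomorphic_vector_bundle ::
  "('x::t2_space, 'e::topological_space, 'n::finite, 'r::finite) hbundle \<Rightarrow> bool" where
  "holomorphic_vector_bundle B \<longleftrightarrow>
     complex_manifold (charts B) \<and>
     continuous_on UNIV (proj B) \<and>
     (\<forall>s e. proj B (vscale B s e) = proj B e) \<and>
     (\<forall>e e'. proj B e = proj B e' \<longrightarrow> proj B (vadd B e e') = proj B e) \<and>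
     (\<Union>\<tau>\<in>trivs B. fst \<tau>) = UNIV \<and>
     (\<forall>\<tau>\<in>trivs B.
        open (fst \<tau>) \<and>
        (\<exists>\<sigma>. homeomorphism (proj B -` fst \<tau>) (fst \<tau> \<times> UNIV) (\<lambda>e. (proj B e, snd \<tau> e)) \<sigma>) \<and>
        (\<forall>e. proj B e \<in> fst \<tau> \<longrightarrow> (\<forall>s. snd \<tau> (vscale B s e) = s *s snd \<tau> e)) \<and>
        (\<forall>e e'. proj B e \<in> fst \<tau> \<longrightarrow> proj B e = proj B e' \<longrightarrow>
           snd \<tau> (vadd B e e') = snd \<tau> e + snd \<tau> e')) \<and>
     (\<forall>\<tau>\<in>trivs B. \<forall>\<sigma>\<in>trivs B. \<exists>g :: 'x \<Rightarrow> complex^'r^'r.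
        (\<forall>e. proj B e \<in> fst \<tau> \<inter> fst \<sigma> \<longrightarrow> snd \<sigma> e = g (proj B e) *v snd \<tau> e) \<and>
        (\<forall>c\<in>charts B. \<forall>i j.
           holo_on (\<lambda>x. g (chart_inv c x) $ i $ j) (snd c ` (fst c \<inter> fst \<tau> \<inter> fst \<sigma>))))"

definition is_zero_vec :: "('x, 'e, 'n::finite, 'r::finite) hbundle \<Rightarrow> 'e \<Rightarrow> bool" where
  "is_zero_vec B e \<longleftrightarrow> vscale B 0 e = e"

text \<open>
  All germs of holomorphic sections at \<open>proj B \<zeta>\<close> with value \<open>\<zeta>\<close>, each represented by a total
  function whose values outside the open set \<open>W\<close> are irrelevant.
\<close>

definition local_sections ::
  "('x::t2_space, 'e, 'n::finite, 'r::finite) hbundle \<Rightarrow> 'e \<Rightarrow> ('x \<Rightarrow> 'e) set" where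
  "local_sections B \<zeta> =
     {\<phi>. \<phi> (proj B \<zeta>) = \<zeta> \<and>
         (\<exists>W. open W \<and> proj B \<zeta> \<in> W \<and> (\<forall>z\<in>W. proj B (\<phi> z) = z) \<and>
            (\<forall>c\<in>charts B. \<forall>\<tau>\<in>trivs B. \<forall>i.
               holo_on (\<lambda>x. snd \<tau> (\<phi> (chart_inv c x)) $ i) (snd c ` (W \<inter> fst c \<inter> fst \<tau>))))}"

text \<open>
  Coordinates \<open>(z, \<zeta>)\<close> on the total space over a chart and a trivialization, indexed by the sum
  type: \<open>Inl\<close> for the base and \<open>Inr\<close> for the fiber.
\<close>

definition bcoord ::
  "('x, 'e, 'n::finite, 'r::finite) hbundle \<Rightarrow> ('x, 'n) chart \<Rightarrow> ('x, 'e, 'r) triv \<Rightarrow>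
     'e \<Rightarrow> complex^('n + 'r)" where
  "bcoord B c \<tau> e = (\<chi> a. case a of Inl \<alpha> \<Rightarrow> snd c (proj B e) $ \<alpha> | Inr i \<Rightarrow> snd \<tau> e $ i)"

definition bpoint ::
  "('x, 'e, 'n::finite, 'r::finite) hbundle \<Rightarrow> ('x, 'n) chart \<Rightarrow> ('x, 'e, 'r) triv \<Rightarrow>
     complex^('n + 'r) \<Rightarrow> 'e" where
  "bpoint B c \<tau> = inv_into (proj B -` (fst c \<inter> fst \<tau>)) (bcoord B c \<tau>)"


section \<open>Finsler metrics\<close>

definition finsler_metric ::
  "('x::t2_space, 'e::topological_space, 'n::finite, 'r::finite) hbundle \<Rightarrow> ('e \<Rightarrow> real) \<Rightarrow> bool" where
  "finsler_metric B F \<longleftrightarrow>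
     continuous_on UNIV F \<and>
     (\<forall>c\<in>charts B. \<forall>\<tau>\<in>trivs B.
        smooth_on (\<lambda>u. F (bpoint B c \<tau> u))
          (bcoord B c \<tau> ` {e. proj B e \<in> fst c \<inter> fst \<tau> \<and> \<not> is_zero_vec B e})) \<and>
     (\<forall>e. 0 \<le> F e \<and> (F e = 0 \<longleftrightarrow> is_zero_vec B e)) \<and>
     (\<forall>s e. F (vscale B s e) = cmod s * F e)"

text \<open>The matrix of mixed second derivatives in the fiber coordinates, at the point with
  coordinates \<open>u\<close>; used for both \<open>F\<close> and \<open>G\<close>.\<close>

definition fiber_hessian ::
  "('x, 'e, 'n::finite, 'r::finite) hbundle \<Rightarrow> ('e \<Rightarrow> real) \<Rightarrow> ('x, 'n) chart \<Rightarrow>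
     ('x, 'e, 'r) triv \<Rightarrow> complex^('n + 'r) \<Rightarrow> complex^'r^'r" where
  "fiber_hessian B f c \<tau> u =
     (\<chi> i j. wirt (Inr i) (wirt_bar (Inr j) (\<lambda>x. complex_of_real (f (bpoint B c \<tau> x)))) u)"

definition strongly_pseudoconvex ::
  "('x, 'e, 'n::finite, 'r::finite) hbundle \<Rightarrow> ('e \<Rightarrow> real) \<Rightarrow> bool" where
  "strongly_pseudoconvex B F \<longleftrightarrow>
     (\<forall>c\<in>charts B. \<forall>\<tau>\<in>trivs B. \<forall>e. proj B e \<in> fst c \<inter> fst \<tau> \<longrightarrow> \<not> is_zero_vec B e \<longrightarrow>
        pos_def_hermitian (fiber_hessian B F c \<tau> (bcoord B c \<tau> e)))"


section \<open>Projectivization and Kobayashi curvature\<close>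

definition bline :: "('x, 'e, 'n::finite, 'r::finite) hbundle \<Rightarrow> 'e \<Rightarrow> 'e set" where
  "bline B \<zeta> = range (\<lambda>s. vscale B s \<zeta>)"

definition projectivization :: "('x, 'e, 'n::finite, 'r::finite) hbundle \<Rightarrow> 'e set set" where
  "projectivization B = {bline B \<zeta> |\<zeta>. \<not> is_zero_vec B \<zeta>}"

text \<open>
  The affine patch of the projectivization over a chart and a trivialization where
  \<open>\<zeta>\<^sub>k \<noteq> 0\<close>, with coordinates \<open>z\<^sub>\<alpha>\<close> and \<open>w\<^sub>i = \<zeta>\<^sub>i/\<zeta>\<^sub>k\<close> for \<open>i \<noteq> k\<close>. They are stored in a vector
  indexed by \<open>'n + 'r\<close> whose entry at \<open>Inr k\<close> is always \<open>1\<close> and is not a coordinate: the metric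
  does not depend on it, and the sum in the Kobayashi curvature omits it.
\<close>

definition ppatch ::
  "('x, 'e, 'n::finite, 'r::finite) hbundle \<Rightarrow> ('x, 'n) chart \<Rightarrow> ('x, 'e, 'r) triv \<Rightarrow> 'r \<Rightarrow>
     'e set set" where
  "ppatch B c \<tau> k =
     {l \<in> projectivization B. \<exists>\<zeta>\<in>l. proj B \<zeta> \<in> fst c \<inter> fst \<tau> \<and> snd \<tau> \<zeta> $ k \<noteq> 0}"

definition pcoord ::
  "('x, 'e, 'n::finite, 'r::finite) hbundle \<Rightarrow> ('x, 'n) chart \<Rightarrow> ('x, 'e, 'r) triv \<Rightarrow> 'r \<Rightarrow>
     'e set \<Rightarrow> complex^('n + 'r)" where
  "pcoord B c \<tau> k l = bcoord B c \<tau> (THE e. e \<in> l \<and> snd \<tau> e $ k = 1)"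

text \<open>
  The matrix, in the frame of \<open>\<tau>\<close>, of the Hermitian metric induced by \<open>G = F\<^sup>2\<close> on the pullback of
  the bundle to the projectivization. It does not depend on the representative of the line, so the
  one with \<open>\<zeta>\<^sub>k = 1\<close> is used.
\<close>

definition pullback_metric ::
  "('x, 'e, 'n::finite, 'r::finite) hbundle \<Rightarrow> ('e \<Rightarrow> real) \<Rightarrow> ('x, 'n) chart \<Rightarrow>
     ('x, 'e, 'r) triv \<Rightarrow> 'r \<Rightarrow> complex^('n + 'r) \<Rightarrow> complex^'r^'r" where
  "pullback_metric B F c \<tau> k u =
     fiber_hessian B (\<lambda>e. (F e)\<^sup>2) c \<tau> (\<chi> a. if a = Inr k then 1 else u $ a)"

text \<open>
  The diagonal block on the line spanned by \<open>\<zeta>\<close> of an endomorphism with matrix \<open>R\<close>, relative to the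
  decomposition into that line and its orthogonal complement for \<open>H\<close>.
\<close>

definition line_block :: "complex^'r^'r \<Rightarrow> complex^'r^'r \<Rightarrow> complex^'r \<Rightarrow> complex" where
  "line_block H R \<zeta> = herm H (\<zeta> v* R) \<zeta> / herm H \<zeta> \<zeta>"

text \<open>
  The Kobayashi curvature at the point \<open>l\<close> of the projectivization, evaluated on the tangent vector
  with components \<open>w\<close> in the patch given by \<open>c\<close>, \<open>\<tau>\<close>, \<open>k\<close> and on its conjugate. All directions,
  base and fiber, enter the sum.
\<close>

definition kobayashi_curvature ::
  "('x, 'e, 'n::finite, 'r::finite) hbundle \<Rightarrow> ('e \<Rightarrow> real) \<Rightarrow> ('x, 'n) chart \<Rightarrow>
     ('x, 'e, 'r) triv \<Rightarrow> 'r \<Rightarrow> 'e set \<Rightarrow> complex^('n + 'r) \<Rightarrow> complex" where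
  "kobayashi_curvature B F c \<tau> k l w =
     (let H = pullback_metric B F c \<tau> k; u = pcoord B c \<tau> k l; \<zeta> = (\<chi> i. u $ Inr i) in
        \<Sum>a\<in>- {Inr k}. \<Sum>b\<in>- {Inr k}.
          line_block (H u) (chern_curvature H a b u) \<zeta> * w $ a * cnj (w $ b))"

text \<open>
  The infimum is taken in the extended reals, so that finiteness is not presupposed. \<open>ddbar\<close> of a
  real-valued smooth function on \<open>(v, cnj v)\<close> is real, which makes \<open>Re\<close> a mere coercion. The chart
  \<open>c\<close> serves only to evaluate \<open>ddbar\<close>.
\<close>

definition K_curv ::
  "('x::t2_space, 'e, 'n::finite, 'r::finite) hbundle \<Rightarrow> ('e \<Rightarrow> real) \<Rightarrow> ('x, 'n) chart \<Rightarrow>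
     (('x, 'n) chart \<Rightarrow> complex^'n) \<Rightarrow> 'e \<Rightarrow> ereal" where
  "K_curv B F c v \<zeta> =
     - (INF \<phi>\<in>local_sections B \<zeta>.
          ereal (Re (ddbar c (\<lambda>z. ln ((F (\<phi> z))\<^sup>2)) (proj B \<zeta>) (v c))))"

end

theory Submission
  imports Defs "HOL-Complex_Analysis.Cauchy_Integral_Formula"
begin

text \<open>
  In coordinates \<open>(z, \<zeta>)\<close> write \<open>L(V, W)\<close> for the complex Hessian form of \<open>G\<close> on the total space and
  \<open>H\<close> for its restriction to the fiber directions. Let \<open>V* = (v, X)\<close> be the lift of \<open>v\<close> that is
  \<open>L\<close>-orthogonal to the fiber directions. Euler's identities for the homogeneous function \<open>G\<close> give
  \<open>\<partial>G(V) = L(V, (0, \<zeta>))\<close> and \<open>G = H(\<zeta>, \<zeta>)\<close>, and, differentiated once or twice more, they turn the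
  Chern curvature into \<open>\<Theta>(v, v) = - L(V*, V*) / G\<close>.

  A section \<open>\<phi>\<close> through \<open>\<zeta>\<close> maps \<open>v\<close> to a tangent vector \<open>V* + (0, Y)\<close>, where every \<open>Y\<close> occurs, and by
  the chain rule for holomorphic maps the complex Hessian of \<open>log G(\<phi>)\<close> in the direction \<open>v\<close> is
  \<open>(L(V*, V*) + H(Y, Y)) / G - |H(Y, \<zeta>)|\<^sup>2 / G\<^sup>2\<close>. By the Cauchy-Schwarz inequality for \<open>H\<close> it is
  minimal for \<open>Y = 0\<close>.
\<close>

section \<open>Smooth functions\<close>

text \<open>Two obstacles shape the groundwork. \<open>holo_on\<close> grants only one complex
  derivative, yet the second-order chain rule differentiates the Jacobian of a section; so
  derivatives of holomorphic functions must be shown to be holomorphic again, by restriction to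
  complex lines. \<open>smooth_on\<close> speaks of iterated derivatives in fixed directions, so
  equality of mixed derivatives is derived from mean values. The curvature and the lift are linked
  through the connection matrices theta_a. By Euler's identities y_a = zeta theta_a solves y_a H =
  (G_{a jbar}) for a base index a and vanishes for a fiber index. So the vectors -y_a are the fiber
  coefficients of the lift, and the curvature contracted twice with zeta is minus the Schur
  complement G_{a bbar} - sum_l y_a^l G_{l bbar}. Fiber directions drop out, which is why the choice
  of the lift of v to the projectivization is immaterial. The orthogonal lift depends linearly on v,
  so a section that is affine in coordinates with the slopes -y_a attains the infimum.\<close>

lemma frechet_derivative_cong_open:
  assumes "open S" "x \<in> S" "\<And>y. y \<in> S \<Longrightarrow> f y = g y"
  shows "frechet_derivative f (at x) = frechet_derivative g (at x)"
proof -
  have "(f has_derivative D) (at x) \<longleftrightarrow> (g has_derivative D) (at x)" for D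
    using has_derivative_transform_within_open[OF _ assms(1,2)] assms(3) by metis
  then show ?thesis unfolding frechet_derivative_def by simp
qed

lemma differentiable_cong_open:
  assumes "open S" "x \<in> S" "\<And>y. y \<in> S \<Longrightarrow> f y = g y"
  shows "f differentiable (at x) \<longleftrightarrow> g differentiable (at x)"
  using has_derivative_transform_within_open[OF _ assms(1,2)] assms(3)
  unfolding differentiable_def by metis

lemma cont_diff_on_cong:
  assumes "open S" "\<And>y. y \<in> S \<Longrightarrow> f y = g y"
  shows "cont_diff_on k f S \<longleftrightarrow> cont_diff_on k g S"
  using assms
proof (induction k arbitrary: f g)
  case 0
  then show ?case by (simp cong: continuous_on_cong)
next
  case (Suc k)
  have d: "frechet_derivative f (at x) = frechet_derivative g (at x)" if "x \<in> S" for x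
    by (rule frechet_derivative_cong_open[OF Suc.prems(1) that Suc.prems(2)])
  have "cont_diff_on k (\<lambda>x. frechet_derivative f (at x) v) S
      \<longleftrightarrow> cont_diff_on k (\<lambda>x. frechet_derivative g (at x) v) S" for v
    by (rule Suc.IH) (use Suc.prems d in auto)
  moreover have "f differentiable (at x) \<longleftrightarrow> g differentiable (at x)" if "x \<in> S" for x
    by (rule differentiable_cong_open[OF Suc.prems(1) that Suc.prems(2)])
  ultimately show ?case by simp
qed

lemma cont_diff_on_Suc_imp: "cont_diff_on (Suc k) f S \<Longrightarrow> cont_diff_on k f S"
proof (induction k arbitrary: f)
  case 0
  then show ?case
    by (auto intro: differentiable_imp_continuous_on differentiable_at_imp_differentiable_on)
next
  case (Suc k)
  then show ?case by (metis cont_diff_on.simps(2))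
qed

lemma cont_diff_on_bounded_linear:
  assumes "bounded_linear L" "open S" "cont_diff_on k f S"
  shows "cont_diff_on k (\<lambda>x. L (f x)) S"
  using assms(3)
proof (induction k arbitrary: f)
  case 0
  then show ?case
    using assms(1) by (auto intro: bounded_linear.continuous_on)
next
  case (Suc k)
  have d: "((\<lambda>x. L (f x)) has_derivative (\<lambda>h. L (frechet_derivative f (at x) h))) (at x)"
    if "x \<in> S" for x
    using Suc.prems that
    by (intro bounded_linear.has_derivative[OF assms(1)]) (simp add: frechet_derivative_works)
  have "cont_diff_on k (\<lambda>x. frechet_derivative (\<lambda>x. L (f x)) (at x) v) S" for v
  proof -
    have "cont_diff_on k (\<lambda>x. L (frechet_derivative f (at x) v)) S"
      using Suc by simp
    then show ?thesis
      by (rule cont_diff_on_cong[OF assms(2), THEN iffD2, rotated])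
        (simp add: frechet_derivative_at[OF d, symmetric])
  qed
  then show ?case using d by (auto intro: differentiableI)
qed

lemma cont_diff_on_add:
  assumes "open S" "cont_diff_on k f S" "cont_diff_on k g S"
  shows "cont_diff_on k (\<lambda>x. f x + g x) S"
  using assms(2,3)
proof (induction k arbitrary: f g)
  case 0
  then show ?case by (auto intro: continuous_intros)
next
  case (Suc k)
  have d: "((\<lambda>x. f x + g x) has_derivative
      (\<lambda>h. frechet_derivative f (at x) h + frechet_derivative g (at x) h)) (at x)"
    if "x \<in> S" for x
    using Suc.prems that by (intro has_derivative_add) (simp_all add: frechet_derivative_works)
  have "cont_diff_on k (\<lambda>x. frechet_derivative (\<lambda>x. f x + g x) (at x) v) S" for v
  proof -
    have "cont_diff_on k (\<lambda>x. frechet_derivative f (at x) v + frechet_derivative g (at x) v) S"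
      using Suc by simp
    then show ?thesis
      by (rule cont_diff_on_cong[OF assms(1), THEN iffD2, rotated])
        (simp add: frechet_derivative_at[OF d, symmetric])
  qed
  then show ?case using d by (auto intro: differentiableI)
qed

lemma cont_diff_on_bilinear:
  assumes "bounded_bilinear p" "open S" "cont_diff_on k f S" "cont_diff_on k g S"
  shows "cont_diff_on k (\<lambda>x. p (f x) (g x)) S"
  using assms(3,4)
proof (induction k arbitrary: f g)
  case 0
  then show ?case using assms(1) by (auto intro: bounded_bilinear.continuous_on)
next
  case (Suc k)
  have d: "((\<lambda>x. p (f x) (g x)) has_derivative
      (\<lambda>h. p (f x) (frechet_derivative g (at x) h) + p (frechet_derivative f (at x) h) (g x))) (at x)"
    if "x \<in> S" for x
    using Suc.prems that
    by (intro bounded_bilinear.FDERIV[OF assms(1)]) (simp_all add: frechet_derivative_works)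
  have "cont_diff_on k (\<lambda>x. frechet_derivative (\<lambda>x. p (f x) (g x)) (at x) v) S" for v
  proof -
    \<comment> \<open>The product rule contains \<open>f\<close> and \<open>g\<close> themselves
      besides their derivatives, so the induction hypothesis needs them at the lower order
      \<open>k\<close>.\<close>
    have "cont_diff_on k f S" "cont_diff_on k g S"
      using Suc.prems cont_diff_on_Suc_imp by blast+
    then have "cont_diff_on k (\<lambda>x. p (f x) (frechet_derivative g (at x) v)
        + p (frechet_derivative f (at x) v) (g x)) S"
      using Suc.prems by (intro cont_diff_on_add[OF assms(2)] Suc.IH) auto
    then show ?thesis
      by (rule cont_diff_on_cong[OF assms(2), THEN iffD2, rotated])
        (simp add: frechet_derivative_at[OF d, symmetric])
  qed
  then show ?case using d by (auto intro: differentiableI)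
qed

lemma smooth_on_bounded_linear:
  "bounded_linear L \<Longrightarrow> open S \<Longrightarrow> smooth_on f S \<Longrightarrow> smooth_on (\<lambda>x. L (f x)) S"
  unfolding smooth_on_def using cont_diff_on_bounded_linear by blast

lemma smooth_on_add:
  "open S \<Longrightarrow> smooth_on f S \<Longrightarrow> smooth_on g S \<Longrightarrow> smooth_on (\<lambda>x. f x + g x) S"
  unfolding smooth_on_def using cont_diff_on_add by blast

lemma smooth_on_mult:
  fixes f g :: "'a::real_normed_vector \<Rightarrow> 'b::real_normed_algebra"
  shows "open S \<Longrightarrow> smooth_on f S \<Longrightarrow> smooth_on g S \<Longrightarrow> smooth_on (\<lambda>x. f x * g x) S"
  unfolding smooth_on_def using cont_diff_on_bilinear[OF bounded_bilinear_mult] by blast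

lemma smooth_on_differentiable: "smooth_on f S \<Longrightarrow> x \<in> S \<Longrightarrow> f differentiable (at x)"
  unfolding smooth_on_def by (metis cont_diff_on.simps(2))

lemma smooth_on_continuous: "smooth_on f S \<Longrightarrow> continuous_on S f"
  unfolding smooth_on_def by (metis cont_diff_on.simps(1))

lemma smooth_on_frechet_derivative:
  "smooth_on f S \<Longrightarrow> smooth_on (\<lambda>x. frechet_derivative f (at x) v) S"
  unfolding smooth_on_def by (metis cont_diff_on.simps(2))

lemma smooth_on_wirt:
  assumes "open S" "smooth_on f S"
  shows "smooth_on (wirt a f) S" "smooth_on (wirt_bar a f) S"
proof -
  have l: "bounded_linear (\<lambda>z::complex. z / 2)" "bounded_linear (\<lambda>z::complex. - \<i> * z / 2)"
    "bounded_linear (\<lambda>z::complex. \<i> * z / 2)"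
    using bounded_linear_mult_right[of "1/2::complex"] bounded_linear_mult_right[of "- \<i>/2"]
      bounded_linear_mult_right[of "\<i>/2"] by simp_all
  have *: "smooth_on (\<lambda>x. frechet_derivative f (at x) v) S" for v
    by (rule smooth_on_frechet_derivative[OF assms(2)])
  have "smooth_on (\<lambda>x. frechet_derivative f (at x) (axis a 1) / 2
      + - \<i> * frechet_derivative f (at x) (axis a \<i>) / 2) S"
    by (intro smooth_on_add smooth_on_bounded_linear[OF l(1)] smooth_on_bounded_linear[OF l(2)] * assms(1))
  then show "smooth_on (wirt a f) S"
    unfolding wirt_def by (simp add: diff_divide_distrib)
  have "smooth_on (\<lambda>x. frechet_derivative f (at x) (axis a 1) / 2
      + \<i> * frechet_derivative f (at x) (axis a \<i>) / 2) S"
    by (intro smooth_on_add smooth_on_bounded_linear[OF l(1)] smooth_on_bounded_linear[OF l(3)] * assms(1))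
  then show "smooth_on (wirt_bar a f) S"
    unfolding wirt_bar_def by (simp add: add_divide_distrib)
qed

section \<open>Wirtinger calculus\<close>

text \<open>The general real-linear map from complex vectors to complex numbers: \<open>p\<close>
  and \<open>q\<close> are the coefficients of the differentials of the coordinates and of their
  conjugates. Derivatives in this form can be handled by comparing coefficients instead of
  directional derivatives.\<close>

definition wirtinger_form ::
  "('m::finite \<Rightarrow> complex) \<Rightarrow> ('m \<Rightarrow> complex) \<Rightarrow> complex^'m \<Rightarrow> complex" where
  "wirtinger_form p q h = (\<Sum>a\<in>UNIV. p a * h $ a + q a * cnj (h $ a))"

lemma complex_vec_expand:
  fixes h :: "complex^'m"
  shows "h = (\<Sum>a\<in>UNIV. Re (h $ a) *\<^sub>R axis a 1 + Im (h $ a) *\<^sub>R axis a \<i>)"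
  by (simp add: vec_eq_iff axis_def if_distrib complex_eq_iff cong: if_cong)

lemma linear_wirtinger_form:
  fixes D :: "complex^'m \<Rightarrow> complex"
  assumes "linear D"
  shows "D = wirtinger_form (\<lambda>a. (D (axis a 1) - \<i> * D (axis a \<i>)) / 2)
                            (\<lambda>a. (D (axis a 1) + \<i> * D (axis a \<i>)) / 2)"
proof
  fix h
  have "D h = D (\<Sum>a\<in>UNIV. Re (h $ a) *\<^sub>R axis a 1 + Im (h $ a) *\<^sub>R axis a \<i>)"
    using complex_vec_expand[of h] by simp
  also have "\<dots> = (\<Sum>a\<in>UNIV. Re (h $ a) *\<^sub>R D (axis a 1) + Im (h $ a) *\<^sub>R D (axis a \<i>))"
    by (simp add: linear_sum[OF assms] linear_add[OF assms] linear_scale[OF assms])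
  also have "\<dots> = (\<Sum>a\<in>UNIV. (D (axis a 1) - \<i> * D (axis a \<i>)) / 2 * h $ a
      + (D (axis a 1) + \<i> * D (axis a \<i>)) / 2 * cnj (h $ a))"
    by (intro sum.cong refl) (simp add: complex_eq_iff field_simps)
  finally show "D h = wirtinger_form (\<lambda>a. (D (axis a 1) - \<i> * D (axis a \<i>)) / 2)
      (\<lambda>a. (D (axis a 1) + \<i> * D (axis a \<i>)) / 2) h"
    by (simp add: wirtinger_form_def)
qed

lemma wirtinger_form_axis:
  "wirtinger_form p q (axis a s) = p a * s + q a * cnj s"
proof -
  have "p b * axis a s $ b + q b * cnj (axis a s $ b) = (if b = a then p a * s + q a * cnj s else 0)" for b
    by (simp add: axis_def)
  then show ?thesis by (simp add: wirtinger_form_def)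
qed

lemma has_derivative_wirtinger:
  assumes "f differentiable (at x)"
  shows "(f has_derivative wirtinger_form (\<lambda>a. wirt a f x) (\<lambda>a. wirt_bar a f x)) (at x)"
  using assms linear_wirtinger_form[OF linear_frechet_derivative[OF assms]]
  unfolding wirt_def wirt_bar_def frechet_derivative_works by simp

text \<open>The basic way to compute Wirtinger derivatives: the values of a
  \<open>wirtinger_form\<close> on \<open>axis a 1\<close> and \<open>axis a \<i>\<close> determine
  its coefficients. The rules for sums, products, conjugates and compositions below rest on
  it.\<close>

lemma wirt_eqI:
  assumes "(f has_derivative wirtinger_form p q) (at x)"
  shows "wirt a f x = p a" "wirt_bar a f x = q a"
  unfolding wirt_def wirt_bar_def frechet_derivative_at[OF assms, symmetric] wirtinger_form_axis
  by (simp_all add: algebra_simps)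

lemma wirt_cong:
  assumes "open S" "x \<in> S" "\<And>y. y \<in> S \<Longrightarrow> f y = g y"
  shows "wirt a f x = wirt a g x" "wirt_bar a f x = wirt_bar a g x"
  using frechet_derivative_cong_open[of S x f g] assms by (simp_all add: wirt_def wirt_bar_def)

lemma wirt_const [simp]: "wirt a (\<lambda>x. s) x = 0" "wirt_bar a (\<lambda>x. s) x = 0"
  by (simp_all add: wirt_def wirt_bar_def)

lemma wirt_add:
  assumes "f differentiable (at x)" "g differentiable (at x)"
  shows "wirt a (\<lambda>x. f x + g x) x = wirt a f x + wirt a g x"
    "wirt_bar a (\<lambda>x. f x + g x) x = wirt_bar a f x + wirt_bar a g x"
proof -
  have "((\<lambda>x. f x + g x) has_derivative wirtinger_form (\<lambda>a. wirt a f x + wirt a g x)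
      (\<lambda>a. wirt_bar a f x + wirt_bar a g x)) (at x)"
    using has_derivative_add[OF has_derivative_wirtinger[OF assms(1)] has_derivative_wirtinger[OF assms(2)]]
    by (simp add: wirtinger_form_def[abs_def] sum.distrib algebra_simps)
  from wirt_eqI[OF this] show "wirt a (\<lambda>x. f x + g x) x = wirt a f x + wirt a g x"
    "wirt_bar a (\<lambda>x. f x + g x) x = wirt_bar a f x + wirt_bar a g x" by simp_all
qed

lemma wirt_mult:
  assumes "f differentiable (at x)" "g differentiable (at x)"
  shows "wirt a (\<lambda>x. f x * g x) x = f x * wirt a g x + wirt a f x * g x"
    "wirt_bar a (\<lambda>x. f x * g x) x = f x * wirt_bar a g x + wirt_bar a f x * g x"
proof -
  have "((\<lambda>x. f x * g x) has_derivative wirtinger_form (\<lambda>a. f x * wirt a g x + wirt a f x * g x)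
      (\<lambda>a. f x * wirt_bar a g x + wirt_bar a f x * g x)) (at x)"
    using has_derivative_mult[OF has_derivative_wirtinger[OF assms(1)] has_derivative_wirtinger[OF assms(2)]]
    by (simp add: wirtinger_form_def[abs_def] sum.distrib sum_distrib_left sum_distrib_right algebra_simps)
  from wirt_eqI[OF this] show "wirt a (\<lambda>x. f x * g x) x = f x * wirt a g x + wirt a f x * g x"
    "wirt_bar a (\<lambda>x. f x * g x) x = f x * wirt_bar a g x + wirt_bar a f x * g x" by simp_all
qed

lemma wirt_cmult:
  assumes "f differentiable (at x)"
  shows "wirt a (\<lambda>x. s * f x) x = s * wirt a f x"
    "wirt_bar a (\<lambda>x. s * f x) x = s * wirt_bar a f x"
  using wirt_mult[of "\<lambda>_. s", OF differentiable_const assms] by simp_all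

lemma wirt_sum:
  assumes "finite I" "\<And>i. i \<in> I \<Longrightarrow> f i differentiable (at x)"
  shows "wirt a (\<lambda>x. \<Sum>i\<in>I. f i x) x = (\<Sum>i\<in>I. wirt a (f i) x)"
    "wirt_bar a (\<lambda>x. \<Sum>i\<in>I. f i x) x = (\<Sum>i\<in>I. wirt_bar a (f i) x)"
  using assms by (induction I rule: finite_induct) (simp_all add: wirt_add differentiable_sum)

lemma differentiable_cnj:
  assumes "f differentiable (at x)"
  shows "(\<lambda>x. cnj (f x)) differentiable (at x)"
  using bounded_linear.has_derivative[OF bounded_linear_cnj] assms
  unfolding differentiable_def by blast

lemma wirt_cnj:
  assumes "f differentiable (at x)"
  shows "wirt a (\<lambda>x. cnj (f x)) x = cnj (wirt_bar a f x)"
    "wirt_bar a (\<lambda>x. cnj (f x)) x = cnj (wirt a f x)"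
proof -
  have "((\<lambda>x. cnj (f x)) has_derivative wirtinger_form (\<lambda>a. cnj (wirt_bar a f x))
      (\<lambda>a. cnj (wirt a f x))) (at x)"
    using bounded_linear.has_derivative[OF bounded_linear_cnj has_derivative_wirtinger[OF assms]]
    by (simp add: wirtinger_form_def[abs_def] sum.distrib algebra_simps)
  from wirt_eqI[OF this] show "wirt a (\<lambda>x. cnj (f x)) x = cnj (wirt_bar a f x)"
    "wirt_bar a (\<lambda>x. cnj (f x)) x = cnj (wirt a f x)" by simp_all
qed

lemma differentiable_component [simp]: "(\<lambda>x::complex^'m. x $ b) differentiable (at x)"
  by (rule bounded_linear_imp_differentiable) (rule bounded_linear_vec_nth)

lemma wirt_component:
  "wirt a (\<lambda>x. x $ b) x = (if a = b then 1 else 0)" "wirt_bar a (\<lambda>x. x $ b) x = 0"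
proof -
  have "wirtinger_form (\<lambda>a. if a = b then 1 else 0) (\<lambda>a. 0) = (\<lambda>x. x $ b)"
    by (simp add: wirtinger_form_def[abs_def] if_distrib if_distribR cong: if_cong)
  then have "((\<lambda>x. x $ b) has_derivative wirtinger_form (\<lambda>a. if a = b then 1 else 0) (\<lambda>a. 0)) (at x)"
    using bounded_linear_imp_has_derivative[OF bounded_linear_vec_nth] by metis
  from wirt_eqI[OF this] show "wirt a (\<lambda>x. x $ b) x = (if a = b then 1 else 0)"
    "wirt_bar a (\<lambda>x. x $ b) x = 0" by simp_all
qed

text \<open>The derivative of \<open>\<Phi>\<close> is complex linear with matrix \<open>J\<close>,
  so conjugate differentials pull back to conjugate differentials and the two kinds of derivatives
  do not mix.\<close>

lemma wirt_chain:
  fixes f :: "complex^'m \<Rightarrow> complex" and \<Phi> D :: "complex^'n \<Rightarrow> complex^'m"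
  assumes "(\<Phi> has_derivative D) (at x)" "f differentiable (at (\<Phi> x))"
    and "\<And>h b. D h $ b = (\<Sum>\<alpha>\<in>UNIV. J b \<alpha> * h $ \<alpha>)"
  shows "wirt \<alpha> (\<lambda>x. f (\<Phi> x)) x = (\<Sum>b\<in>UNIV. wirt b f (\<Phi> x) * J b \<alpha>)"
    "wirt_bar \<alpha> (\<lambda>x. f (\<Phi> x)) x = (\<Sum>b\<in>UNIV. wirt_bar b f (\<Phi> x) * cnj (J b \<alpha>))"
proof -
  have "wirtinger_form (\<lambda>a. wirt a f (\<Phi> x)) (\<lambda>a. wirt_bar a f (\<Phi> x)) (D h)
    = wirtinger_form (\<lambda>\<alpha>. \<Sum>b\<in>UNIV. wirt b f (\<Phi> x) * J b \<alpha>)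
         (\<lambda>\<alpha>. \<Sum>b\<in>UNIV. wirt_bar b f (\<Phi> x) * cnj (J b \<alpha>)) h" for h
    unfolding wirtinger_form_def assms(3) sum.distrib
    by (simp add: sum_distrib_left sum_distrib_right mult.assoc,
      intro arg_cong2[where f="(+)"]; rule sum.swap)
  then have "((\<lambda>x. f (\<Phi> x)) has_derivative wirtinger_form (\<lambda>\<alpha>. \<Sum>b\<in>UNIV. wirt b f (\<Phi> x) * J b \<alpha>)
         (\<lambda>\<alpha>. \<Sum>b\<in>UNIV. wirt_bar b f (\<Phi> x) * cnj (J b \<alpha>))) (at x)"
    using has_derivative_compose[OF assms(1) has_derivative_wirtinger[OF assms(2)]] by simp
  from wirt_eqI[OF this] show "wirt \<alpha> (\<lambda>x. f (\<Phi> x)) x = (\<Sum>b\<in>UNIV. wirt b f (\<Phi> x) * J b \<alpha>)"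
    "wirt_bar \<alpha> (\<lambda>x. f (\<Phi> x)) x = (\<Sum>b\<in>UNIV. wirt_bar b f (\<Phi> x) * cnj (J b \<alpha>))"
    by simp_all
qed

section \<open>Symmetry of second derivatives\<close>

lemma second_difference_mvt:
  fixes f :: "'a::real_normed_vector \<Rightarrow> real"
  assumes "s > 0"
    and f: "\<And>a b. 0 \<le> a \<Longrightarrow> a \<le> s \<Longrightarrow> 0 \<le> b \<Longrightarrow> b \<le> s \<Longrightarrow> f differentiable (at (x + a *\<^sub>R v + b *\<^sub>R w))"
    and f': "\<And>a b. 0 \<le> a \<Longrightarrow> a \<le> s \<Longrightarrow> 0 \<le> b \<Longrightarrow> b \<le> s \<Longrightarrow>
      (\<lambda>y. frechet_derivative f (at y) v) differentiable (at (x + a *\<^sub>R v + b *\<^sub>R w))"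
  obtains a b where "0 \<le> a" "a \<le> s" "0 \<le> b" "b \<le> s"
    "f (x + s *\<^sub>R v + s *\<^sub>R w) - f (x + s *\<^sub>R v) - f (x + s *\<^sub>R w) + f x
      = s\<^sup>2 * frechet_derivative (\<lambda>y. frechet_derivative f (at y) v) (at (x + a *\<^sub>R v + b *\<^sub>R w)) w"
proof -
  define D where "D y = frechet_derivative f (at y)" for y
  have D: "(f has_derivative D y) (at y)" if "y = x + a *\<^sub>R v + b *\<^sub>R w" "0 \<le> a" "a \<le> s" "0 \<le> b" "b \<le> s" for y a b
    using f[of a b] that unfolding D_def frechet_derivative_works by simp
  \<comment> \<open>The second difference is the increment of \<open>g\<close> from 0 to
    \<open>s\<close>. One mean value, in \<open>a\<close>, turns it into the increment of a
    directional derivative; another, in \<open>b\<close>, yields the mixed derivative.\<close>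
  define g where "g a = f (x + a *\<^sub>R v + s *\<^sub>R w) - f (x + a *\<^sub>R v)" for a
  have lin: "D y (t *\<^sub>R u) = t * D y u" if "(f has_derivative D y) (at y)" for y t u
    using linear_scale[OF has_derivative_linear[OF that]] by simp
  have gd: "(g has_derivative (\<lambda>t. t * (D (x + a *\<^sub>R v + s *\<^sub>R w) v - D (x + a *\<^sub>R v) v))) (at a)"
    if a: "0 \<le> a" "a \<le> s" for a
  proof -
    have 1: "(f has_derivative D (x + a *\<^sub>R v + s *\<^sub>R w)) (at (x + a *\<^sub>R v + s *\<^sub>R w))"
      "(f has_derivative D (x + a *\<^sub>R v)) (at (x + a *\<^sub>R v))"
      using D[of _ a s] D[of _ a 0] a \<open>s > 0\<close> by auto
    have "((\<lambda>a. x + a *\<^sub>R v + s *\<^sub>R w) has_derivative (\<lambda>t. t *\<^sub>R v)) (at a)"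
      "((\<lambda>a. x + a *\<^sub>R v) has_derivative (\<lambda>t. t *\<^sub>R v)) (at a)"
      by (auto intro!: derivative_eq_intros)
    then have "((\<lambda>a. f (x + a *\<^sub>R v + s *\<^sub>R w)) has_derivative
          (\<lambda>t. D (x + a *\<^sub>R v + s *\<^sub>R w) (t *\<^sub>R v))) (at a)"
      "((\<lambda>a. f (x + a *\<^sub>R v)) has_derivative (\<lambda>t. D (x + a *\<^sub>R v) (t *\<^sub>R v))) (at a)"
      using has_derivative_compose 1 by blast+
    from has_derivative_diff[OF this] show ?thesis
      unfolding g_def by (simp only: lin[OF 1(1)] lin[OF 1(2)] right_diff_distrib)
  qed
  have "continuous_on {0..s} g"
    using gd has_derivative_continuous by (intro continuous_at_imp_continuous_on) fastforce
  from mvt[OF \<open>s > 0\<close> this gd] obtain a where a: "0 < a" "a < s"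
    and g: "g s - g 0 = s * (D (x + a *\<^sub>R v + s *\<^sub>R w) v - D (x + a *\<^sub>R v) v)" by auto
  define h where "h b = D (x + a *\<^sub>R v + b *\<^sub>R w) v" for b
  define E where "E y = frechet_derivative (\<lambda>y. D y v) (at y)" for y
  have hd: "(h has_derivative (\<lambda>t. t * E (x + a *\<^sub>R v + b *\<^sub>R w) w)) (at b)" if b: "0 \<le> b" "b \<le> s" for b
  proof -
    have 1: "((\<lambda>y. D y v) has_derivative E (x + a *\<^sub>R v + b *\<^sub>R w)) (at (x + a *\<^sub>R v + b *\<^sub>R w))"
      using f'[of a b] a b unfolding D_def E_def frechet_derivative_works by simp
    have "((\<lambda>b. x + a *\<^sub>R v + b *\<^sub>R w) has_derivative (\<lambda>t. t *\<^sub>R w)) (at b)"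
      by (auto intro!: derivative_eq_intros)
    from has_derivative_compose[OF this 1] show ?thesis
      unfolding h_def using linear_scale[OF has_derivative_linear[OF 1]] by simp
  qed
  have "continuous_on {0..s} h"
    using hd has_derivative_continuous by (intro continuous_at_imp_continuous_on) fastforce
  from mvt[OF \<open>s > 0\<close> this hd] obtain b where b: "0 < b" "b < s"
    and h: "h s - h 0 = s * E (x + a *\<^sub>R v + b *\<^sub>R w) w" by auto
  show ?thesis
  proof (rule that[of a b])
    show "f (x + s *\<^sub>R v + s *\<^sub>R w) - f (x + s *\<^sub>R v) - f (x + s *\<^sub>R w) + f x
      = s\<^sup>2 * frechet_derivative (\<lambda>y. frechet_derivative f (at y) v) (at (x + a *\<^sub>R v + b *\<^sub>R w)) w"
      using g h unfolding g_def h_def E_def D_def by (simp add: power2_eq_square)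
  qed (use a b in auto)
qed

text \<open>The mean values put the mixed derivative at some point of a small parallelogram, and its
  continuity moves it to \<open>x\<close>. The difference quotient does not change when
  \<open>v\<close> and \<open>w\<close> are interchanged, so its limit cannot change either.\<close>

lemma second_derivative_limit:
  fixes f :: "'a::real_normed_vector \<Rightarrow> real"
  assumes "open S" "smooth_on f S" "x \<in> S"
  shows "((\<lambda>s. (f (x + s *\<^sub>R v + s *\<^sub>R w) - f (x + s *\<^sub>R v) - f (x + s *\<^sub>R w) + f x) / s\<^sup>2)
    \<longlongrightarrow> frechet_derivative (\<lambda>y. frechet_derivative f (at y) v) (at x) w) (at_right 0)"
proof (rule tendstoI)
  fix e :: real assume "e > 0"
  define E where "E y = frechet_derivative (\<lambda>y. frechet_derivative f (at y) v) (at y) w" for y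
  have "continuous_on S E"
    unfolding E_def
    by (intro smooth_on_continuous smooth_on_frechet_derivative assms(2))
  then have "isCont E x" using assms(1,3) continuous_on_eq_continuous_at by blast
  then obtain d where "d > 0" and d: "\<And>y. dist y x < d \<Longrightarrow> dist (E y) (E x) < e"
    using \<open>e > 0\<close> unfolding continuous_at_eps_delta dist_norm by metis
  obtain r where "r > 0" and r: "ball x r \<subseteq> S" using assms(1,3) openE by blast
  \<comment> \<open>With this bound the points \<open>x + a *\<^sub>R v + b *\<^sub>R w\<close> stay
    in the ball inside \<open>S\<close> and where \<open>E\<close> is close to \<open>E x\<close>;
    the summand 1 covers \<open>v = w = 0\<close>.\<close>
  define m where "m = min d r / (1 + norm v + norm w)"
  have pos: "1 + norm v + norm w > 0" by (simp add: add_pos_nonneg)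
  have "m > 0" unfolding m_def using \<open>d > 0\<close> \<open>r > 0\<close> pos by simp
  have near: "norm (a *\<^sub>R v + b *\<^sub>R w) < min d r" if "0 \<le> a" "a < m" "0 \<le> b" "b < m" for a b
  proof -
    have "norm (a *\<^sub>R v + b *\<^sub>R w) \<le> a * norm v + b * norm w"
      using norm_triangle_ineq[of "a *\<^sub>R v" "b *\<^sub>R w"] that by simp
    also have "\<dots> \<le> m * norm v + m * norm w"
      using that by (intro add_mono mult_right_mono) auto
    also have "\<dots> < m * (1 + norm v + norm w)" using \<open>m > 0\<close> by (simp add: algebra_simps)
    also have "\<dots> = min d r" unfolding m_def using pos by simp
    finally show ?thesis .
  qed
  have "dist ((f (x + s *\<^sub>R v + s *\<^sub>R w) - f (x + s *\<^sub>R v) - f (x + s *\<^sub>R w) + f x) / s\<^sup>2) (E x) < e"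
    if s: "0 < s" "s < m" for s
  proof -
    have mem: "x + a *\<^sub>R v + b *\<^sub>R w \<in> S" if "0 \<le> a" "a \<le> s" "0 \<le> b" "b \<le> s" for a b
      using near[of a b] that s norm_minus_commute[of x "x + a *\<^sub>R v + b *\<^sub>R w"]
      by (intro subsetD[OF r]) (simp add: dist_norm add.assoc)
    obtain a b where ab: "0 \<le> a" "a \<le> s" "0 \<le> b" "b \<le> s" and
      eq: "f (x + s *\<^sub>R v + s *\<^sub>R w) - f (x + s *\<^sub>R v) - f (x + s *\<^sub>R w) + f x
        = s\<^sup>2 * E (x + a *\<^sub>R v + b *\<^sub>R w)"
      unfolding E_def
    proof (rule second_difference_mvt[OF \<open>0 < s\<close>, of f x v w])
      show "f differentiable at (x + a *\<^sub>R v + b *\<^sub>R w)"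
        "(\<lambda>y. frechet_derivative f (at y) v) differentiable at (x + a *\<^sub>R v + b *\<^sub>R w)"
        if "0 \<le> a" "a \<le> s" "0 \<le> b" "b \<le> s" for a b
        using mem[OF that] assms(2) smooth_on_differentiable smooth_on_frechet_derivative by blast+
    qed
    have "dist (x + a *\<^sub>R v + b *\<^sub>R w) x < d"
      using near[of a b] ab s by (simp add: dist_norm add.assoc)
    then show ?thesis using d eq s by simp
  qed
  then show "\<forall>\<^sub>F s in at_right 0. dist ((f (x + s *\<^sub>R v + s *\<^sub>R w) - f (x + s *\<^sub>R v) - f (x + s *\<^sub>R w) + f x) / s\<^sup>2)
     (frechet_derivative (\<lambda>y. frechet_derivative f (at y) v) (at x) w) < e"
    unfolding E_def eventually_at_right_field using \<open>m > 0\<close> by blast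
qed

lemma second_derivative_symmetric:
  fixes f :: "'a::real_normed_vector \<Rightarrow> real"
  assumes "open S" "smooth_on f S" "x \<in> S"
  shows "frechet_derivative (\<lambda>y. frechet_derivative f (at y) v) (at x) w
    = frechet_derivative (\<lambda>y. frechet_derivative f (at y) w) (at x) v"
proof -
  have eq: "f (x + s *\<^sub>R w + s *\<^sub>R v) - f (x + s *\<^sub>R w) - f (x + s *\<^sub>R v) + f x
    = f (x + s *\<^sub>R v + s *\<^sub>R w) - f (x + s *\<^sub>R v) - f (x + s *\<^sub>R w) + f x" for s
    by (simp add: add.assoc add.commute[of "s *\<^sub>R w"])
  have "((\<lambda>s. (f (x + s *\<^sub>R v + s *\<^sub>R w) - f (x + s *\<^sub>R v) - f (x + s *\<^sub>R w) + f x) / s\<^sup>2)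
    \<longlongrightarrow> frechet_derivative (\<lambda>y. frechet_derivative f (at y) w) (at x) v) (at_right 0)"
    using second_derivative_limit[OF assms, of w v] by (simp only: eq)
  from tendsto_unique[OF _ second_derivative_limit[OF assms, of v w] this] show ?thesis by simp
qed

text \<open>Stated for real-valued \<open>f\<close>, since the symmetry of second derivatives came
  from the mean value theorem. Both sides expand into second derivatives along the four pairs of
  real and imaginary directions.\<close>

lemma wirt_commute:
  fixes f :: "complex^'m \<Rightarrow> real"
  assumes S: "open S" and f: "smooth_on f S" and x: "x \<in> S"
  shows "wirt_bar b (wirt a (\<lambda>x. complex_of_real (f x))) x = wirt a (wirt_bar b (\<lambda>x. complex_of_real (f x))) x"
proof -
  let ?g = "\<lambda>x. complex_of_real (f x)"
  let ?D = "\<lambda>v x. frechet_derivative ?g (at x) v"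
  have fd: "f differentiable (at y)" if "y \<in> S" for y
    using smooth_on_differentiable[OF f that] .
  have fD: "(\<lambda>y. frechet_derivative f (at y) v) differentiable (at x)" for v
    using smooth_on_differentiable[OF smooth_on_frechet_derivative[OF f] x] .
  have D: "?D v y = complex_of_real (frechet_derivative f (at y) v)" if "y \<in> S" for v y
    using has_derivative_of_real[OF fd[OF that, unfolded frechet_derivative_works]]
    by (metis frechet_derivative_at)
  have gD': "(?D v has_derivative (\<lambda>w. complex_of_real
      (frechet_derivative (\<lambda>y. frechet_derivative f (at y) v) (at x) w))) (at x)" for v
    by (rule has_derivative_transform_within_open[OF
        has_derivative_of_real[OF fD[unfolded frechet_derivative_works]] S x]) (simp add: D)
  have gD: "?D v differentiable (at x)" for v
    using gD' differentiableI by blast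
  have DD: "frechet_derivative (?D v) (at x) w
    = complex_of_real (frechet_derivative (\<lambda>y. frechet_derivative f (at y) v) (at x) w)" for v w
    by (simp add: frechet_derivative_at[OF gD', symmetric])
  have sym: "frechet_derivative (?D v) (at x) w = frechet_derivative (?D w) (at x) v" for v w
    unfolding DD using second_derivative_symmetric[OF assms] by simp
  have lin: "frechet_derivative (\<lambda>x. (?D v x + s * ?D w x) / 2) (at x) u
    = (frechet_derivative (?D v) (at x) u + s * frechet_derivative (?D w) (at x) u) / 2" for v w u s
  proof -
    have "((\<lambda>x. (?D v x + s * ?D w x) * (1 / 2)) has_derivative
       (\<lambda>u. (frechet_derivative (?D v) (at x) u + s * frechet_derivative (?D w) (at x) u) * (1 / 2))) (at x)"
      by (intro has_derivative_mult_left has_derivative_mult_right has_derivative_add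
          gD[unfolded frechet_derivative_works])
    from frechet_derivative_at[OF this, symmetric] show ?thesis by simp
  qed
  have 1: "frechet_derivative (\<lambda>x. (?D v x - \<i> * ?D w x) / 2) (at x) u
    = (frechet_derivative (?D v) (at x) u - \<i> * frechet_derivative (?D w) (at x) u) / 2" for v w u
    using lin[of v "- \<i>" w u] by simp
  have 2: "frechet_derivative (\<lambda>x. (?D v x + \<i> * ?D w x) / 2) (at x) u
    = (frechet_derivative (?D v) (at x) u + \<i> * frechet_derivative (?D w) (at x) u) / 2" for v w u
    by (rule lin)
  show ?thesis
    unfolding wirt_def[abs_def] wirt_bar_def[abs_def] 1 2
    using sym[of "axis a 1" "axis b 1"] sym[of "axis a \<i>" "axis b 1"]
      sym[of "axis a 1" "axis b \<i>"] sym[of "axis a \<i>" "axis b \<i>"]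
    by (simp add: field_simps)
qed

section \<open>Derivatives of holomorphic functions\<close>

lemma linear_sum_component: "(\<Sum>k\<in>UNIV. a k * h $ k) = wirtinger_form a (\<lambda>_. 0) h"
  by (simp add: wirtinger_form_def)

lemma holo_onD:
  assumes "holo_on f S" "x \<in> S"
  shows "(f has_derivative (\<lambda>h. \<Sum>k\<in>UNIV. wirt k f x * h $ k)) (at x)" "wirt_bar k f x = 0"
    "f differentiable (at x)"
proof -
  obtain a where a: "(f has_derivative (\<lambda>h. \<Sum>k\<in>UNIV. a $ k * h $ k)) (at x)"
    using assms unfolding holo_on_def by blast
  then have a': "(f has_derivative wirtinger_form (\<lambda>k. a $ k) (\<lambda>_. 0)) (at x)"
    by (simp add: linear_sum_component[of "\<lambda>k. a $ k"] cong: if_cong)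
  show "wirt_bar k f x = 0" by (rule wirt_eqI(2)[OF a'])
  show "(f has_derivative (\<lambda>h. \<Sum>k\<in>UNIV. wirt k f x * h $ k)) (at x)"
    using a by (simp add: wirt_eqI(1)[OF a'])
  show "f differentiable (at x)" using a by (rule differentiableI)
qed

lemma holo_onI:
  assumes "\<And>x. x \<in> S \<Longrightarrow> \<exists>p. (f has_derivative (\<lambda>h. \<Sum>k\<in>UNIV. p k * h $ k)) (at x)"
  shows "holo_on f S"
  unfolding holo_on_def
proof
  fix x assume "x \<in> S"
  then obtain p where "(f has_derivative (\<lambda>h. \<Sum>k\<in>UNIV. p k * h $ k)) (at x)"
    using assms by blast
  then have "(f has_derivative (\<lambda>h. \<Sum>k\<in>UNIV. (\<chi> k. p k) $ k * h $ k)) (at x)"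
    by simp
  then show "\<exists>a. (f has_derivative (\<lambda>h. \<Sum>k\<in>UNIV. a $ k * h $ k)) (at x)" by blast
qed

lemma norm_axis_smult: "norm (t *s axis k (1::complex)) = cmod t"
proof -
  have "norm ((t *s axis k (1::complex)) $ i) = (if i = k then cmod t else 0)" for i
    by (simp add: axis_def)
  then show ?thesis
    by (simp add: norm_vec_def L2_set_def if_distrib[of "\<lambda>x. x\<^sup>2"] cong: if_cong)
qed

text \<open>Restriction to a complex line in a coordinate direction, through which the one-variable
  theory enters.\<close>

lemma holo_on_line_deriv:
  assumes "holo_on f S" "x + t *s axis k 1 \<in> S"
  shows "((\<lambda>t. f (x + t *s axis k 1)) has_field_derivative wirt k f (x + t *s axis k 1)) (at t)"
proof -
  have "((\<lambda>t. x + t *s axis k 1) has_derivative (\<lambda>t. t *s axis k 1)) (at t)"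
  proof -
    have "linear (\<lambda>t::complex. t *s axis k (1::complex))"
      by (auto intro!: linearI simp: vec_eq_iff algebra_simps)
    then have "bounded_linear (\<lambda>t::complex. t *s axis k (1::complex))"
      by (simp add: linear_conv_bounded_linear)
    from bounded_linear_imp_has_derivative[OF this] show ?thesis
      by (auto intro!: derivative_eq_intros)
  qed
  from has_derivative_compose[OF this holo_onD(1)[OF assms]] 
  have "((\<lambda>t. f (x + t *s axis k 1)) has_derivative
     (\<lambda>h. \<Sum>j\<in>UNIV. wirt j f (x + t *s axis k 1) * (h *s axis k 1) $ j)) (at t)" .
  moreover have "wirt j f y * (h *s axis k 1) $ j = (if j = k then wirt k f y * h else 0)" for j h y
    by (simp add: axis_def)
  ultimately show ?thesis by (simp add: has_field_derivative_def)
qed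

lemma holo_on_Cauchy_estimate:
  assumes f: "holo_on f S" and "cball x r \<subseteq> S" "r > 0" and M: "\<And>y. y \<in> cball x r \<Longrightarrow> cmod (f y) \<le> M"
  shows "cmod (wirt k f x) \<le> M / r"
proof -
  let ?F = "\<lambda>t. f (x + t *s axis k 1)"
  have mem: "x + t *s axis k 1 \<in> cball x r" if "cmod t \<le> r" for t
    using that by (simp add: dist_norm norm_axis_smult)
  have d: "(?F has_field_derivative wirt k f (x + t *s axis k 1)) (at t)" if "cmod t \<le> r" for t
    using holo_on_line_deriv[OF f] mem[OF that] assms(2) by blast
  have "?F holomorphic_on cball 0 r"
    unfolding holomorphic_on_def field_differentiable_def
    using has_field_derivative_at_within[OF d] by (metis dist_0_norm mem_cball)
  then have "cmod ((deriv ^^ 1) ?F 0) \<le> fact 1 * M / r ^ 1"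
    using M mem \<open>r > 0\<close>
    by (intro Cauchy_inequality holomorphic_on_imp_continuous_on)
       (auto intro: holomorphic_on_subset)
  moreover have "deriv ?F 0 = wirt k f x" using DERIV_imp_deriv[OF d, of 0] \<open>r > 0\<close> by simp
  ultimately show ?thesis by simp
qed

text \<open>A Taylor estimate on a complex line. The bound involves \<open>M\<close> and
  \<open>r\<close> but not the point \<open>x\<close>, which is what makes difference quotients
  converge uniformly.\<close>

lemma holo_on_diff_quotient:
  assumes f: "holo_on f S" and "cball x (2 * r) \<subseteq> S" "r > 0"
    and M: "\<And>y. y \<in> cball x (2 * r) \<Longrightarrow> cmod (f y) \<le> M" and t: "cmod t \<le> r" "t \<noteq> 0"
  shows "cmod ((f (x + t *s axis k 1) - f x) / t - wirt k f x) \<le> 2 * M / r\<^sup>2 * cmod t"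
proof -
  let ?F = "\<lambda>t. f (x + t *s axis k 1)"
  let ?F' = "\<lambda>t. wirt k f (x + t *s axis k 1)"
  have mem: "x + t *s axis k 1 \<in> cball x (2 * r)" if "cmod t \<le> 2 * r" for t
    using that by (simp add: dist_norm norm_axis_smult)
  have d: "(?F has_field_derivative ?F' t) (at t)" if "cmod t \<le> 2 * r" for t
    using holo_on_line_deriv[OF f] mem[OF that] assms(2) by blast
  have hol: "?F holomorphic_on cball 0 (2 * r)"
    unfolding holomorphic_on_def field_differentiable_def
    using has_field_derivative_at_within[OF d] by (metis dist_0_norm mem_cball)
  \<comment> \<open>The disc of radius \<open>r\<close> about \<open>u\<close> lies in the disc of
    radius \<open>2 * r\<close> about 0, where \<open>M\<close> bounds the function; the factor 2 is
    the \<open>fact 2\<close> of Cauchy's inequality of order two.\<close>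
  have 2: "cmod ((deriv ^^ 2) ?F u) \<le> 2 * M / r\<^sup>2" if "cmod u \<le> r" for u
  proof -
    have sub: "cball u r \<subseteq> cball 0 (2 * r)"
      using that norm_triangle_ineq2 by (auto simp: dist_norm) (smt (verit) norm_minus_commute norm_triangle_ineq2)
    have "cmod ((deriv ^^ 2) ?F u) \<le> fact 2 * M / r ^ 2"
    proof (rule Cauchy_inequality)
      show "?F holomorphic_on ball u r"
        using hol sub ball_subset_cball holomorphic_on_subset by (metis (no_types, lifting))
      show "continuous_on (cball u r) ?F"
        using hol sub holomorphic_on_subset holomorphic_on_imp_continuous_on by blast
      show "cmod (?F y) \<le> M" if "cmod (u - y) = r" for y
        using that sub by (intro M mem) (auto simp: dist_norm subset_iff)
    qed (use \<open>r > 0\<close> in auto)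
    then show ?thesis by (simp add: fact_2)
  qed
  have dn: "((deriv ^^ n) ?F has_field_derivative (deriv ^^ (Suc n)) ?F u) (at u within cball 0 r)"
    if "u \<in> cball 0 r" for u n
  proof -
    have "(deriv ^^ n) ?F holomorphic_on ball 0 (2 * r)"
      by (intro holomorphic_higher_deriv holomorphic_on_subset[OF hol]) auto
    moreover have "u \<in> ball 0 (2 * r)" using that \<open>r > 0\<close> by simp
    ultimately show ?thesis
      using holomorphic_derivI[OF _ open_ball] by (auto intro: has_field_derivative_at_within)
  qed
  \<comment> \<open>\<open>complex_Taylor\<close> of order 1 divides the remainder by
    \<open>fact 1\<close>, so the bound keeps the whole constant
    \<open>2 * M / r\<^sup>2\<close>.\<close>
  have "cmod ((deriv ^^ 0) ?F t - (\<Sum>i\<le>1. (deriv ^^ i) ?F 0 * (t - 0) ^ i / fact i))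
      \<le> 2 * M / r\<^sup>2 * cmod (t - 0) ^ (Suc 1) / fact 1"
  proof (rule complex_Taylor)
    show "cmod ((deriv ^^ Suc 1) ?F u) \<le> 2 * M / r\<^sup>2" if "u \<in> cball 0 r" for u
      using 2[of u] that by (simp add: numeral_2_eq_2)
  qed (use t dn \<open>r > 0\<close> in auto)
  moreover have "deriv ?F 0 = wirt k f x" using DERIV_imp_deriv[OF d, of 0] \<open>r > 0\<close> by simp
  ultimately have "cmod (?F t - f x - wirt k f x * t) \<le> 2 * M / r\<^sup>2 * (cmod t)\<^sup>2"
    by (simp add: power2_eq_square algebra_simps)
  moreover have "(f (x + t *s axis k 1) - f x) / t - wirt k f x = (?F t - f x - wirt k f x * t) / t"
    using t by (simp add: field_simps)
  ultimately show ?thesis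
    using t by (simp add: norm_divide divide_le_eq power2_eq_square mult.assoc)
qed

text \<open>Difference quotients of \<open>f\<close> in the direction \<open>k\<close> converge locally uniformly, and Cauchy's
  estimate carries this over to their derivatives.\<close>

lemma holo_on_wirt:
  fixes f :: "complex^'m \<Rightarrow> complex"
  assumes "open S" and f: "holo_on f S"
  shows "holo_on (wirt k f) S"
proof -
  have "\<exists>p. (wirt k f has_derivative (\<lambda>h. \<Sum>j\<in>UNIV. p j * h $ j)) (at x0)" if x0: "x0 \<in> S" for x0
  proof -
    obtain r0 where "r0 > 0" and r0: "cball x0 r0 \<subseteq> S"
      using \<open>open S\<close> x0 open_contains_cball by blast
    \<comment> \<open>Quotients are formed at points within \<open>2 * r\<close> of
      \<open>x0\<close>, and \<open>holo_on_diff_quotient\<close> needs a ball of radius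
      \<open>2 * r\<close> around each of them, hence \<open>4 * r\<close> in all.\<close>
    define r where "r = r0 / 4"
    have "r > 0" using \<open>r0 > 0\<close> by (simp add: r_def)
    have cb: "cball x0 (4 * r) \<subseteq> S" using r0 by (simp add: r_def)
    have "continuous_on (cball x0 (4 * r)) f"
      using holo_onD(3)[OF f] cb
      by (intro differentiable_imp_continuous_on differentiable_at_imp_differentiable_on) blast
    then have "bounded (f ` cball x0 (4 * r))"
      by (intro compact_imp_bounded compact_continuous_image) auto
    then obtain M where M: "\<And>y. y \<in> cball x0 (4 * r) \<Longrightarrow> cmod (f y) \<le> M"
      unfolding bounded_iff by blast
    have "M \<ge> 0" using M[of x0] \<open>r > 0\<close> by (smt (verit) centre_in_cball norm_ge_zero)
    define s where "s n = complex_of_real (r / real (Suc n))" for n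
    have s: "s n \<noteq> 0" "cmod (s n) = r / real (Suc n)" "cmod (s n) \<le> r" for n
      using \<open>r > 0\<close> by (auto simp: s_def norm_divide divide_le_eq mult_le_cancel_left1 simp del: of_nat_Suc)
    define q where "q n x = (f (x + s n *s axis k 1) - f x) / s n" for n x
    define p where "p n x j = (wirt j f (x + s n *s axis k 1) - wirt j f x) / s n" for n x j
    define C where "C = 2 * M / r\<^sup>2"
    have "C \<ge> 0" unfolding C_def using \<open>M \<ge> 0\<close> by simp
    have tri: "dist x0 y \<le> a + b" if "dist x0 x < a" "dist x y \<le> b" for x y and a b :: real
      using that dist_triangle[of x0 y x] by simp
    have q_lim: "cmod (q n x - wirt k f x) \<le> C * cmod (s n)" if "x \<in> ball x0 (2 * r)" for n x
    proof -
      have sub: "cball x (2 * r) \<subseteq> cball x0 (4 * r)" using tri[of x "2 * r" _ "2 * r"] that by auto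
      show ?thesis
        unfolding C_def q_def
        by (rule holo_on_diff_quotient[OF f _ \<open>r > 0\<close>]) (use sub cb M s in auto)
    qed
    have q_der: "(q n has_derivative (\<lambda>h. \<Sum>j\<in>UNIV. p n x j * h $ j)) (at x)" if "x \<in> ball x0 (2 * r)" for n x
    proof -
      have mem: "x \<in> S" "x + s n *s axis k 1 \<in> S"
        using that tri[of x "2 * r" x 0] tri[of x "2 * r" "x + s n *s axis k 1" r] s(3)[of n] cb \<open>r > 0\<close>
        by (auto simp: dist_norm norm_axis_smult intro!: subsetD[OF cb])
      have "((\<lambda>x. x + s n *s axis k 1) has_derivative (\<lambda>h. h)) (at x)"
        by (auto intro!: derivative_eq_intros)
      from has_derivative_compose[OF this holo_onD(1)[OF f mem(2)]]
      have "((\<lambda>x. f (x + s n *s axis k 1) - f x) has_derivative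
          (\<lambda>h. (\<Sum>j\<in>UNIV. wirt j f (x + s n *s axis k 1) * h $ j) - (\<Sum>j\<in>UNIV. wirt j f x * h $ j))) (at x)"
        using holo_onD(1)[OF f mem(1)] by (rule has_derivative_diff)
      from has_derivative_mult_left[OF this, of "inverse (s n)"] show ?thesis
        unfolding q_def[abs_def] p_def
        by (simp add: divide_inverse sum_distrib_left sum_subtractf algebra_simps)
    qed
    have q_holo: "holo_on (\<lambda>x. q m x - q n x) (ball x0 (2 * r))" for m n
    proof (rule holo_onI)
      show "\<exists>a. ((\<lambda>x. q m x - q n x) has_derivative (\<lambda>h. \<Sum>j\<in>UNIV. a j * h $ j)) (at x)"
        if "x \<in> ball x0 (2 * r)" for x
        using has_derivative_diff[OF q_der[OF that] q_der[OF that], of m n]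
        by (intro exI[of _ "\<lambda>j. p m x j - p n x j"]) (simp add: sum_subtractf algebra_simps)
    qed
    \<comment> \<open>On the larger ball \<open>q m\<close> and \<open>q n\<close> are both
      uniformly close to \<open>wirt k f\<close>, so their difference is small; Cauchy's estimate at
      radius \<open>r / 2\<close> makes its derivatives small as well.\<close>
    have p_Cauchy: "cmod (p m x j - p n x j) \<le> C * (cmod (s m) + cmod (s n)) / (r / 2)" if "x \<in> ball x0 r" for m n x j
    proof -
      have sub: "cball x (r / 2) \<subseteq> ball x0 (2 * r)"
      proof
        fix y assume "y \<in> cball x (r / 2)"
        then show "y \<in> ball x0 (2 * r)" using tri[of x r y "r / 2"] that \<open>r > 0\<close> by auto
      qed
      have "wirt j (\<lambda>x. q m x - q n x) x = p m x j - p n x j"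
      proof (rule wirt_eqI(1)[where q = "\<lambda>_. 0"])
        have "x \<in> ball x0 (2 * r)" using that \<open>r > 0\<close> by auto
        from has_derivative_diff[OF q_der[OF this, of m] q_der[OF this, of n]]
        show "((\<lambda>x. q m x - q n x) has_derivative wirtinger_form (\<lambda>j. p m x j - p n x j) (\<lambda>_. 0)) (at x)"
          by (simp add: wirtinger_form_def[abs_def] sum_subtractf algebra_simps)
      qed
      moreover have "cmod (wirt j (\<lambda>x. q m x - q n x) x) \<le> C * (cmod (s m) + cmod (s n)) / (r / 2)"
      proof (rule holo_on_Cauchy_estimate[OF q_holo sub])
        fix y assume "y \<in> cball x (r / 2)"
        then have y: "y \<in> ball x0 (2 * r)" using sub by blast
        have "cmod (q m y - q n y) \<le> cmod (q m y - wirt k f y) + cmod (q n y - wirt k f y)"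
          using norm_triangle_ineq4[of "q m y - wirt k f y" "q n y - wirt k f y"] by simp
        also have "\<dots> \<le> C * (cmod (s m) + cmod (s n))"
          using q_lim[OF y, of m] q_lim[OF y, of n] by (simp add: algebra_simps)
        finally show "cmod (q m y - q n y) \<le> C * (cmod (s m) + cmod (s n))" .
      qed (use \<open>r > 0\<close> in auto)
      ultimately show ?thesis by simp
    qed
    have s_lim: "(\<lambda>n. cmod (s n)) \<longlonglongrightarrow> 0"
      unfolding s(2) by (rule LIMSEQ_Suc[OF lim_const_over_n])
    \<comment> \<open>The argument is a pair of a point and a coordinate index, so that a single
      limit \<open>P\<close> covers all partial derivatives at once.\<close>
    have "\<exists>P. \<forall>e>0. \<exists>N. \<forall>n z. N \<le> n \<and> fst z \<in> ball x0 r \<longrightarrow> dist (p n (fst z) (snd z)) (P z) < e"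
      unfolding uniformly_convergent_eq_cauchy
    proof (intro allI impI)
      fix e :: real assume "e > 0"
      \<comment> \<open>With this choice \<open>C * (\<delta> + \<delta>) / (r / 2)\<close> becomes
        \<open>e * (C / (C + 1)) / 2\<close>; dividing by \<open>C + 1\<close> avoids a vanishing
        \<open>C\<close>.\<close>
      define \<delta> where "\<delta> = e * r / (8 * (C + 1))"
      have "\<delta> > 0" unfolding \<delta>_def using \<open>e > 0\<close> \<open>r > 0\<close> \<open>C \<ge> 0\<close> by simp
      then obtain N where N: "\<And>n. n \<ge> N \<Longrightarrow> cmod (s n) < \<delta>"
        using s_lim unfolding LIMSEQ_iff by fastforce
      have "dist (p m (fst z) (snd z)) (p n (fst z) (snd z)) < e"
        if "N \<le> m" "N \<le> n" "fst z \<in> ball x0 r" for m n z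
      proof -
        have "dist (p m (fst z) (snd z)) (p n (fst z) (snd z)) \<le> C * (cmod (s m) + cmod (s n)) / (r / 2)"
          using p_Cauchy[OF that(3)] by (simp add: dist_norm)
        also have "\<dots> \<le> C * (\<delta> + \<delta>) / (r / 2)"
          using N[OF that(1)] N[OF that(2)] \<open>r > 0\<close> \<open>C \<ge> 0\<close>
          by (intro divide_right_mono mult_left_mono) auto
        also have "\<dots> = e * (C / (C + 1)) / 2"
        proof -
          have *: "C * (e * r / (8 * K) + e * r / (8 * K)) / (r / 2) = e * (C / K) / 2" if "K > 0" for K
            using \<open>r > 0\<close> that by (simp add: field_simps)
          show ?thesis unfolding \<delta>_def by (rule *) (use \<open>C \<ge> 0\<close> in simp)
        qed
        also have "\<dots> < e"
        proof -
          have "e * (C / (C + 1)) \<le> e * 1" using \<open>C \<ge> 0\<close> \<open>e > 0\<close> by (intro mult_left_mono) auto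
          moreover have "q / 2 < e" if "q \<le> e * 1" for q using that \<open>e > 0\<close> by simp
          ultimately show ?thesis by blast
        qed
        finally show ?thesis .
      qed
      then show "\<exists>N. \<forall>m n z. N \<le> m \<and> N \<le> n \<and> fst z \<in> ball x0 r
          \<longrightarrow> dist (p m (fst z) (snd z)) (p n (fst z) (snd z)) < e" by blast
    qed
    then obtain P where P: "\<And>e. e > 0 \<Longrightarrow>
        \<exists>N. \<forall>n z. N \<le> n \<and> fst z \<in> ball x0 r \<longrightarrow> dist (p n (fst z) (snd z)) (P z) < e" by blast
    have q_tendsto: "(\<lambda>n. q n x) \<longlonglongrightarrow> wirt k f x" if "x \<in> ball x0 r" for x
    proof -
      have "(\<lambda>n. q n x - wirt k f x) \<longlonglongrightarrow> 0"
      proof (rule Lim_null_comparison)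
        show "\<forall>\<^sub>F n in sequentially. norm (q n x - wirt k f x) \<le> C * cmod (s n)"
          using that \<open>r > 0\<close> by (intro always_eventually allI q_lim) auto
        show "(\<lambda>n. C * cmod (s n)) \<longlonglongrightarrow> 0" using tendsto_mult_right_zero[OF s_lim] .
      qed
      then show ?thesis by (simp add: LIM_zero_iff)
    qed
    \<comment> \<open>Uniform convergence of the derivatives makes the limit \<open>g\<close>
      differentiable; uniqueness of pointwise limits then identifies \<open>g\<close> with
      \<open>wirt k f\<close> near \<open>x0\<close>.\<close>
    have "\<exists>g. \<forall>x\<in>ball x0 r. (\<lambda>n. q n x) \<longlonglongrightarrow> g x \<and>
        (g has_derivative (\<lambda>h. \<Sum>j\<in>UNIV. P (x, j) * h $ j)) (at x within ball x0 r)"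
    proof (rule has_derivative_sequence)
      show "(q n has_derivative (\<lambda>h. \<Sum>j\<in>UNIV. p n x j * h $ j)) (at x within ball x0 r)"
        if "x \<in> ball x0 r" for n x
        using that \<open>r > 0\<close> by (intro has_derivative_at_withinI[OF q_der]) auto
      show "\<forall>\<^sub>F n in sequentially. \<forall>x\<in>ball x0 r. \<forall>h::complex^'m.
          norm ((\<Sum>j\<in>UNIV. p n x j * h $ j) - (\<Sum>j\<in>UNIV. P (x, j) * h $ j)) \<le> e * norm h"
        if "e > 0" for e
      proof -
        \<comment> \<open>The permitted error is spread evenly over the coordinates of
          \<open>h\<close>, each of which is bounded by \<open>norm h\<close>.\<close>
        have card: "real CARD('m) > 0" by simp
        then have "e / real CARD('m) > 0" using that by simp
        from P[OF this] obtain N where N: "\<And>n x j. N \<le> n \<Longrightarrow> x \<in> ball x0 r \<Longrightarrow>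
            dist (p n x j) (P (x, j)) < e / real CARD('m)" by fastforce
        have "norm ((\<Sum>j\<in>UNIV. p n x j * h $ j) - (\<Sum>j\<in>UNIV. P (x, j) * h $ j)) \<le> e * norm h"
          if "n \<ge> N" "x \<in> ball x0 r" for n x and h :: "complex^'m"
        proof -
          have "norm ((\<Sum>j\<in>UNIV. p n x j * h $ j) - (\<Sum>j\<in>UNIV. P (x, j) * h $ j))
            = norm (\<Sum>j\<in>UNIV. (p n x j - P (x, j)) * h $ j)"
            by (simp add: sum_subtractf algebra_simps)
          also have "\<dots> \<le> (\<Sum>j\<in>(UNIV::'m set). e / real CARD('m) * norm h)"
          proof (rule sum_norm_le)
            fix j
            have "cmod (p n x j - P (x, j)) \<le> e / real CARD('m)"
              using N[OF that, of j] by (simp add: dist_norm less_imp_le)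
            then show "norm ((p n x j - P (x, j)) * h $ j) \<le> e / real CARD('m) * norm h"
              unfolding norm_mult using Finite_Cartesian_Product.norm_nth_le[of h j] \<open>e / real CARD('m) > 0\<close>
              by (intro mult_mono) auto
          qed
          also have "\<dots> = e * norm h" using card by simp
          finally show ?thesis .
        qed
        then show ?thesis unfolding eventually_sequentially by blast
      qed
      show "(\<lambda>n. q n x0) \<longlonglongrightarrow> wirt k f x0" using q_tendsto \<open>r > 0\<close> by simp
    qed (use \<open>r > 0\<close> in auto)
    then obtain g where g: "\<And>x. x \<in> ball x0 r \<Longrightarrow> (\<lambda>n. q n x) \<longlonglongrightarrow> g x"
      and g': "\<And>x. x \<in> ball x0 r \<Longrightarrow>
        (g has_derivative (\<lambda>h. \<Sum>j\<in>UNIV. P (x, j) * h $ j)) (at x within ball x0 r)" by blast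
    have x0r: "x0 \<in> ball x0 r" using \<open>r > 0\<close> by simp
    have "(g has_derivative (\<lambda>h. \<Sum>j\<in>UNIV. P (x0, j) * h $ j)) (at x0)"
      using g'[OF x0r] at_within_open[OF x0r open_ball] by simp
    moreover have "g x = wirt k f x" if "x \<in> ball x0 r" for x
      using LIMSEQ_unique[OF g[OF that] q_tendsto[OF that]] .
    ultimately have "(wirt k f has_derivative (\<lambda>h. \<Sum>j\<in>UNIV. P (x0, j) * h $ j)) (at x0)"
      using has_derivative_transform_within_open[OF _ open_ball x0r] by blast
    then show ?thesis by (rule exI[where x="\<lambda>j. P (x0, j)"])
  qed
  then show ?thesis by (rule holo_onI)
qed

section \<open>The complex Hessian form and Hermitian matrices\<close>

definition levi :: "(complex^'m \<Rightarrow> complex) \<Rightarrow> complex^'m \<Rightarrow> complex^'m \<Rightarrow> complex" where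
  "levi f u V = (\<Sum>a\<in>UNIV. \<Sum>b\<in>UNIV. wirt a (wirt_bar b f) u * V $ a * cnj (V $ b))"

lemma bounded_linear_axis: "bounded_linear (\<lambda>t::complex. axis b t :: complex^'m)"
proof -
  have "linear (\<lambda>t::complex. axis b t :: complex^'m)"
    by (auto intro!: linearI simp: vec_eq_iff axis_def)
  then show ?thesis by (simp add: linear_conv_bounded_linear)
qed

lemma has_derivative_components:
  fixes \<Phi> :: "'a::real_normed_vector \<Rightarrow> complex^'m"
  assumes "\<And>b. ((\<lambda>x. \<Phi> x $ b) has_derivative D b) (at x)"
  shows "(\<Phi> has_derivative (\<lambda>h. \<chi> b. D b h)) (at x)"
proof -
  have *: "v = (\<Sum>b\<in>UNIV. axis b (v $ b))" for v :: "complex^'m"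
    by (simp add: vec_eq_iff axis_def if_distrib cong: if_cong)
  have "((\<lambda>x. \<Sum>b\<in>UNIV. axis b (\<Phi> x $ b)) has_derivative (\<lambda>h. \<Sum>b\<in>UNIV. axis b (D b h))) (at x)"
    by (intro has_derivative_sum bounded_linear.has_derivative[OF bounded_linear_axis] assms)
  moreover have "(\<lambda>x. \<Sum>b\<in>UNIV. axis b (\<Phi> x $ b)) = \<Phi>" by (rule ext) (rule *[symmetric])
  moreover have "(\<lambda>h. \<Sum>b\<in>UNIV. axis b (D b h)) = (\<lambda>h. \<chi> b. D b h)"
  proof
    show "(\<Sum>b\<in>UNIV. axis b (D b h)) = (\<chi> b. D b h)" for h
      using *[of "\<chi> b. D b h"] by simp
  qed
  ultimately show ?thesis by simp
qed

lemma holo_map_has_derivative: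
  fixes \<Phi> :: "complex^'n \<Rightarrow> complex^'m"
  assumes "\<And>b. holo_on (\<lambda>x. \<Phi> x $ b) N" "x \<in> N"
  shows "(\<Phi> has_derivative (\<lambda>h. \<chi> b. \<Sum>\<alpha>\<in>UNIV. wirt \<alpha> (\<lambda>x. \<Phi> x $ b) x * h $ \<alpha>)) (at x)"
  by (rule has_derivative_components) (rule holo_onD(1)[OF assms])

text \<open>The conjugated Jacobian is antiholomorphic, so \<open>wirt\<close> annihilates it and no
  second derivative of \<open>\<Phi>\<close> survives. A section therefore enters only through its
  value and its first derivatives at the point.\<close>

lemma levi_holo_comp:
  fixes \<Phi> :: "complex^'n \<Rightarrow> complex^'m"
  assumes N: "open N" "x \<in> N" and hol: "\<And>b. holo_on (\<lambda>x. \<Phi> x $ b) N"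
    and maps: "\<And>y. y \<in> N \<Longrightarrow> \<Phi> y \<in> \<Omega>"
    and f: "\<And>u. u \<in> \<Omega> \<Longrightarrow> f differentiable (at u)"
    and fb: "\<And>b u. u \<in> \<Omega> \<Longrightarrow> wirt_bar b f differentiable (at u)"
  shows "levi (\<lambda>x. f (\<Phi> x)) x v
    = levi f (\<Phi> x) (\<chi> b. \<Sum>\<alpha>\<in>UNIV. wirt \<alpha> (\<lambda>x. \<Phi> x $ b) x * v $ \<alpha>)"
proof -
  define J where "J y b \<alpha> = wirt \<alpha> (\<lambda>x. \<Phi> x $ b) y" for y b \<alpha>
  have D: "(\<Phi> has_derivative (\<lambda>h. \<chi> b. \<Sum>\<alpha>\<in>UNIV. J y b \<alpha> * h $ \<alpha>)) (at y)" if "y \<in> N" for y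
    unfolding J_def by (rule holo_map_has_derivative[OF hol that])
  have J_holo: "holo_on (\<lambda>y. J y b \<alpha>) N" for b \<alpha>
    unfolding J_def by (rule holo_on_wirt[OF N(1) hol])
  have 1: "wirt_bar \<beta> (\<lambda>x. f (\<Phi> x)) y = (\<Sum>b\<in>UNIV. wirt_bar b f (\<Phi> y) * cnj (J y b \<beta>))"
    if "y \<in> N" for y \<beta>
    by (rule wirt_chain(2)[OF D[OF that] f[OF maps[OF that]]]) simp
  have dJ: "(\<lambda>y. cnj (J y b \<beta>)) differentiable (at x)" for b \<beta>
    by (rule differentiable_cnj[OF holo_onD(3)[OF J_holo N(2)]])
  have df: "(\<lambda>y. wirt_bar b f (\<Phi> y)) differentiable (at x)" for b
    using has_derivative_compose[OF D[OF N(2)] fb[OF maps[OF N(2)], unfolded frechet_derivative_works]]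
    by (rule differentiableI)
  have J0: "wirt \<alpha> (\<lambda>y. cnj (J y b \<beta>)) x = 0" for \<alpha> \<beta> b
    by (simp add: wirt_cnj(1)[OF holo_onD(3)[OF J_holo N(2)]] holo_onD(2)[OF J_holo N(2)])
  have 2: "wirt \<alpha> (wirt_bar \<beta> (\<lambda>x. f (\<Phi> x))) x
      = (\<Sum>b\<in>UNIV. \<Sum>a\<in>UNIV. wirt a (wirt_bar b f) (\<Phi> x) * J x a \<alpha> * cnj (J x b \<beta>))" for \<alpha> \<beta>
  proof -
    have "wirt \<alpha> (wirt_bar \<beta> (\<lambda>x. f (\<Phi> x))) x
      = wirt \<alpha> (\<lambda>y. \<Sum>b\<in>UNIV. wirt_bar b f (\<Phi> y) * cnj (J y b \<beta>)) x"
      by (rule wirt_cong(1)[OF N 1])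
    also have "\<dots> = (\<Sum>b\<in>UNIV. wirt \<alpha> (\<lambda>y. wirt_bar b f (\<Phi> y) * cnj (J y b \<beta>)) x)"
      by (intro wirt_sum(1) differentiable_mult df dJ finite)
    also have "\<dots> = (\<Sum>b\<in>UNIV. (\<Sum>a\<in>UNIV. wirt a (wirt_bar b f) (\<Phi> x) * J x a \<alpha>) * cnj (J x b \<beta>))"
      by (intro sum.cong refl)
        (simp add: wirt_mult(1)[OF df dJ] J0 wirt_chain(1)[OF D[OF N(2)] fb[OF maps[OF N(2)]]])
    finally show ?thesis by (simp add: sum_distrib_right)
  qed
  let ?d = "\<lambda>a b. wirt a (wirt_bar b f) (\<Phi> x)"
  have "levi (\<lambda>x. f (\<Phi> x)) x v = (\<Sum>\<alpha>\<in>UNIV. \<Sum>\<beta>\<in>UNIV. \<Sum>b\<in>UNIV. \<Sum>a\<in>UNIV.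
      ?d a b * (J x a \<alpha> * v $ \<alpha>) * cnj (J x b \<beta> * v $ \<beta>))"
    unfolding levi_def 2 by (simp add: sum_distrib_left sum_distrib_right mult_ac)
  also have "\<dots> = (\<Sum>a\<in>UNIV. \<Sum>b\<in>UNIV. \<Sum>\<alpha>\<in>UNIV. \<Sum>\<beta>\<in>UNIV.
      ?d a b * (J x a \<alpha> * v $ \<alpha>) * cnj (J x b \<beta> * v $ \<beta>))"
  proof -
    have "(\<Sum>\<alpha>\<in>UNIV. \<Sum>\<beta>\<in>UNIV. \<Sum>b\<in>UNIV. \<Sum>a\<in>UNIV. g \<alpha> \<beta> a b)
        = (\<Sum>a\<in>UNIV. \<Sum>b\<in>UNIV. \<Sum>\<alpha>\<in>UNIV. \<Sum>\<beta>\<in>UNIV. g \<alpha> \<beta> a b)"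
      for g :: "'n \<Rightarrow> 'n \<Rightarrow> 'm \<Rightarrow> 'm \<Rightarrow> complex"
      by (simp add: sum.cartesian_product)
        (rule sum.reindex_bij_witness[where i="\<lambda>(a, b, \<alpha>, \<beta>). (\<alpha>, \<beta>, b, a)"
            and j="\<lambda>(\<alpha>, \<beta>, b, a). (a, b, \<alpha>, \<beta>)"]; auto)
    then show ?thesis .
  qed
  also have "\<dots> = levi f (\<Phi> x) (\<chi> b. \<Sum>\<alpha>\<in>UNIV. J x b \<alpha> * v $ \<alpha>)"
    unfolding levi_def
    by (simp add: sum_distrib_left sum_distrib_right mult.assoc)
      (rule sum.cong[OF refl], rule sum.cong[OF refl], rule sum.swap)
  finally show ?thesis unfolding J_def .
qed

lemma wirt_bar_real:
  assumes "(\<lambda>x. complex_of_real (g x)) differentiable (at x)"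
  shows "wirt_bar a (\<lambda>x. complex_of_real (g x)) x = cnj (wirt a (\<lambda>x. complex_of_real (g x)) x)"
  using wirt_cnj(2)[OF assms, of a] by simp

text \<open>\<open>\<kappa>\<close> only adds a constant to the logarithm. It is carried along to
  absorb the factor that appears when a section is rescaled.\<close>

lemma wirt_ln:
  fixes G :: "complex^'m \<Rightarrow> real"
  assumes "G differentiable (at u)" "G u > 0" "\<kappa> > 0"
  shows "(\<lambda>x. complex_of_real (ln (\<kappa> * G x))) differentiable (at u)"
    "wirt_bar b (\<lambda>x. complex_of_real (ln (\<kappa> * G x))) u
      = wirt_bar b (\<lambda>x. complex_of_real (G x)) u / complex_of_real (G u)"
proof -
  let ?g = "\<lambda>x. complex_of_real (G x)"
  let ?D = "frechet_derivative G (at u)"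
  have D: "(G has_derivative ?D) (at u)" using assms(1) by (simp add: frechet_derivative_works)
  have "?g differentiable (at u)"
    using has_derivative_of_real[OF D] by (rule differentiableI)
  from has_derivative_unique[OF has_derivative_of_real[OF D] has_derivative_wirtinger[OF this]]
  have w: "complex_of_real (?D h) = wirtinger_form (\<lambda>a. wirt a ?g u) (\<lambda>a. wirt_bar a ?g u) h" for h
    by metis
  have "((\<lambda>x. ln (\<kappa> * G x)) has_derivative (\<lambda>h. (\<kappa> * ?D h) * inverse (\<kappa> * G u))) (at u)"
    using assms by (intro has_derivative_ln has_derivative_mult_right D) auto
  then have "((\<lambda>x. complex_of_real (ln (\<kappa> * G x))) has_derivative
      (\<lambda>h. complex_of_real (\<kappa> * ?D h * inverse (\<kappa> * G u)))) (at u)"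
    by (rule has_derivative_of_real)
  moreover have "(\<lambda>h. complex_of_real (\<kappa> * ?D h * inverse (\<kappa> * G u)))
      = wirtinger_form (\<lambda>a. wirt a ?g u / complex_of_real (G u)) (\<lambda>a. wirt_bar a ?g u / complex_of_real (G u))"
  proof
    fix h
    show "complex_of_real (\<kappa> * ?D h * inverse (\<kappa> * G u))
      = wirtinger_form (\<lambda>a. wirt a ?g u / complex_of_real (G u)) (\<lambda>a. wirt_bar a ?g u / complex_of_real (G u)) h"
    proof -
      have "complex_of_real (\<kappa> * ?D h * inverse (\<kappa> * G u)) = complex_of_real (?D h) / complex_of_real (G u)"
        using assms(2,3) by (simp add: field_simps)
      then show ?thesis
        unfolding w by (simp add: wirtinger_form_def sum_divide_distrib add_divide_distrib)
    qed
  qed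
  ultimately have L: "((\<lambda>x. complex_of_real (ln (\<kappa> * G x))) has_derivative
      wirtinger_form (\<lambda>a. wirt a ?g u / complex_of_real (G u)) (\<lambda>a. wirt_bar a ?g u / complex_of_real (G u))) (at u)"
    by (simp only:)
  show "wirt_bar b (\<lambda>x. complex_of_real (ln (\<kappa> * G x))) u = wirt_bar b ?g u / complex_of_real (G u)"
    by (rule wirt_eqI(2)[OF L])
  show "(\<lambda>x. complex_of_real (ln (\<kappa> * G x))) differentiable (at u)"
    by (rule differentiableI[OF L])
qed

text \<open>The quotient rule applied to the conjugate gradient of \<open>G\<close> divided by
  \<open>G\<close>. As \<open>G\<close> is real, its two gradients are conjugate to each other and
  the correction term becomes a squared modulus. The first conclusion supplies a premise of
  \<open>levi_holo_comp\<close>.\<close>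

lemma levi_ln:
  fixes G :: "complex^'m \<Rightarrow> real"
  assumes "open \<Omega>" "u \<in> \<Omega>" and G: "\<And>x. x \<in> \<Omega> \<Longrightarrow> G differentiable (at x)"
    and pos: "\<And>x. x \<in> \<Omega> \<Longrightarrow> G x > 0" and "\<kappa> > 0"
    and Gb: "\<And>b. wirt_bar b (\<lambda>x. complex_of_real (G x)) differentiable (at u)"
  shows "wirt_bar b (\<lambda>x. complex_of_real (ln (\<kappa> * G x))) differentiable (at u)"
    and "levi (\<lambda>x. complex_of_real (ln (\<kappa> * G x))) u V
      = levi (\<lambda>x. complex_of_real (G x)) u V / complex_of_real (G u)
        - complex_of_real ((cmod (\<Sum>a\<in>UNIV. wirt a (\<lambda>x. complex_of_real (G x)) u * V $ a))\<^sup>2 / (G u)\<^sup>2)"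
proof -
  let ?g = "\<lambda>x. complex_of_real (G x)"
  let ?L = "\<lambda>x. complex_of_real (ln (\<kappa> * G x))"
  have g: "?g differentiable (at x)" if "x \<in> \<Omega>" for x
    using has_derivative_of_real[OF G[OF that, unfolded frechet_derivative_works]] by (rule differentiableI)
  have eq: "wirt_bar b ?L x = wirt_bar b ?g x * inverse (?g x)" if "x \<in> \<Omega>" for x b
    using wirt_ln(2)[OF G[OF that] pos[OF that] \<open>\<kappa> > 0\<close>] by (simp add: divide_inverse)
  have di: "(\<lambda>x. inverse (?g x)) differentiable (at u)"
    using g[OF \<open>u \<in> \<Omega>\<close>] pos[OF \<open>u \<in> \<Omega>\<close>] by (intro differentiable_inverse) auto
  have wi: "wirt a (\<lambda>x. inverse (?g x)) u = - wirt a ?g u / (?g u)\<^sup>2" for a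
  proof -
    have "((\<lambda>x. inverse (?g x)) has_derivative (\<lambda>h. - (inverse (?g u)
        * wirtinger_form (\<lambda>a. wirt a ?g u) (\<lambda>a. wirt_bar a ?g u) h * inverse (?g u)))) (at u)"
      using pos[OF \<open>u \<in> \<Omega>\<close>] by (intro Deriv.has_derivative_inverse has_derivative_wirtinger g \<open>u \<in> \<Omega>\<close>) auto
    moreover have "(\<lambda>h. - (inverse (?g u) * wirtinger_form (\<lambda>a. wirt a ?g u) (\<lambda>a. wirt_bar a ?g u) h * inverse (?g u)))
      = wirtinger_form (\<lambda>a. - wirt a ?g u / (?g u)\<^sup>2) (\<lambda>a. - wirt_bar a ?g u / (?g u)\<^sup>2)"
      by (rule ext) (simp add: wirtinger_form_def sum_distrib_left sum_distrib_right sum_negf[symmetric]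
          divide_inverse power2_eq_square algebra_simps del: sum_negf)
    ultimately have "((\<lambda>x. inverse (?g x)) has_derivative
        wirtinger_form (\<lambda>a. - wirt a ?g u / (?g u)\<^sup>2) (\<lambda>a. - wirt_bar a ?g u / (?g u)\<^sup>2)) (at u)"
      by (simp only:)
    from wirt_eqI(1)[OF this] show ?thesis .
  qed
  show "wirt_bar b ?L differentiable (at u)"
    using differentiable_cong_open[OF assms(1,2), of "wirt_bar b ?L" "\<lambda>x. wirt_bar b ?g x * inverse (?g x)"]
      eq differentiable_mult[OF Gb di] by blast
  have w: "wirt a (wirt_bar b ?L) u = wirt a (wirt_bar b ?g) u / ?g u
      - wirt a ?g u * cnj (wirt b ?g u) / (?g u)\<^sup>2" for a b
  proof -
    have "wirt a (wirt_bar b ?L) u = wirt a (\<lambda>x. wirt_bar b ?g x * inverse (?g x)) u"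
      by (rule wirt_cong(1)[OF assms(1,2) eq])
    also have "\<dots> = wirt_bar b ?g u * wirt a (\<lambda>x. inverse (?g x)) u + wirt a (wirt_bar b ?g) u * inverse (?g u)"
      by (rule wirt_mult(1)[OF Gb di])
    finally show ?thesis
      by (simp add: wi wirt_bar_real[OF g[OF \<open>u \<in> \<Omega>\<close>]] divide_inverse)
  qed
  have "levi ?L u V = levi ?g u V / ?g u - (\<Sum>a\<in>UNIV. \<Sum>b\<in>UNIV.
      (wirt a ?g u * V $ a) * cnj (wirt b ?g u * V $ b)) / (?g u)\<^sup>2"
    unfolding levi_def w
    by (simp add: sum_divide_distrib sum_subtractf[symmetric] diff_divide_distrib algebra_simps)
  also have "(\<Sum>a\<in>UNIV. \<Sum>b\<in>UNIV. (wirt a ?g u * V $ a) * cnj (wirt b ?g u * V $ b))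
      = (\<Sum>a\<in>UNIV. wirt a ?g u * V $ a) * cnj (\<Sum>a\<in>UNIV. wirt a ?g u * V $ a)"
    by (simp only: cnj_sum sum_product)
  also have "\<dots> = complex_of_real ((cmod (\<Sum>a\<in>UNIV. wirt a ?g u * V $ a))\<^sup>2)"
    by (simp only: complex_norm_square)
  finally show "levi ?L u V = levi ?g u V / ?g u
      - complex_of_real ((cmod (\<Sum>a\<in>UNIV. wirt a ?g u * V $ a))\<^sup>2 / (G u)\<^sup>2)"
    by simp
qed

section \<open>Determinants and inverses of differentiable matrices\<close>

lemma differentiable_prod:
  fixes f :: "'i \<Rightarrow> 'a::real_normed_vector \<Rightarrow> 'b::real_normed_field"
  assumes "\<And>i. i \<in> I \<Longrightarrow> f i differentiable (at x)"
  shows "(\<lambda>x. \<Prod>i\<in>I. f i x) differentiable (at x)"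
  by (rule differentiableI[OF has_derivative_prod])
    (use assms in \<open>simp add: frechet_derivative_works\<close>)

lemma differentiable_det:
  fixes A :: "'a::real_normed_vector \<Rightarrow> complex^'r^'r"
  assumes "\<And>i j. (\<lambda>x. A x $ i $ j) differentiable (at x)"
  shows "(\<lambda>x. det (A x)) differentiable (at x)"
  unfolding det_def
  by (intro differentiable_sum differentiable_mult differentiable_const differentiable_prod assms finite ballI)

lemma matrix_inv_inverse:
  assumes "invertible A"
  shows "A ** matrix_inv A = mat 1" "matrix_inv A ** A = mat 1"
  using someI_ex[OF assms[unfolded invertible_def]] unfolding matrix_inv_def by auto

text \<open>Cramer's rule presents each entry of the inverse as a quotient of determinants, so that
  differentiability of the inverse follows from that of polynomials in the entries.\<close>

lemma matrix_inv_cramer: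
  fixes A :: "complex^'r^'r"
  assumes "invertible A"
  shows "matrix_inv A $ k $ l = det (\<chi> i j. if j = k then (if i = l then 1 else 0) else A $ i $ j) / det A"
proof -
  have "A *v column l (matrix_inv A) = column l (A ** matrix_inv A)"
    by (simp add: vec_eq_iff column_def matrix_vector_mult_def matrix_matrix_mult_def)
  also have "\<dots> = (\<chi> i. if i = l then 1 else 0)"
    using matrix_inv_inverse(1)[OF assms] by (simp add: column_def mat_def)
  finally have "A *v column l (matrix_inv A) = (\<chi> i. if i = l then 1 else 0)" .
  from cramer[OF assms[unfolded invertible_det_nz], THEN iffD1, OF this] show ?thesis
    by (simp add: vec_eq_iff column_def cong: if_cong)
qed

lemma differentiable_matrix_inv:
  fixes A :: "'a::real_normed_vector \<Rightarrow> complex^'r^'r"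
  assumes "open S" "x \<in> S" "\<And>y. y \<in> S \<Longrightarrow> invertible (A y)"
    and A: "\<And>i j. (\<lambda>x. A x $ i $ j) differentiable (at x)"
  shows "(\<lambda>x. matrix_inv (A x) $ k $ l) differentiable (at x)"
proof -
  have e: "(\<lambda>y. (\<chi> i j. if j = k then (if i = l then 1 else 0) else A y $ i $ j) $ i $ j) differentiable (at x)"
    for i j by (cases "j = k") (use A in simp_all)
  have "(\<lambda>y. det (\<chi> i j. if j = k then (if i = l then 1 else 0) else A y $ i $ j) / det (A y)) differentiable (at x)"
    using assms(3)[OF assms(2)] invertible_det_nz[of "A x"]
    by (intro differentiable_divide differentiable_det A e) auto
  then show ?thesis
    using differentiable_cong_open[OF assms(1,2), of "\<lambda>y. matrix_inv (A y) $ k $ l"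
      "\<lambda>y. det (\<chi> i j. if j = k then (if i = l then 1 else 0) else A y $ i $ j) / det (A y)"]
      matrix_inv_cramer[OF assms(3)] by blast
qed

section \<open>Positive definite Hermitian forms\<close>

lemma herm_add_left: "herm H (Y + Z) W = herm H Y W + herm H Z W"
  by (simp add: herm_def sum.distrib algebra_simps)

lemma herm_add_right: "herm H Y (Z + W) = herm H Y Z + herm H Y W"
  by (simp add: herm_def sum.distrib algebra_simps)

lemma herm_scale_left: "herm H (s *s Z) W = s * herm H Z W"
  by (simp add: herm_def sum_distrib_left algebra_simps)

lemma herm_scale_right: "herm H Z (s *s W) = cnj s * herm H Z W"
  by (simp add: herm_def sum_distrib_left algebra_simps)

lemma herm_cnj:
  assumes "pos_def_hermitian H"
  shows "cnj (herm H Z W) = herm H W Z"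
proof -
  have "cnj (H $ i $ j) = H $ j $ i" for i j
    using assms unfolding pos_def_hermitian_def by metis
  then have "cnj (herm H Z W) = (\<Sum>i\<in>UNIV. \<Sum>j\<in>UNIV. H $ j $ i * cnj (Z $ i) * W $ j)"
    by (simp add: herm_def)
  also have "\<dots> = herm H W Z"
    unfolding herm_def by (subst sum.swap) (simp add: algebra_simps)
  finally show ?thesis .
qed

lemma herm_self_real:
  assumes "pos_def_hermitian H"
  shows "herm H Z Z = complex_of_real (Re (herm H Z Z))"
  using herm_cnj[OF assms, of Z Z] by (simp add: complex_eq_iff)

lemma pos_def_hermitianD:
  assumes "pos_def_hermitian H"
  shows "H $ j $ i = cnj (H $ i $ j)" "Z \<noteq> 0 \<Longrightarrow> 0 < Re (herm H Z Z)"
  using assms unfolding pos_def_hermitian_def by blast+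

lemma herm_nonneg: "pos_def_hermitian H \<Longrightarrow> Re (herm H Z Z) \<ge> 0"
  using pos_def_hermitianD(2)[of H Z] by (cases "Z = 0") (simp_all add: herm_def less_imp_le)

lemma herm_Cauchy_Schwarz:
  assumes H: "pos_def_hermitian H"
  shows "(cmod (herm H Y Z))\<^sup>2 \<le> Re (herm H Y Y) * Re (herm H Z Z)"
proof (cases "Z = 0")
  case True
  then show ?thesis by (simp add: herm_def)
next
  case False
  define r where "r = Re (herm H Z Z)"
  have "r > 0" using H False unfolding pos_def_hermitian_def r_def by blast
  have Z: "herm H Z Z = complex_of_real r" unfolding r_def by (rule herm_self_real[OF H])
  \<comment> \<open>The minimizer of the squared length of \<open>Y + s *s Z\<close>; that its
    minimum is nonnegative is the assertion.\<close>
  define s where "s = - herm H Y Z / r"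
  have "herm H (Y + s *s Z) (Y + s *s Z)
      = herm H Y Y + cnj s * herm H Y Z + s * cnj (herm H Y Z) + s * cnj s * complex_of_real r"
    by (simp add: herm_add_left herm_add_right herm_scale_left herm_scale_right Z herm_cnj[OF H] algebra_simps)
  also have "\<dots> = herm H Y Y - herm H Y Z * cnj (herm H Y Z) / r"
    using \<open>r > 0\<close> by (simp add: s_def field_simps)
  also have "\<dots> = herm H Y Y - complex_of_real ((cmod (herm H Y Z))\<^sup>2 / r)"
    by (simp only: complex_norm_square[symmetric] of_real_divide)
  finally have "Re (herm H Y Y) - (cmod (herm H Y Z))\<^sup>2 / r \<ge> 0"
    using herm_nonneg[OF H, of "Y + s *s Z"] by simp
  then show ?thesis using \<open>r > 0\<close> unfolding r_def[symmetric] by (simp add: field_simps)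
qed

lemma pos_def_hermitian_invertible:
  assumes "pos_def_hermitian H"
  shows "invertible H"
proof -
  have "x = 0" if "H *v x = 0" for x
  proof -
    \<comment> \<open>\<open>herm\<close> conjugates its second argument, while \<open>*v\<close>
      contracts the second index of \<open>H\<close>; conjugating \<open>x\<close> matches the
      two.\<close>
    have "herm H (\<chi> i. cnj (x $ i)) (\<chi> i. cnj (x $ i)) = (\<Sum>i\<in>UNIV. (H *v x) $ i * cnj (x $ i))"
      by (simp add: herm_def matrix_vector_mult_def sum_distrib_left sum_distrib_right algebra_simps)
    then have "herm H (\<chi> i. cnj (x $ i)) (\<chi> i. cnj (x $ i)) = 0" using that by simp
    then have "(\<chi> i. cnj (x $ i)) = 0"
      using pos_def_hermitianD(2)[OF assms] by force
    then show "x = 0" by (simp add: vec_eq_iff)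
  qed
  then show ?thesis unfolding invertible_left_inverse matrix_left_invertible_ker by blast
qed

section \<open>Homogeneous functions and their curvature\<close>

lemma sum_UNIV_sum:
  fixes f :: "'n::finite + 'r::finite \<Rightarrow> 'b::comm_monoid_add"
  shows "(\<Sum>a\<in>UNIV. f a) = (\<Sum>\<alpha>\<in>UNIV. f (Inl \<alpha>)) + (\<Sum>i\<in>UNIV. f (Inr i))"
  using sum.Plus[of "UNIV :: 'n set" "UNIV :: 'r set" f] by simp

definition scale_fiber :: "complex \<Rightarrow> complex^('n::finite + 'r::finite) \<Rightarrow> complex^('n + 'r)" where
  "scale_fiber s u = (\<chi> a. case a of Inl \<alpha> \<Rightarrow> u $ Inl \<alpha> | Inr i \<Rightarrow> s * u $ Inr i)"

text \<open>Differentiating a contracted Euler identity in a fiber direction gives an extra term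
  that cancels the right-hand side, while a base direction gives none. This factor records both
  outcomes in one formula.\<close>

definition base_index :: "'n + 'r \<Rightarrow> complex" where
  "base_index a = (case a of Inl _ \<Rightarrow> 1 | Inr _ \<Rightarrow> 0)"

text \<open>The \<open>case\<close> terms come from differentiating the explicit factor: a
  coordinate contributes only under \<open>wirt\<close>, its conjugate only under
  \<open>wirt_bar\<close>.\<close>

lemma wirt_fiber_sum:
  fixes f :: "'r::finite \<Rightarrow> complex^('n::finite + 'r) \<Rightarrow> complex"
  assumes "\<And>i. f i differentiable (at u)"
  shows "wirt a (\<lambda>u. \<Sum>i\<in>UNIV. u $ Inr i * f i u) u
      = (\<Sum>i\<in>UNIV. u $ Inr i * wirt a (f i) u) + (case a of Inl _ \<Rightarrow> 0 | Inr l \<Rightarrow> f l u)"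
    and "wirt_bar a (\<lambda>u. \<Sum>i\<in>UNIV. u $ Inr i * f i u) u = (\<Sum>i\<in>UNIV. u $ Inr i * wirt_bar a (f i) u)"
    and "wirt a (\<lambda>u. \<Sum>i\<in>UNIV. cnj (u $ Inr i) * f i u) u = (\<Sum>i\<in>UNIV. cnj (u $ Inr i) * wirt a (f i) u)"
    and "wirt_bar a (\<lambda>u. \<Sum>i\<in>UNIV. cnj (u $ Inr i) * f i u) u
      = (\<Sum>i\<in>UNIV. cnj (u $ Inr i) * wirt_bar a (f i) u) + (case a of Inl _ \<Rightarrow> 0 | Inr l \<Rightarrow> f l u)"
proof -
  note c = differentiable_component
  have d: "(\<lambda>u. u $ Inr i * f i u) differentiable (at u)"
    "(\<lambda>u. cnj (u $ Inr i) * f i u) differentiable (at u)" for i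
    by (intro differentiable_mult differentiable_cnj assms c)+
  have *: "(\<Sum>i\<in>UNIV. (if a = Inr i then 1 else 0) * f i u) = (case a of Inl _ \<Rightarrow> 0 | Inr l \<Rightarrow> f l u)"
    by (cases a) (simp_all add: mult_if_delta)
  show "wirt a (\<lambda>u. \<Sum>i\<in>UNIV. u $ Inr i * f i u) u
      = (\<Sum>i\<in>UNIV. u $ Inr i * wirt a (f i) u) + (case a of Inl _ \<Rightarrow> 0 | Inr l \<Rightarrow> f l u)"
    by (simp only: wirt_sum(1)[OF finite d(1)] wirt_mult(1)[OF c assms] wirt_component sum.distrib *)
  show "wirt_bar a (\<lambda>u. \<Sum>i\<in>UNIV. u $ Inr i * f i u) u = (\<Sum>i\<in>UNIV. u $ Inr i * wirt_bar a (f i) u)"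
    by (simp add: wirt_sum(2)[OF finite d(1)] wirt_mult(2)[OF c assms] wirt_component)
  show "wirt a (\<lambda>u. \<Sum>i\<in>UNIV. cnj (u $ Inr i) * f i u) u = (\<Sum>i\<in>UNIV. cnj (u $ Inr i) * wirt a (f i) u)"
    by (simp add: wirt_sum(1)[OF finite d(2)] wirt_mult(1)[OF differentiable_cnj[OF c] assms]
        wirt_cnj(1)[OF c] wirt_component)
  have "cnj (if a = Inr i then 1 else 0) = (if a = Inr i then 1 else 0)" for i by simp
  then show "wirt_bar a (\<lambda>u. \<Sum>i\<in>UNIV. cnj (u $ Inr i) * f i u) u
      = (\<Sum>i\<in>UNIV. cnj (u $ Inr i) * wirt_bar a (f i) u) + (case a of Inl _ \<Rightarrow> 0 | Inr l \<Rightarrow> f l u)"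
    by (simp only: wirt_sum(2)[OF finite d(2)] wirt_mult(2)[OF differentiable_cnj[OF c] assms]
        wirt_cnj(2)[OF c] wirt_component sum.distrib *)
qed

text \<open>The square of the Finsler metric in the coordinates of one chart and one trivialization,
  off the zero section. The curvature computation takes place entirely at this level.\<close>

locale homogeneous_metric =
  fixes G :: "complex^('n::finite + 'r::finite) \<Rightarrow> real" and \<Omega> :: "(complex^('n + 'r)) set"
  assumes open_domain: "open \<Omega>"
    and smooth: "smooth_on G \<Omega>"
    and pos: "u \<in> \<Omega> \<Longrightarrow> G u > 0"
    and homogeneous: "u \<in> \<Omega> \<Longrightarrow> s \<noteq> 0 \<Longrightarrow> G (scale_fiber s u) = (cmod s)\<^sup>2 * G u"
    and pos_def: "u \<in> \<Omega> \<Longrightarrow> pos_def_hermitian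
      (\<chi> i j. wirt (Inr i) (wirt_bar (Inr j) (\<lambda>x. complex_of_real (G x))) u)"
begin

definition g :: "complex^('n + 'r) \<Rightarrow> complex" where "g u = complex_of_real (G u)"

definition gg :: "'n + 'r \<Rightarrow> 'n + 'r \<Rightarrow> complex^('n + 'r) \<Rightarrow> complex" where
  "gg a b = wirt a (wirt_bar b g)"

definition hess :: "complex^('n + 'r) \<Rightarrow> complex^'r^'r" where
  "hess u = (\<chi> i j. gg (Inr i) (Inr j) u)"

definition fib :: "complex^('n + 'r) \<Rightarrow> complex^'r" where "fib u = (\<chi> i. u $ Inr i)"

lemma g_smooth: "smooth_on g \<Omega>"
  unfolding g_def[abs_def] by (rule smooth_on_bounded_linear[OF bounded_linear_of_real open_domain smooth])

lemma gg_smooth: "smooth_on (gg a b) \<Omega>"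
  unfolding gg_def by (intro smooth_on_wirt open_domain g_smooth)

lemma diff:
  assumes "u \<in> \<Omega>"
  shows "g differentiable (at u)" "wirt a g differentiable (at u)" "wirt_bar a g differentiable (at u)"
    "gg a b differentiable (at u)" "wirt c (gg a b) differentiable (at u)"
  by (intro smooth_on_differentiable[OF _ assms] smooth_on_wirt open_domain g_smooth gg_smooth)+

lemma gg_commute: "u \<in> \<Omega> \<Longrightarrow> wirt_bar b (wirt a g) u = gg a b u"
  unfolding gg_def g_def[abs_def] by (rule wirt_commute[OF open_domain smooth])

lemma gg_cnj:
  assumes "u \<in> \<Omega>"
  shows "cnj (gg b a u) = gg a b u"
proof -
  have "wirt a g y = cnj (wirt_bar a g y)" if "y \<in> \<Omega>" for y
    using wirt_bar_real[OF diff(1)[OF that, unfolded g_def[abs_def]]] by (simp add: g_def[abs_def])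
  then have "wirt_bar b (wirt a g) u = wirt_bar b (\<lambda>y. cnj (wirt_bar a g y)) u"
    by (rule wirt_cong(2)[OF open_domain assms])
  also have "\<dots> = cnj (wirt b (wirt_bar a g) u)" by (rule wirt_cnj(2)[OF diff(3)[OF assms]])
  finally show ?thesis using gg_commute[OF assms] by (simp add: gg_def)
qed

lemma hess_pos_def: "u \<in> \<Omega> \<Longrightarrow> pos_def_hermitian (hess u)"
  unfolding hess_def gg_def g_def[abs_def] by (rule pos_def)

text \<open>Both identities come from differentiating
  \<open>G (scale_fiber s u) = (cmod s)\<^sup>2 * G u\<close> in \<open>s\<close> at 1, where the
  two sums are the coefficients of \<open>t\<close> and of \<open>cnj t\<close>.\<close>

lemma euler:
  assumes u: "u \<in> \<Omega>"
  shows "(\<Sum>i\<in>UNIV. u $ Inr i * wirt (Inr i) g u) = g u"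
    "(\<Sum>i\<in>UNIV. cnj (u $ Inr i) * wirt_bar (Inr i) g u) = g u"
proof -
  define p where "p = (\<Sum>i\<in>UNIV. u $ Inr i * wirt (Inr i) g u)"
  define q where "q = (\<Sum>i\<in>UNIV. cnj (u $ Inr i) * wirt_bar (Inr i) g u)"
  define E :: "complex \<Rightarrow> complex^('n + 'r)"
    where "E t = (\<chi> a. case a of Inl _ \<Rightarrow> 0 | Inr i \<Rightarrow> t * u $ Inr i)" for t
  have s1: "scale_fiber 1 u = u" by (simp add: scale_fiber_def vec_eq_iff split: sum.split)
  have "((\<lambda>s. scale_fiber s u) has_derivative E) (at 1)"
    unfolding E_def
  proof (rule has_derivative_components)
    show "((\<lambda>s. scale_fiber s u $ b) has_derivative (\<lambda>t. case b of Inl _ \<Rightarrow> 0 | Inr i \<Rightarrow> t * u $ Inr i)) (at 1)" for b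
      by (cases b) (auto simp: scale_fiber_def intro!: derivative_eq_intros)
  qed
  from has_derivative_compose[OF this, of g] has_derivative_wirtinger[OF diff(1)[OF u]]
  have 1: "((\<lambda>s. g (scale_fiber s u)) has_derivative
      (\<lambda>t. wirtinger_form (\<lambda>a. wirt a g u) (\<lambda>a. wirt_bar a g u) (E t))) (at 1)"
    by (simp add: s1)
  have form: "wirtinger_form (\<lambda>a. wirt a g u) (\<lambda>a. wirt_bar a g u) (E t) = p * t + q * cnj t" for t
    by (simp add: wirtinger_form_def sum_UNIV_sum E_def p_def q_def sum.distrib sum_distrib_left algebra_simps)
  have dr: "((\<lambda>s. s * cnj s * g u) has_derivative (\<lambda>t. (t + cnj t) * g u)) (at 1)"
    by (auto intro!: derivative_eq_intros bounded_linear.has_derivative[OF bounded_linear_cnj] simp: algebra_simps)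
  have eq: "s * cnj s * g u = g (scale_fiber s u)" if "s \<in> - {0}" for s
    using homogeneous[OF u, of s] that by (simp add: g_def complex_norm_square[symmetric])
  have "((\<lambda>s. g (scale_fiber s u)) has_derivative (\<lambda>t. (t + cnj t) * g u)) (at 1)"
    by (rule has_derivative_transform_within_open[where s="- {0}", OF dr _ _ eq]) auto
  from has_derivative_unique[OF 1 this] have "p * t + q * cnj t = (t + cnj t) * g u" for t
    unfolding form by metis
  \<comment> \<open>A real-linear map is tested on the real basis 1, \<open>\<i>\<close>, which
    separates \<open>p\<close> from \<open>q\<close>.\<close>
  from this[of 1] this[of \<i>] have "p + q = 2 * g u" "p = q" by (auto simp: algebra_simps)
  then show "p = g u" "q = g u" by auto
qed

text \<open>The first Euler identity under \<open>wirt_bar b\<close>; the fiber coordinates are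
  holomorphic and contribute no term.\<close>

lemma contract_left:
  assumes u: "u \<in> \<Omega>"
  shows "(\<Sum>i\<in>UNIV. u $ Inr i * gg (Inr i) b u) = wirt_bar b g u"
proof -
  have "wirt_bar b (\<lambda>u. \<Sum>i\<in>UNIV. u $ Inr i * wirt (Inr i) g u) u = wirt_bar b g u"
    by (rule wirt_cong(2)[OF open_domain u euler(1)])
  then show ?thesis
    by (simp add: wirt_fiber_sum(2)[OF diff(2)[OF u]] gg_commute[OF u])
qed

lemma contract_right:
  assumes u: "u \<in> \<Omega>"
  shows "(\<Sum>j\<in>UNIV. cnj (u $ Inr j) * gg a (Inr j) u) = wirt a g u"
proof -
  have "wirt a (\<lambda>u. \<Sum>i\<in>UNIV. cnj (u $ Inr i) * wirt_bar (Inr i) g u) u = wirt a g u"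
    by (rule wirt_cong(1)[OF open_domain u euler(2)])
  then show ?thesis
    by (simp add: wirt_fiber_sum(3)[OF diff(3)[OF u]] gg_def)
qed

text \<open>\<open>contract_left\<close> under \<open>wirt a\<close>. For a fiber index the
  derivative of the factor \<open>u $ Inr i\<close> already accounts for the right-hand side, so the
  contraction vanishes: the Hessian is homogeneous of degree 0 in the fiber.\<close>

lemma contract_wirt_hess:
  assumes u: "u \<in> \<Omega>"
  shows "(\<Sum>i\<in>UNIV. u $ Inr i * wirt a (gg (Inr i) (Inr j)) u) = base_index a * gg a (Inr j) u"
proof -
  have "wirt a (\<lambda>u. \<Sum>i\<in>UNIV. u $ Inr i * gg (Inr i) (Inr j) u) u = gg a (Inr j) u"
    unfolding gg_def[of a] by (rule wirt_cong(1)[OF open_domain u contract_left])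
  then show ?thesis
    unfolding wirt_fiber_sum(1)[OF diff(4)[OF u]] by (cases a) (simp_all add: base_index_def)
qed

lemma contract_wirt_bar:
  assumes u: "u \<in> \<Omega>"
  shows "(\<Sum>j\<in>UNIV. cnj (u $ Inr j) * wirt_bar b (gg a (Inr j)) u) = base_index b * gg a b u"
proof -
  have "wirt_bar b (\<lambda>u. \<Sum>j\<in>UNIV. cnj (u $ Inr j) * gg a (Inr j) u) u = wirt_bar b (wirt a g) u"
    by (rule wirt_cong(2)[OF open_domain u contract_right])
  then show ?thesis
    unfolding wirt_fiber_sum(4)[OF diff(4)[OF u]] gg_commute[OF u] by (cases b) (simp_all add: base_index_def)
qed

text \<open>This is the fourth-order term of the curvature. \<open>contract_wirt_hess\<close> under
  \<open>wirt_bar b\<close> removes one order and \<open>contract_wirt_bar\<close> another, leaving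
  a second derivative of \<open>G\<close>.\<close>

lemma contract_wirt_bar_wirt:
  assumes u: "u \<in> \<Omega>"
  shows "(\<Sum>j\<in>UNIV. \<Sum>i\<in>UNIV. cnj (u $ Inr j) * (u $ Inr i * wirt_bar b (wirt a (gg (Inr i) (Inr j))) u))
    = base_index a * base_index b * gg a b u"
proof -
  have "wirt_bar b (\<lambda>u. \<Sum>i\<in>UNIV. u $ Inr i * wirt a (gg (Inr i) (Inr j)) u) u
      = wirt_bar b (\<lambda>u. base_index a * gg a (Inr j) u) u" for j
    by (rule wirt_cong(2)[OF open_domain u contract_wirt_hess])
  then have "(\<Sum>i\<in>UNIV. u $ Inr i * wirt_bar b (wirt a (gg (Inr i) (Inr j))) u)
      = base_index a * wirt_bar b (gg a (Inr j)) u" for j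
    by (simp add: wirt_fiber_sum(2)[OF diff(5)[OF u]] wirt_cmult(2)[OF diff(4)[OF u]])
  then have "(\<Sum>j\<in>UNIV. cnj (u $ Inr j) * (\<Sum>i\<in>UNIV. u $ Inr i * wirt_bar b (wirt a (gg (Inr i) (Inr j))) u))
      = base_index a * (\<Sum>j\<in>UNIV. cnj (u $ Inr j) * wirt_bar b (gg a (Inr j)) u)"
    by (simp add: sum_distrib_left mult_ac)
  then show ?thesis
    by (simp add: contract_wirt_bar[OF u] sum_distrib_left)
qed

lemma herm_fib:
  assumes u: "u \<in> \<Omega>"
  shows "herm (hess u) (fib u) (fib u) = g u"
proof -
  have "herm (hess u) (fib u) (fib u)
      = (\<Sum>i\<in>UNIV. u $ Inr i * (\<Sum>j\<in>UNIV. cnj (u $ Inr j) * gg (Inr i) (Inr j) u))"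
    by (simp add: herm_def hess_def fib_def sum_distrib_left mult_ac)
  then show ?thesis by (simp add: contract_right[OF u] euler[OF u])
qed

text \<open>The Chern connection matrix in the homogeneous fiber coordinates;
  \<open>chern_curvature_fix_coord\<close> relates it to the affine patch.\<close>

definition conn :: "'n + 'r \<Rightarrow> complex^('n + 'r) \<Rightarrow> complex^'r^'r" where
  "conn a u = (\<chi> i j. wirt a (gg (Inr i) (Inr j)) u) ** matrix_inv (hess u)"

lemma conn_diff:
  assumes u: "u \<in> \<Omega>"
  shows "(\<lambda>x. conn a x $ i $ j) differentiable (at u)"
proof -
  have "(\<lambda>x. matrix_inv (hess x) $ k $ l) differentiable (at u)" for k l
    using hess_pos_def pos_def_hermitian_invertible diff(4)[OF u]
    by (intro differentiable_matrix_inv[OF open_domain u]) (auto simp: hess_def)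
  then show ?thesis
    unfolding conn_def matrix_matrix_mult_def
    by (simp add: diff(5)[OF u] differentiable_sum)
qed

lemma conn_hess:
  assumes u: "u \<in> \<Omega>"
  shows "conn a u ** hess u = (\<chi> i j. wirt a (gg (Inr i) (Inr j)) u)"
  unfolding conn_def
  by (simp add: matrix_mul_assoc[symmetric] matrix_inv_inverse(2)[OF pos_def_hermitian_invertible[OF hess_pos_def[OF u]]])

text \<open>\<open>contract_wirt_hess\<close> as a linear system for the connection applied to the
  tautological section. For a base index \<open>a\<close> it says that
  \<open>- (fib u v* conn a u)\<close> is the fiber part of the lift of that base direction
  orthogonal to all fiber directions.\<close>

lemma fib_conn_hess:
  assumes u: "u \<in> \<Omega>"
  shows "(fib u v* conn a u) v* hess u = (\<chi> j. base_index a * gg a (Inr j) u)"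
  unfolding vector_matrix_mul_assoc conn_hess[OF u]
  using contract_wirt_hess[OF u] by (simp add: vec_eq_iff vector_matrix_mult_def fib_def mult_ac)

lemma herm_vector_matrix:
  "herm H (Z v* R) W = (\<Sum>m\<in>UNIV. \<Sum>i\<in>UNIV. cnj (W $ m) * (Z $ i * (R ** H) $ i $ m))"
proof -
  have "herm H Z W = (\<Sum>m\<in>UNIV. cnj (W $ m) * (Z v* H) $ m)" for Z
    unfolding herm_def
    by (subst sum.swap) (simp add: vector_matrix_mult_def sum_distrib_left mult_ac)
  then have "herm H (Z v* R) W = (\<Sum>m\<in>UNIV. cnj (W $ m) * (Z v* (R ** H)) $ m)"
    by (simp add: vector_matrix_mul_assoc)
  then show ?thesis by (simp add: vector_matrix_mult_def sum_distrib_left mult_ac)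
qed

text \<open>Applying d-bar to the identity \<open>conn_hess\<close> gives curvature times Hessian
  without differentiating an inverse. Contraction with \<open>fib u\<close> on both sides then
  lowers the fourth derivatives by \<open>contract_wirt_bar_wirt\<close> and the third ones by
  \<open>contract_wirt_bar\<close>.\<close>

lemma herm_curvature:
  assumes u: "u \<in> \<Omega>"
  shows "herm (hess u) (fib u v* (\<chi> i j. - wirt_bar b (\<lambda>x. conn a x $ i $ j) u)) (fib u)
    = base_index b * (- (base_index a * gg a b u) + (\<Sum>l\<in>UNIV. (fib u v* conn a u) $ l * gg (Inr l) b u))"
proof -
  let ?R = "\<chi> i j. - wirt_bar b (\<lambda>x. conn a x $ i $ j) u"
  have RH: "(?R ** hess u) $ i $ m = - wirt_bar b (wirt a (gg (Inr i) (Inr m))) u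
      + (\<Sum>l\<in>UNIV. conn a u $ i $ l * wirt_bar b (gg (Inr l) (Inr m)) u)" for i m
  proof -
    have "(\<Sum>l\<in>UNIV. conn a x $ i $ l * gg (Inr l) (Inr m) x) = wirt a (gg (Inr i) (Inr m)) x" if "x \<in> \<Omega>" for x
      using arg_cong[OF conn_hess[OF that], of "\<lambda>M. M $ i $ m"] by (simp add: matrix_matrix_mult_def hess_def)
    then have "wirt_bar b (\<lambda>x. \<Sum>l\<in>UNIV. conn a x $ i $ l * gg (Inr l) (Inr m) x) u
        = wirt_bar b (wirt a (gg (Inr i) (Inr m))) u"
      by (rule wirt_cong(2)[OF open_domain u])
    also have "wirt_bar b (\<lambda>x. \<Sum>l\<in>UNIV. conn a x $ i $ l * gg (Inr l) (Inr m) x) u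
        = (\<Sum>l\<in>UNIV. conn a u $ i $ l * wirt_bar b (gg (Inr l) (Inr m)) u)
          + (\<Sum>l\<in>UNIV. wirt_bar b (\<lambda>x. conn a x $ i $ l) u * gg (Inr l) (Inr m) u)"
      by (simp add: wirt_sum(2)[OF finite differentiable_mult[OF conn_diff[OF u] diff(4)[OF u]]]
          wirt_mult(2)[OF conn_diff[OF u] diff(4)[OF u]] sum.distrib)
    finally show ?thesis
      by (simp add: matrix_matrix_mult_def hess_def sum_negf algebra_simps)
  qed
  let ?A = "\<Sum>m\<in>UNIV. \<Sum>i\<in>UNIV. cnj (u $ Inr m) * (u $ Inr i * wirt_bar b (wirt a (gg (Inr i) (Inr m))) u)"
  let ?B = "\<Sum>m\<in>UNIV. \<Sum>i\<in>UNIV. \<Sum>l\<in>UNIV.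
      cnj (u $ Inr m) * (u $ Inr i * (conn a u $ i $ l * wirt_bar b (gg (Inr l) (Inr m)) u))"
  have "herm (hess u) (fib u v* ?R) (fib u) = - ?A + ?B"
    unfolding herm_vector_matrix RH
    by (simp add: fib_def algebra_simps sum.distrib sum_distrib_left sum_negf sum_subtractf)
  also have "?A = base_index a * base_index b * gg a b u" by (rule contract_wirt_bar_wirt[OF u])
  also have "?B = (\<Sum>l\<in>UNIV. (fib u v* conn a u) $ l * (\<Sum>m\<in>UNIV. cnj (u $ Inr m) * wirt_bar b (gg (Inr l) (Inr m)) u))"
  proof -
    have "(\<Sum>m\<in>UNIV. \<Sum>i\<in>UNIV. \<Sum>l\<in>UNIV. f m i l) = (\<Sum>l\<in>UNIV. \<Sum>m\<in>UNIV. \<Sum>i\<in>UNIV. f m i l)"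
      for f :: "'r \<Rightarrow> 'r \<Rightarrow> 'r \<Rightarrow> complex"
      by (simp add: sum.cartesian_product)
        (rule sum.reindex_bij_witness[where i="\<lambda>(l, m, i). (m, i, l)" and j="\<lambda>(m, i, l). (l, m, i)"]; auto)
    then have "?B = (\<Sum>l\<in>UNIV. \<Sum>m\<in>UNIV. \<Sum>i\<in>UNIV.
      cnj (u $ Inr m) * (u $ Inr i * (conn a u $ i $ l * wirt_bar b (gg (Inr l) (Inr m)) u)))" .
    then show ?thesis
      by (simp add: vector_matrix_mult_def fib_def sum_distrib_left sum_distrib_right mult_ac)
  qed
  also have "\<dots> = base_index b * (\<Sum>l\<in>UNIV. (fib u v* conn a u) $ l * gg (Inr l) b u)"
    by (simp add: contract_wirt_bar[OF u] sum_distrib_left mult_ac)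
  finally show ?thesis by (simp add: algebra_simps)
qed

end

section \<open>Affine coordinates on the projectivization and the Kobayashi curvature\<close>

definition fix_coord :: "'r \<Rightarrow> complex^('n::finite + 'r::finite) \<Rightarrow> complex^('n + 'r)" where
  "fix_coord k u = (\<chi> a. if a = Inr k then 1 else u $ a)"

lemma has_derivative_fix_coord:
  "(fix_coord k has_derivative (\<lambda>h. \<chi> b. if b = Inr k then 0 else h $ b)) (at u)"
proof (rule has_derivative_components)
  show "((\<lambda>x. fix_coord k x $ b) has_derivative (\<lambda>h. if b = Inr k then 0 else h $ b)) (at u)" for b
    by (cases "b = Inr k")
      (simp_all add: fix_coord_def bounded_linear_imp_has_derivative[OF bounded_linear_vec_nth])
qed

lemma continuous_fix_coord: "continuous_on UNIV (fix_coord k)"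
  by (intro continuous_at_imp_continuous_on ballI has_derivative_continuous[OF has_derivative_fix_coord])

text \<open>The derivative of \<open>fix_coord k\<close> deletes the component \<open>Inr k\<close>
  and keeps all others, so it fixes every direction with \<open>a \<noteq> Inr k\<close>.\<close>

lemma wirt_fix_coord:
  assumes "a \<noteq> Inr k" "f differentiable (at (fix_coord k u))"
  shows "wirt a (\<lambda>x. f (fix_coord k x)) u = wirt a f (fix_coord k u)"
    "wirt_bar a (\<lambda>x. f (fix_coord k x)) u = wirt_bar a f (fix_coord k u)"
proof -
  define J :: "'a + 'b \<Rightarrow> 'a + 'b \<Rightarrow> complex"
    where "J b c = (if b = Inr k then 0 else if c = b then 1 else 0)" for b c
  have D: "(\<chi> b. if b = Inr k then 0 else h $ b) $ b = (\<Sum>c\<in>UNIV. J b c * h $ c)" for h b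
    by (simp add: J_def mult_if_delta)
  have "s * J b a = (if b = a then s else 0)" "s * cnj (J b a) = (if b = a then s else 0)" for b s
    using assms(1) by (auto simp: J_def)
  then show "wirt a (\<lambda>x. f (fix_coord k x)) u = wirt a f (fix_coord k u)"
    "wirt_bar a (\<lambda>x. f (fix_coord k x)) u = wirt_bar a f (fix_coord k u)"
    using wirt_chain[OF has_derivative_fix_coord assms(2) D, of a] by simp_all
qed

definition embed_fiber :: "complex^'r \<Rightarrow> complex^('n::finite + 'r::finite)" where
  "embed_fiber Y = (\<chi> a. case a of Inl _ \<Rightarrow> 0 | Inr i \<Rightarrow> Y $ i)"

context homogeneous_metric
begin

text \<open>The metric on the patch is the Hessian on the slice where coordinate
  \<open>Inr k\<close> equals 1. All directions other than \<open>Inr k\<close> are tangent to this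
  slice, so these curvature coefficients can be computed in homogeneous coordinates.\<close>

lemma chern_curvature_fix_coord:
  assumes u: "u \<in> \<Omega>" "fix_coord k u = u" and ab: "a \<noteq> Inr k" "b \<noteq> Inr k"
  shows "chern_curvature (\<lambda>x. hess (fix_coord k x)) a b u = (\<chi> i j. - wirt_bar b (\<lambda>x. conn a x $ i $ j) u)"
proof -
  let ?N = "fix_coord k -` \<Omega>"
  have N: "open ?N" using continuous_fix_coord open_domain by (metis open_vimage)
  have uN: "u \<in> ?N" using u by simp
  have c: "chern_connection (\<lambda>x. hess (fix_coord k x)) a x = conn a (fix_coord k x)" if "x \<in> ?N" for x
    using that wirt_fix_coord(1)[OF ab(1) diff(4)]
    by (simp add: chern_connection_def conn_def hess_def)
  have "wirt_bar b (\<lambda>x. chern_connection (\<lambda>x. hess (fix_coord k x)) a x $ i $ j) u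
      = wirt_bar b (\<lambda>x. conn a (fix_coord k x) $ i $ j) u" for i j
    by (rule wirt_cong(2)[OF N uN]) (simp add: c)
  moreover have "wirt_bar b (\<lambda>x. conn a (fix_coord k x) $ i $ j) u = wirt_bar b (\<lambda>x. conn a x $ i $ j) u" for i j
    using wirt_fix_coord(2)[OF ab(2), of "\<lambda>x. conn a x $ i $ j" u] conn_diff u by simp
  ultimately show ?thesis by (simp add: chern_curvature_def)
qed

text \<open>For a fiber index the system \<open>fib_conn_hess\<close> has right-hand side 0 and an
  invertible matrix. Together with the factor \<open>base_index b\<close> in
  \<open>herm_curvature\<close> this removes all fiber directions from the Kobayashi
  curvature.\<close>

lemma fib_conn_fiber:
  assumes u: "u \<in> \<Omega>"
  shows "fib u v* conn (Inr i) u = 0"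
proof -
  have "(fib u v* conn (Inr i) u) v* hess u = 0"
    using fib_conn_hess[OF u, of "Inr i"] by (simp add: base_index_def vec_eq_iff)
  then have "(fib u v* conn (Inr i) u) v* (hess u ** matrix_inv (hess u)) = 0"
    by (simp flip: vector_matrix_mul_assoc)
  then show ?thesis
    by (simp add: matrix_inv_inverse(1)[OF pos_def_hermitian_invertible[OF hess_pos_def[OF u]]])
qed

text \<open>The pointwise form of the result. \<open>V\<close> is the orthogonal lift;
  \<open>A\<close> exhibits its fiber part as a linear function of the base part, which is what a
  section needs in order to realize it.\<close>

lemma kobayashi_levi:
  fixes w :: "complex^('n + 'r)"
  assumes u: "u \<in> \<Omega>" "fix_coord k u = u" and "\<kappa> > 0"
  defines "H \<equiv> \<lambda>x. hess (fix_coord k x)"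
  defines "L \<equiv> \<lambda>x. complex_of_real (ln (\<kappa> * G x))"
  defines "K \<equiv> \<Sum>a\<in>- {Inr k}. \<Sum>b\<in>- {Inr k}.
      line_block (H u) (chern_curvature H a b u) (fib u) * w $ a * cnj (w $ b)"
  obtains V :: "complex^('n + 'r)" and A where "\<forall>\<alpha>. V $ Inl \<alpha> = w $ Inl \<alpha>" "\<forall>i. V $ Inr i = (\<Sum>\<alpha>\<in>UNIV. A i \<alpha> * w $ Inl \<alpha>)"
    "K = - levi L u V" "K \<in> \<real>"
    "\<forall>V'. (\<forall>\<alpha>. V' $ Inl \<alpha> = w $ Inl \<alpha>) \<longrightarrow> Re (levi L u V) \<le> Re (levi L u V')"
proof -
  note uu = u(1)
  define y where "y a = fib u v* conn a u" for a
  \<comment> \<open>The sign makes the fiber part cancel the base part in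
    \<open>V_orth\<close>.\<close>
  define X where "X = (\<chi> l. - (\<Sum>\<alpha>\<in>UNIV. w $ Inl \<alpha> * y (Inl \<alpha>) $ l))"
  define V :: "complex^('n + 'r)" where "V = (\<chi> a. case a of Inl \<alpha> \<Rightarrow> w $ Inl \<alpha> | Inr l \<Rightarrow> X $ l)"
  define M where "M = (\<chi> a b. gg a b u)"
  have M_cnj: "cnj (herm M Z W) = herm M W Z" for Z W
  proof -
    have "cnj (herm M Z W) = (\<Sum>a\<in>UNIV. \<Sum>b\<in>UNIV. gg b a u * cnj (Z $ a) * W $ b)"
      by (simp add: herm_def M_def gg_cnj[OF uu])
    also have "\<dots> = herm M W Z"
      unfolding herm_def M_def by (subst sum.swap) (simp add: algebra_simps)
    finally show ?thesis .
  qed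
  have M_embed: "herm M Z (embed_fiber Y) = (\<Sum>j\<in>UNIV. cnj (Y $ j) * (\<Sum>a\<in>UNIV. Z $ a * gg a (Inr j) u))" for Z Y
  proof -
    have "herm M Z (embed_fiber Y) = (\<Sum>b\<in>UNIV. \<Sum>a\<in>UNIV. gg a b u * Z $ a * cnj (embed_fiber Y $ b))"
      unfolding herm_def M_def by (subst sum.swap) simp
    then show ?thesis
      unfolding sum_UNIV_sum[of "\<lambda>b. \<Sum>a\<in>UNIV. gg a b u * Z $ a * cnj (embed_fiber Y $ b)"]
      by (simp add: embed_fiber_def sum_distrib_left mult_ac)
  qed
  have M_hess: "herm M (embed_fiber Z) (embed_fiber Y) = herm (hess u) Z Y" for Z Y
    unfolding M_embed unfolding herm_def
    by (subst sum.swap) (simp add: sum_UNIV_sum embed_fiber_def hess_def sum_distrib_left mult_ac)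
  have yh: "(\<Sum>l\<in>UNIV. y a $ l * gg (Inr l) (Inr j) u) = base_index a * gg a (Inr j) u" for a j
    using arg_cong[OF fib_conn_hess[OF uu, of a], of "\<lambda>x. x $ j"]
    by (simp add: y_def hess_def vector_matrix_mult_def mult_ac)
  have V_orth: "(\<Sum>a\<in>UNIV. V $ a * gg a (Inr j) u) = 0" for j
  proof -
    have "(\<Sum>l\<in>UNIV. X $ l * gg (Inr l) (Inr j) u)
        = - (\<Sum>l\<in>UNIV. \<Sum>\<alpha>\<in>UNIV. w $ Inl \<alpha> * (y (Inl \<alpha>) $ l * gg (Inr l) (Inr j) u))"
      by (simp add: X_def sum_negf sum_distrib_left sum_distrib_right mult_ac)
    also have "\<dots> = - (\<Sum>\<alpha>\<in>UNIV. w $ Inl \<alpha> * (\<Sum>l\<in>UNIV. y (Inl \<alpha>) $ l * gg (Inr l) (Inr j) u))"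
      by (subst sum.swap) (simp add: sum_distrib_left)
    also have "\<dots> = - (\<Sum>\<alpha>\<in>UNIV. w $ Inl \<alpha> * gg (Inl \<alpha>) (Inr j) u)"
      by (simp add: yh base_index_def)
    finally show ?thesis by (simp add: sum_UNIV_sum V_def)
  qed
  have V_embed: "herm M V (embed_fiber Y) = 0" for Y
    by (simp add: M_embed V_orth)
  have MV_real: "herm M V V \<in> \<real>"
    using M_cnj[of V V] by (simp add: Reals_cnj_iff)
  have G0: "G u > 0" by (rule pos[OF uu])
  have gG: "g u = complex_of_real (G u)" by (simp add: g_def)
  have GD: "G differentiable (at x)" if "x \<in> \<Omega>" for x by (rule smooth_on_differentiable[OF smooth that])
  have levi_L: "levi L u (V + embed_fiber Y) = (herm M V V + herm (hess u) Y Y) / complex_of_real (G u)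
      - complex_of_real ((cmod (herm (hess u) Y (fib u)))\<^sup>2 / (G u)\<^sup>2)" for Y
  proof -
    have "levi (\<lambda>x. complex_of_real (G x)) u (V + embed_fiber Y) = herm M (V + embed_fiber Y) (V + embed_fiber Y)"
      by (simp add: levi_def herm_def M_def gg_def g_def[abs_def])
    also have "\<dots> = herm M V V + herm (hess u) Y Y"
      using M_cnj[of V "embed_fiber Y"] by (simp add: herm_add_left herm_add_right V_embed M_hess)
    finally have 1: "levi (\<lambda>x. complex_of_real (G x)) u (V + embed_fiber Y) = herm M V V + herm (hess u) Y Y" .
    \<comment> \<open>By \<open>contract_right\<close> the differential of \<open>G\<close> is the
      pairing with the vertical vector \<open>fib u\<close>. It therefore annihilates
      \<open>V\<close>, and only \<open>Y\<close> enters the squared modulus.\<close>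
    have "(\<Sum>a\<in>UNIV. wirt a g u * Z $ a) = herm M Z (embed_fiber (fib u))" for Z
    proof -
      have "(\<Sum>a\<in>UNIV. wirt a g u * Z $ a) = (\<Sum>a\<in>UNIV. \<Sum>j\<in>UNIV. cnj (fib u $ j) * (Z $ a * gg a (Inr j) u))"
        unfolding contract_right[OF uu, symmetric] by (simp add: fib_def sum_distrib_left sum_distrib_right mult_ac)
      also have "\<dots> = herm M Z (embed_fiber (fib u))"
        unfolding M_embed by (subst sum.swap) (simp add: sum_distrib_left)
      finally show ?thesis .
    qed
    then have 2: "(\<Sum>a\<in>UNIV. wirt a g u * (V + embed_fiber Y) $ a) = herm (hess u) Y (fib u)"
      by (simp only: herm_add_left V_embed M_hess add_0_left)
    have "levi L u (V + embed_fiber Y) = levi (\<lambda>x. complex_of_real (G x)) u (V + embed_fiber Y) / complex_of_real (G u)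
        - complex_of_real ((cmod (\<Sum>a\<in>UNIV. wirt a (\<lambda>x. complex_of_real (G x)) u * (V + embed_fiber Y) $ a))\<^sup>2 / (G u)\<^sup>2)"
      unfolding L_def
      using diff(3)[OF uu] by (intro levi_ln(2)[OF open_domain uu GD pos \<open>\<kappa> > 0\<close>]) (simp_all add: g_def[abs_def])
    then show ?thesis using 1 2 by (simp add: g_def[abs_def])
  qed
  have "embed_fiber 0 = (0 :: complex^('n + 'r))" by (simp add: embed_fiber_def vec_eq_iff split: sum.split)
  then have levi_V: "levi L u V = herm M V V / complex_of_real (G u)"
    using levi_L[of 0] by (simp add: herm_def)
  show ?thesis
  proof (rule that[of V "\<lambda>i \<alpha>. - y (Inl \<alpha>) $ i"])
    show "\<forall>\<alpha>. V $ Inl \<alpha> = w $ Inl \<alpha>" by (simp add: V_def)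
    show "\<forall>i. V $ Inr i = (\<Sum>\<alpha>\<in>UNIV. - y (Inl \<alpha>) $ i * w $ Inl \<alpha>)"
      by (simp add: V_def X_def sum_negf mult.commute)
    have block: "line_block (H u) (chern_curvature H a b u) (fib u)
        = base_index b * (- (base_index a * gg a b u) + (\<Sum>l\<in>UNIV. y a $ l * gg (Inr l) b u)) / g u"
      if "a \<in> - {Inr k}" "b \<in> - {Inr k}" for a b
      using that u herm_fib[OF uu] herm_curvature[OF uu]
      by (simp add: line_block_def H_def chern_curvature_fix_coord y_def)
    define S where "S a b = base_index b * (- (base_index a * gg a b u) + (\<Sum>l\<in>UNIV. y a $ l * gg (Inr l) b u))
        / g u * w $ a * cnj (w $ b)" for a b
    have S0: "S a (Inr i) = 0" "S (Inr i) b = 0" for a b i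
      using fib_conn_fiber[OF uu, of i] by (simp_all add: S_def base_index_def y_def)
    \<comment> \<open>Terms with a fiber index vanish, so restoring the omitted index
      \<open>Inr k\<close> changes nothing.\<close>
    have red: "(\<Sum>a\<in>- {Inr k}. f a) = (\<Sum>\<alpha>\<in>UNIV. f (Inl \<alpha>))" if "\<And>i. f (Inr i) = 0"
      for f :: "'n + 'r \<Rightarrow> complex"
    proof -
      have "(\<Sum>a\<in>- {Inr k}. f a) = (\<Sum>a\<in>UNIV. f a)"
        using that by (intro sum.mono_neutral_left) auto
      then show ?thesis using that by (simp add: sum_UNIV_sum)
    qed
    have "K = (\<Sum>a\<in>- {Inr k}. \<Sum>b\<in>- {Inr k}. S a b)"
      unfolding K_def S_def by (intro sum.cong refl) (simp add: block)
    also have "\<dots> = (\<Sum>\<alpha>\<in>UNIV. \<Sum>\<beta>\<in>UNIV. S (Inl \<alpha>) (Inl \<beta>))"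
      by (simp add: red S0)
    also have "\<dots> = - (\<Sum>\<alpha>\<in>UNIV. \<Sum>\<beta>\<in>UNIV. (gg (Inl \<alpha>) (Inl \<beta>) u - (\<Sum>l\<in>UNIV. y (Inl \<alpha>) $ l * gg (Inr l) (Inl \<beta>) u))
        * w $ Inl \<alpha> * cnj (w $ Inl \<beta>)) / g u"
      unfolding sum_divide_distrib sum_negf[symmetric]
      by (intro sum.cong refl) (simp add: S_def base_index_def field_simps)
    also have "(\<Sum>\<alpha>\<in>UNIV. \<Sum>\<beta>\<in>UNIV. (gg (Inl \<alpha>) (Inl \<beta>) u - (\<Sum>l\<in>UNIV. y (Inl \<alpha>) $ l * gg (Inr l) (Inl \<beta>) u))
        * w $ Inl \<alpha> * cnj (w $ Inl \<beta>)) = herm M V V"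
    proof -
      \<comment> \<open>\<open>W\<close> is \<open>V\<close> without its fiber part. As
        \<open>V\<close> is orthogonal to fiber vectors, \<open>W\<close> may replace it in the
        second slot, which leaves exactly the Schur complement of the curvature sum.\<close>
      define W where "W = V - embed_fiber X"
      have W: "W $ Inl \<beta> = w $ Inl \<beta>" "W $ Inr j = 0" for \<beta> j
        by (simp_all add: W_def V_def embed_fiber_def)
      have "herm M V V = herm M V W"
        using herm_add_right[of M V W "embed_fiber X"] by (simp add: W_def V_embed)
      also have "\<dots> = (\<Sum>a\<in>UNIV. \<Sum>\<beta>\<in>UNIV. gg a (Inl \<beta>) u * V $ a * cnj (w $ Inl \<beta>))"
        unfolding herm_def M_def by (simp add: sum_UNIV_sum[of "\<lambda>b. gg _ b u * _ * cnj (W $ b)"] W)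
      also have "\<dots> = (\<Sum>\<alpha>\<in>UNIV. \<Sum>\<beta>\<in>UNIV. gg (Inl \<alpha>) (Inl \<beta>) u * w $ Inl \<alpha> * cnj (w $ Inl \<beta>))
          + (\<Sum>l\<in>UNIV. \<Sum>\<beta>\<in>UNIV. gg (Inr l) (Inl \<beta>) u * X $ l * cnj (w $ Inl \<beta>))"
        by (simp add: sum_UNIV_sum V_def)
      also have "(\<Sum>l\<in>UNIV. \<Sum>\<beta>\<in>UNIV. gg (Inr l) (Inl \<beta>) u * X $ l * cnj (w $ Inl \<beta>))
          = - (\<Sum>l\<in>UNIV. \<Sum>\<beta>\<in>UNIV. \<Sum>\<alpha>\<in>UNIV. y (Inl \<alpha>) $ l * gg (Inr l) (Inl \<beta>) u * w $ Inl \<alpha> * cnj (w $ Inl \<beta>))"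
        by (simp add: X_def sum_negf sum_distrib_left sum_distrib_right mult_ac)
      also have "(\<Sum>l\<in>UNIV. \<Sum>\<beta>\<in>UNIV. \<Sum>\<alpha>\<in>UNIV. y (Inl \<alpha>) $ l * gg (Inr l) (Inl \<beta>) u * w $ Inl \<alpha> * cnj (w $ Inl \<beta>))
          = (\<Sum>\<alpha>\<in>UNIV. \<Sum>\<beta>\<in>UNIV. \<Sum>l\<in>UNIV. y (Inl \<alpha>) $ l * gg (Inr l) (Inl \<beta>) u * w $ Inl \<alpha> * cnj (w $ Inl \<beta>))"
        by (simp add: sum.cartesian_product)
          (rule sum.reindex_bij_witness[where i="\<lambda>(\<alpha>, \<beta>, l). (l, \<beta>, \<alpha>)" and j="\<lambda>(l, \<beta>, \<alpha>). (\<alpha>, \<beta>, l)"]; auto)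
      finally show ?thesis
        by (simp add: sum_subtractf left_diff_distrib sum_distrib_right)
    qed
    finally show K: "K = - levi L u V" by (simp add: levi_V gG)
    show "K \<in> \<real>" unfolding K levi_V using MV_real by simp
    show "\<forall>V'. (\<forall>\<alpha>. V' $ Inl \<alpha> = w $ Inl \<alpha>) \<longrightarrow> Re (levi L u V) \<le> Re (levi L u V')"
    proof (intro allI impI)
      fix V' :: "complex^('n + 'r)" assume V': "\<forall>\<alpha>. V' $ Inl \<alpha> = w $ Inl \<alpha>"
      define Y :: "complex^'r" where "Y = (\<chi> i. V' $ Inr i - V $ Inr i)"
      have "V' $ a = (V + embed_fiber Y) $ a" for a
        by (cases a) (simp_all add: V' V_def Y_def embed_fiber_def)
      then have eq: "V' = V + embed_fiber Y" by (simp add: vec_eq_iff)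
      have HG: "Re (herm (hess u) (fib u) (fib u)) = G u" by (simp add: herm_fib[OF uu] g_def)
      \<comment> \<open>Since \<open>fib u\<close> has squared length \<open>G u\<close>,
        Cauchy-Schwarz bounds the squared modulus subtracted by the logarithm by the contribution of
        \<open>Y\<close> to the Hessian form.\<close>
      have "(cmod (herm (hess u) Y (fib u)))\<^sup>2 / (G u)\<^sup>2 \<le> Re (herm (hess u) Y Y) / G u"
        using herm_Cauchy_Schwarz[OF hess_pos_def[OF uu], of Y "fib u"] G0
        unfolding HG by (simp add: power2_eq_square field_simps)
      then show "Re (levi L u V) \<le> Re (levi L u V')"
        unfolding eq levi_L levi_V by (simp add: add_divide_distrib)
    qed
  qed
qed

end

section \<open>Coordinates on a vector bundle\<close>

lemma levi_cong:
  assumes "open S" "x \<in> S" "\<And>y. y \<in> S \<Longrightarrow> f y = g y"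
  shows "levi f x v = levi g x v"
proof -
  have "wirt_bar b f y = wirt_bar b g y" if "y \<in> S" for b y
    by (rule wirt_cong(2)[OF assms(1) that assms(3)])
  then have "wirt a (wirt_bar b f) x = wirt a (wirt_bar b g) x" for a b
    by (rule wirt_cong(1)[OF assms(1,2)])
  then show ?thesis by (simp add: levi_def)
qed

lemma ddbar_levi: "ddbar c f z v = levi (\<lambda>x. complex_of_real (f (chart_inv c x))) (snd c z) v"
  by (simp add: ddbar_def levi_def)

section \<open>Closure properties of holomorphic functions\<close>

lemma holo_on_iff:
  "holo_on f S \<longleftrightarrow> (\<forall>x\<in>S. f differentiable (at x) \<and> (\<forall>k. wirt_bar k f x = 0))"
proof
  assume "holo_on f S"
  then show "\<forall>x\<in>S. f differentiable (at x) \<and> (\<forall>k. wirt_bar k f x = 0)"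
    using holo_onD by blast
next
  assume *: "\<forall>x\<in>S. f differentiable (at x) \<and> (\<forall>k. wirt_bar k f x = 0)"
  show "holo_on f S"
  proof (rule holo_onI)
    fix x assume "x \<in> S"
    with * have "(f has_derivative wirtinger_form (\<lambda>k. wirt k f x) (\<lambda>k. 0)) (at x)"
      using has_derivative_wirtinger[of f x] by simp
    then show "\<exists>p. (f has_derivative (\<lambda>h. \<Sum>k\<in>UNIV. p k * h $ k)) (at x)"
      unfolding wirtinger_form_def[abs_def] by auto
  qed
qed

lemma holo_on_subset: "holo_on f S \<Longrightarrow> T \<subseteq> S \<Longrightarrow> holo_on f T"
  unfolding holo_on_def by blast

lemma holo_on_cong:
  assumes "open S" "\<And>x. x \<in> S \<Longrightarrow> f x = g x"
  shows "holo_on f S \<longleftrightarrow> holo_on g S"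
proof -
  have "f differentiable (at x) \<longleftrightarrow> g differentiable (at x)" if "x \<in> S" for x
    by (rule differentiable_cong_open[OF assms(1) that assms(2)])
  moreover have "wirt_bar k f x = wirt_bar k g x" if "x \<in> S" for k x
    by (rule wirt_cong(2)[OF assms(1) that assms(2)])
  ultimately show ?thesis unfolding holo_on_iff by simp
qed

lemma holo_on_const: "holo_on (\<lambda>x. s) S"
  by (simp add: holo_on_iff)

lemma holo_on_add: "holo_on f S \<Longrightarrow> holo_on g S \<Longrightarrow> holo_on (\<lambda>x. f x + g x) S"
  by (simp add: holo_on_iff wirt_add)

lemma holo_on_mult: "holo_on f S \<Longrightarrow> holo_on g S \<Longrightarrow> holo_on (\<lambda>x. f x * g x) S"
  by (simp add: holo_on_iff wirt_mult)

lemma holo_on_sum: "(\<And>i. i \<in> I \<Longrightarrow> holo_on (f i) S) \<Longrightarrow> holo_on (\<lambda>x. \<Sum>i\<in>I. f i x) S"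
  by (induction I rule: infinite_finite_induct) (simp_all add: holo_on_const holo_on_add)

text \<open>Strong pseudoconvexity is assumed for \<open>F\<close>, while the curvature is built
  from \<open>G\<close>. The mixed derivatives of the square are
  \<open>2 * (f * f_ij + f_i * cnj f_j)\<close>, a positive definite part plus a semidefinite
  one.\<close>

lemma pos_def_hermitian_square:
  fixes f :: "complex^('n::finite + 'r::finite) \<Rightarrow> real"
  assumes "open \<Omega>" and u: "u \<in> \<Omega>" and f: "smooth_on f \<Omega>" and pos: "f u > 0"
    and pd: "pos_def_hermitian (\<chi> i j. wirt (Inr i) (wirt_bar (Inr j) (\<lambda>x. complex_of_real (f x))) u)"
  shows "pos_def_hermitian (\<chi> i j. wirt (Inr i) (wirt_bar (Inr j) (\<lambda>x. complex_of_real ((f x)\<^sup>2))) u)"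
    (is "pos_def_hermitian ?G")
proof -
  let ?g = "\<lambda>x. complex_of_real (f x)"
  let ?F = "\<chi> i j. wirt (Inr i) (wirt_bar (Inr j) ?g) u"
  let ?d = "\<lambda>i. wirt (Inr i) ?g u"
  have g: "smooth_on ?g \<Omega>"
    by (rule smooth_on_bounded_linear[OF bounded_linear_of_real assms(1) f])
  have d: "?g differentiable (at x)" "wirt_bar b ?g differentiable (at x)" if "x \<in> \<Omega>" for x b
    by (intro smooth_on_differentiable[OF _ that] smooth_on_wirt assms(1) g)+
  have "wirt_bar b (\<lambda>x. complex_of_real ((f x)\<^sup>2)) x = 2 * (?g x * wirt_bar b ?g x)" if "x \<in> \<Omega>" for b x
    using wirt_mult(2)[OF d(1)[OF that] d(1)[OF that], of b] by (simp add: power2_eq_square)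
  then have "wirt a (wirt_bar b (\<lambda>x. complex_of_real ((f x)\<^sup>2))) u
      = wirt a (\<lambda>x. 2 * (?g x * wirt_bar b ?g x)) u" for a b
    by (rule wirt_cong(1)[OF assms(1) u])
  then have G: "wirt a (wirt_bar b (\<lambda>x. complex_of_real ((f x)\<^sup>2))) u
      = 2 * (?g u * wirt a (wirt_bar b ?g) u + wirt a ?g u * cnj (wirt b ?g u))" for a b
    using d[OF u] by (simp add: wirt_cmult(1) wirt_mult(1) wirt_bar_real)
  show ?thesis
    unfolding pos_def_hermitian_def
  proof (intro conjI allI impI)
    show "?G $ j $ i = cnj (?G $ i $ j)" for i j
      using pos_def_hermitianD(1)[OF pd, of j i] by (simp add: G del: of_real_power)
    fix Z :: "complex^'r" assume "Z \<noteq> 0"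
    have "herm ?G Z Z = 2 * (?g u * herm ?F Z Z
        + (\<Sum>i\<in>UNIV. \<Sum>j\<in>UNIV. (?d i * Z $ i) * cnj (?d j * Z $ j)))"
      by (simp add: herm_def G sum.distrib sum_distrib_left algebra_simps del: of_real_power)
    also have "(\<Sum>i\<in>UNIV. \<Sum>j\<in>UNIV. (?d i * Z $ i) * cnj (?d j * Z $ j))
        = (\<Sum>i\<in>UNIV. ?d i * Z $ i) * cnj (\<Sum>i\<in>UNIV. ?d i * Z $ i)"
      by (simp only: cnj_sum sum_product)
    also have "\<dots> = complex_of_real ((cmod (\<Sum>i\<in>UNIV. ?d i * Z $ i))\<^sup>2)"
      by (simp only: complex_norm_square)
    finally have "Re (herm ?G Z Z) = 2 * (f u * Re (herm ?F Z Z) + (cmod (\<Sum>i\<in>UNIV. ?d i * Z $ i))\<^sup>2)"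
      by (simp del: of_real_power)
    moreover have "f u * Re (herm ?F Z Z) > 0"
      using pos pos_def_hermitianD(2)[OF pd \<open>Z \<noteq> 0\<close>] by simp
    ultimately show "0 < Re (herm ?G Z Z)" by (simp add: add_pos_nonneg)
  qed
qed

lemma chart_facts:
  assumes "complex_manifold A" "c \<in> A"
  shows "open (fst c)" "inj_on (snd c) (fst c)" "z \<in> fst c \<Longrightarrow> chart_inv c (snd c z) = z"
    "open U \<Longrightarrow> U \<subseteq> fst c \<Longrightarrow> open (snd c ` U)"
proof -
  obtain \<psi> where hom: "homeomorphism (fst c) (snd c ` fst c) (snd c) \<psi>"
    and opn: "open (fst c)" "open (snd c ` fst c)"
    using assms unfolding complex_manifold_def by blast
  show "open (fst c)" by (rule opn)
  show inj: "inj_on (snd c) (fst c)"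
    by (rule inj_on_inverseI[where g=\<psi>]) (rule homeomorphism_apply1[OF hom])
  show "z \<in> fst c \<Longrightarrow> chart_inv c (snd c z) = z"
    unfolding chart_inv_def by (rule inv_into_f_f[OF inj])
  assume U: "open U" "U \<subseteq> fst c"
  then have "openin (top_of_set (fst c)) U" by (simp add: openin_open_eq opn)
  from homeomorphism_imp_open_map[OF hom this] show "open (snd c ` U)"
    using opn(2) openin_open_trans by blast
qed

section \<open>The bundle over one chart and one trivialization\<close>

locale bundle_patch =
  fixes B :: "('x::t2_space, 'e::topological_space, 'n::finite, 'r::finite) hbundle"
    and d :: "('x, 'n) chart" and \<tau> :: "('x, 'e, 'r) triv"
  assumes holomorphic: "holomorphic_vector_bundle B" and d: "d \<in> charts B" and \<tau>: "\<tau> \<in> trivs B"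
begin

lemma manifold: "complex_manifold (charts B)"
  using holomorphic unfolding holomorphic_vector_bundle_def by blast

lemma proj_vscale: "proj B (vscale B s e) = proj B e"
  using holomorphic unfolding holomorphic_vector_bundle_def by blast

lemma open_triv: "\<sigma> \<in> trivs B \<Longrightarrow> open (fst \<sigma>)"
  using holomorphic unfolding holomorphic_vector_bundle_def by blast

lemma triv_vscale: "\<sigma> \<in> trivs B \<Longrightarrow> proj B e \<in> fst \<sigma> \<Longrightarrow> snd \<sigma> (vscale B s e) = s *s snd \<sigma> e"
  using holomorphic unfolding holomorphic_vector_bundle_def by blast

lemma triv_homeomorphism:
  "\<exists>\<sigma>. homeomorphism (proj B -` fst \<tau>) (fst \<tau> \<times> UNIV) (\<lambda>e. (proj B e, snd \<tau> e)) \<sigma>"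
  using holomorphic \<tau> unfolding holomorphic_vector_bundle_def by blast

lemma triv_eqI:
  assumes "proj B e \<in> fst \<tau>" "proj B e = proj B e'" "snd \<tau> e = snd \<tau> e'"
  shows "e = e'"
proof -
  obtain \<sigma> where "homeomorphism (proj B -` fst \<tau>) (fst \<tau> \<times> UNIV) (\<lambda>e. (proj B e, snd \<tau> e)) \<sigma>"
    using triv_homeomorphism by blast
  from homeomorphism_apply1[OF this] show ?thesis using assms by (metis vimage_eq)
qed

lemma triv_surj:
  assumes "z \<in> fst \<tau>"
  obtains e where "proj B e = z" "snd \<tau> e = Z"
proof -
  obtain \<sigma> where "homeomorphism (proj B -` fst \<tau>) (fst \<tau> \<times> UNIV) (\<lambda>e. (proj B e, snd \<tau> e)) \<sigma>"
    using triv_homeomorphism by blast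
  from homeomorphism_image1[OF this] have "(z, Z) \<in> (\<lambda>e. (proj B e, snd \<tau> e)) ` (proj B -` fst \<tau>)"
    using assms by simp
  then show thesis using that by auto
qed

lemma is_zero_vec_iff:
  assumes "proj B e \<in> fst \<tau>"
  shows "is_zero_vec B e \<longleftrightarrow> snd \<tau> e = 0"
proof
  assume "is_zero_vec B e"
  then have "snd \<tau> e = snd \<tau> (vscale B 0 e)" by (simp add: is_zero_vec_def)
  then show "snd \<tau> e = 0" using triv_vscale[OF \<tau> assms] by simp
next
  assume "snd \<tau> e = 0"
  then show "is_zero_vec B e" unfolding is_zero_vec_def
    using assms by (intro triv_eqI) (simp_all add: proj_vscale triv_vscale[OF \<tau>])
qed

definition patch :: "'x set" where "patch = fst d \<inter> fst \<tau>"

text \<open>Spelled as in \<open>finsler_metric\<close>, so that the smoothness assumption applies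
  directly; \<open>nonzero_coords_iff\<close> gives the description from which openness
  follows.\<close>

definition nonzero_coords :: "(complex^('n + 'r)) set" where
  "nonzero_coords = bcoord B d \<tau> ` {e. proj B e \<in> fst d \<inter> fst \<tau> \<and> \<not> is_zero_vec B e}"

lemma open_patch: "open patch" "open (snd d ` patch)"
proof -
  show "open patch" unfolding patch_def
    using chart_facts(1)[OF manifold d] open_triv[OF \<tau>] by (rule open_Int)
  then show "open (snd d ` patch)"
    by (rule chart_facts(4)[OF manifold d]) (simp add: patch_def)
qed

lemma bcoord_inj: "inj_on (bcoord B d \<tau>) (proj B -` patch)"
proof (rule inj_onI)
  fix e e' assume e: "e \<in> proj B -` patch" "e' \<in> proj B -` patch" and eq: "bcoord B d \<tau> e = bcoord B d \<tau> e'"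
  have "snd d (proj B e) $ \<alpha> = snd d (proj B e') $ \<alpha>" for \<alpha>
    using arg_cong[OF eq, of "\<lambda>u. u $ Inl \<alpha>"] by (simp add: bcoord_def)
  then have "proj B e = proj B e'"
    using inj_onD[OF chart_facts(2)[OF manifold d]] e by (simp add: patch_def vec_eq_iff)
  moreover have "snd \<tau> e $ i = snd \<tau> e' $ i" for i
    using arg_cong[OF eq, of "\<lambda>u. u $ Inr i"] by (simp add: bcoord_def)
  ultimately show "e = e'" using e by (intro triv_eqI) (simp_all add: patch_def vec_eq_iff)
qed

lemma bpoint_bcoord: "proj B e \<in> patch \<Longrightarrow> bpoint B d \<tau> (bcoord B d \<tau> e) = e"
  unfolding bpoint_def using bcoord_inj by (intro inv_into_f_f) (simp_all add: patch_def)

lemma bcoord_surj: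
  assumes "z \<in> patch" "\<And>\<alpha>. u $ Inl \<alpha> = snd d z $ \<alpha>"
  obtains e where "proj B e = z" "bcoord B d \<tau> e = u" "bpoint B d \<tau> u = e"
proof -
  obtain e where e: "proj B e = z" "snd \<tau> e = (\<chi> i. u $ Inr i)"
    using triv_surj[of z] assms(1) unfolding patch_def by blast
  have "bcoord B d \<tau> e = u"
    using e assms(2) by (simp add: bcoord_def vec_eq_iff split: sum.split)
  then show thesis using that[OF e(1)] bpoint_bcoord[of e] e assms(1) by simp
qed

lemma nonzero_coords_iff:
  "u \<in> nonzero_coords \<longleftrightarrow> (\<chi> \<alpha>. u $ Inl \<alpha>) \<in> snd d ` patch \<and> (\<exists>i. u $ Inr i \<noteq> 0)"
proof
  assume "u \<in> nonzero_coords"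
  then obtain e where e: "u = bcoord B d \<tau> e" "proj B e \<in> patch" "\<not> is_zero_vec B e"
    unfolding nonzero_coords_def patch_def by blast
  then have "snd \<tau> e \<noteq> 0" using is_zero_vec_iff by (simp add: patch_def)
  then show "(\<chi> \<alpha>. u $ Inl \<alpha>) \<in> snd d ` patch \<and> (\<exists>i. u $ Inr i \<noteq> 0)"
    using e by (auto simp: bcoord_def vec_eq_iff)
next
  assume u: "(\<chi> \<alpha>. u $ Inl \<alpha>) \<in> snd d ` patch \<and> (\<exists>i. u $ Inr i \<noteq> 0)"
  then obtain z i where z: "z \<in> patch" "(\<chi> \<alpha>. u $ Inl \<alpha>) = snd d z" and i: "u $ Inr i \<noteq> 0" by blast
  then obtain e where e: "proj B e = z" "bcoord B d \<tau> e = u"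
    using bcoord_surj[of z u] by (metis vec_lambda_beta)
  have "snd \<tau> e $ i \<noteq> 0" using i e(2) by (auto simp: bcoord_def)
  then have "\<not> is_zero_vec B e" using is_zero_vec_iff[of e] e z by (auto simp: patch_def)
  then show "u \<in> nonzero_coords" unfolding nonzero_coords_def using e z by (auto simp: patch_def)
qed

lemma open_nonzero_coords: "open nonzero_coords"
proof -
  have "continuous_on UNIV (\<lambda>u::complex^('n + 'r). (\<chi> \<alpha>. u $ Inl \<alpha>) :: complex^'n)"
    by (intro continuous_on_vec_lambda continuous_intros)
  from open_vimage[OF open_patch(2) this]
  have 1: "open {u::complex^('n + 'r). (\<chi> \<alpha>. u $ Inl \<alpha>) \<in> snd d ` patch}" by (simp add: vimage_def)
  have 2: "open {u::complex^('n + 'r). u $ Inr i \<noteq> 0}" for i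
    by (intro open_Collect_neq continuous_intros)
  have "nonzero_coords = {u. (\<chi> \<alpha>. u $ Inl \<alpha>) \<in> snd d ` patch} \<inter> (\<Union>i. {u. u $ Inr i \<noteq> 0})"
    using nonzero_coords_iff by auto
  then show ?thesis using 1 2 by (simp add: open_Int open_UN)
qed

lemma bcoord_vscale:
  assumes "proj B e \<in> patch"
  shows "bcoord B d \<tau> (vscale B s e) = scale_fiber s (bcoord B d \<tau> e)"
  using assms
  by (simp add: bcoord_def scale_fiber_def vec_eq_iff proj_vscale triv_vscale[OF \<tau>] patch_def split: sum.split)

lemma homogeneous_metric_finsler:
  assumes F: "finsler_metric B F" and spc: "strongly_pseudoconvex B F"
  shows "homogeneous_metric (\<lambda>u. (F (bpoint B d \<tau> u))\<^sup>2) nonzero_coords"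
proof
  have pt: "\<exists>e. u = bcoord B d \<tau> e \<and> bpoint B d \<tau> u = e \<and> proj B e \<in> patch \<and> \<not> is_zero_vec B e"
    if "u \<in> nonzero_coords" for u
    using that bpoint_bcoord unfolding nonzero_coords_def patch_def by blast
  have smooth: "smooth_on (\<lambda>u. F (bpoint B d \<tau> u)) nonzero_coords"
    using F d \<tau> unfolding finsler_metric_def nonzero_coords_def by blast
  have pos: "F e > 0" if "\<not> is_zero_vec B e" for e
    using F that unfolding finsler_metric_def by (metis less_eq_real_def)
  show "open nonzero_coords" by (rule open_nonzero_coords)
  show "smooth_on (\<lambda>u. (F (bpoint B d \<tau> u))\<^sup>2) nonzero_coords"
    unfolding power2_eq_square by (rule smooth_on_mult[OF open_nonzero_coords smooth smooth])
  fix u assume u: "u \<in> nonzero_coords"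
  then obtain e where e: "u = bcoord B d \<tau> e" "bpoint B d \<tau> u = e" "proj B e \<in> patch" "\<not> is_zero_vec B e"
    using pt by blast
  show "0 < (F (bpoint B d \<tau> u))\<^sup>2" using pos[OF e(4)] e(2) by simp
  show "(F (bpoint B d \<tau> (scale_fiber s u)))\<^sup>2 = (cmod s)\<^sup>2 * (F (bpoint B d \<tau> u))\<^sup>2" for s
  proof -
    have "bpoint B d \<tau> (scale_fiber s u) = vscale B s e"
      using e bcoord_vscale[OF e(3), of s] bpoint_bcoord[of "vscale B s e"] by (simp add: proj_vscale)
    moreover have "F (vscale B s e) = cmod s * F e" using F unfolding finsler_metric_def by blast
    ultimately show ?thesis using e(2) by (simp add: power_mult_distrib)
  qed
  show "pos_def_hermitian (\<chi> i j. wirt (Inr i) (wirt_bar (Inr j) (\<lambda>x. complex_of_real ((F (bpoint B d \<tau> x))\<^sup>2))) u)"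
  proof (rule pos_def_hermitian_square[OF open_nonzero_coords u smooth])
    show "0 < F (bpoint B d \<tau> u)" using pos[OF e(4)] e(2) by simp
    show "pos_def_hermitian (\<chi> i j. wirt (Inr i) (wirt_bar (Inr j) (\<lambda>x. complex_of_real (F (bpoint B d \<tau> x)))) u)"
      using spc d \<tau> e unfolding strongly_pseudoconvex_def fiber_hessian_def patch_def by blast
  qed
qed

text \<open>Only some multiple of \<open>\<zeta>\<close> is known to lie over the patch with nonzero
  coordinate \<open>k\<close>; the trivialization respects scaling, which carries both properties
  over to \<open>\<zeta>\<close> and makes the vector described in \<open>pcoord\<close>
  unique.\<close>

lemma bline_coord:
  assumes "bline B \<zeta> \<in> ppatch B d \<tau> k"
  shows "proj B \<zeta> \<in> patch" "snd \<tau> \<zeta> $ k \<noteq> 0"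
    "pcoord B d \<tau> k (bline B \<zeta>) = bcoord B d \<tau> (vscale B (1 / snd \<tau> \<zeta> $ k) \<zeta>)"
proof -
  obtain s where s: "proj B (vscale B s \<zeta>) \<in> fst d \<inter> fst \<tau>" "snd \<tau> (vscale B s \<zeta>) $ k \<noteq> 0"
    using assms unfolding ppatch_def bline_def by blast
  then show p: "proj B \<zeta> \<in> patch" by (simp add: patch_def proj_vscale)
  then have t: "snd \<tau> (vscale B s \<zeta>) = s *s snd \<tau> \<zeta>" for s
    using triv_vscale[OF \<tau>] by (simp add: patch_def)
  show k: "snd \<tau> \<zeta> $ k \<noteq> 0" using s(2) by (auto simp: t)
  have "(THE e. e \<in> bline B \<zeta> \<and> snd \<tau> e $ k = 1) = vscale B (1 / snd \<tau> \<zeta> $ k) \<zeta>"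
  proof (rule the_equality)
    show "vscale B (1 / snd \<tau> \<zeta> $ k) \<zeta> \<in> bline B \<zeta> \<and> snd \<tau> (vscale B (1 / snd \<tau> \<zeta> $ k) \<zeta>) $ k = 1"
      using k by (simp add: bline_def t)
    fix e assume "e \<in> bline B \<zeta> \<and> snd \<tau> e $ k = 1"
    then obtain s where "e = vscale B s \<zeta>" "s * snd \<tau> \<zeta> $ k = 1" by (auto simp: bline_def t)
    moreover from this(2) have "s = 1 / snd \<tau> \<zeta> $ k" using k by (simp add: field_simps)
    ultimately show "e = vscale B (1 / snd \<tau> \<zeta> $ k) \<zeta>" by simp
  qed
  then show "pcoord B d \<tau> k (bline B \<zeta>) = bcoord B d \<tau> (vscale B (1 / snd \<tau> \<zeta> $ k) \<zeta>)"
    by (simp add: pcoord_def)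
qed

lemma bcoord_vscale_nonzero:
  assumes "proj B \<zeta> \<in> patch" "snd \<tau> \<zeta> $ k \<noteq> 0" "s \<noteq> 0"
  shows "bcoord B d \<tau> (vscale B s \<zeta>) \<in> nonzero_coords"
proof -
  have "snd \<tau> (vscale B s \<zeta>) = s *s snd \<tau> \<zeta>"
    using triv_vscale[OF \<tau>] assms(1) by (simp add: patch_def)
  then have "snd \<tau> (vscale B s \<zeta>) $ k \<noteq> 0" using assms by simp
  then have "\<not> is_zero_vec B (vscale B s \<zeta>)"
    using is_zero_vec_iff[of "vscale B s \<zeta>"] assms(1) by (auto simp: patch_def proj_vscale)
  then show ?thesis
    unfolding nonzero_coords_def using assms(1) by (simp add: patch_def proj_vscale)
qed

section \<open>Holomorphic sections in coordinates\<close>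

lemma holo_on_transition:
  assumes "c \<in> charts B" "S \<subseteq> fst c \<inter> fst d"
  shows "holo_on (\<lambda>x. snd d (chart_inv c x) $ \<alpha>) (snd c ` S)"
  using manifold assms d holo_on_subset[OF _ image_mono[OF assms(2)]]
  unfolding complex_manifold_def by blast

lemma tangent_vector_transition:
  assumes "tangent_vector (charts B) z v" "c \<in> charts B" "z \<in> fst c" "z \<in> fst d"
  shows "v d $ \<alpha> = (\<Sum>\<gamma>\<in>UNIV. wirt \<gamma> (\<lambda>x. snd d (chart_inv c x) $ \<alpha>) (snd c z) * v c $ \<gamma>)"
proof -
  have "((\<lambda>x. snd d (chart_inv c x)) has_derivative
      (\<lambda>h. \<chi> \<alpha>. \<Sum>\<gamma>\<in>UNIV. wirt \<gamma> (\<lambda>x. snd d (chart_inv c x) $ \<alpha>) (snd c z) * h $ \<gamma>)) (at (snd c z))"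
    by (rule holo_map_has_derivative[OF holo_on_transition[OF assms(2) subset_refl]]) (use assms in auto)
  moreover have "v d = frechet_derivative (\<lambda>x. snd d (chart_inv c x)) (at (snd c z)) (v c)"
    using assms d unfolding tangent_vector_def by blast
  ultimately show ?thesis by (simp add: frechet_derivative_at[symmetric])
qed

text \<open>The section is multiplied by \<open>s\<close> because \<open>pcoord\<close> evaluates the curvature at the
  representative of the line with \<open>\<zeta>\<^sub>k = 1\<close>; the factor \<open>1 / |s|\<^sup>2\<close> compensates for this.\<close>

lemma ddbar_section:
  assumes F: "finsler_metric B F" and spc: "strongly_pseudoconvex B F"
    and v: "tangent_vector (charts B) (proj B \<zeta>) v"
    and c: "c \<in> charts B" "proj B \<zeta> \<in> fst c"
    and p: "proj B \<zeta> \<in> patch" "snd \<tau> \<zeta> $ k \<noteq> 0" and s: "s \<noteq> 0"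
    and \<phi>: "\<phi> \<in> local_sections B \<zeta>"
  obtains V where "\<forall>\<alpha>. V $ Inl \<alpha> = v d $ \<alpha>"
    "\<forall>i. V $ Inr i = (\<Sum>\<gamma>\<in>UNIV. wirt \<gamma> (\<lambda>x. s * snd \<tau> (\<phi> (chart_inv c x)) $ i) (snd c (proj B \<zeta>)) * v c $ \<gamma>)"
    "ddbar c (\<lambda>z. ln ((F (\<phi> z))\<^sup>2)) (proj B \<zeta>) (v c)
      = levi (\<lambda>u. complex_of_real (ln (1 / (cmod s)\<^sup>2 * (F (bpoint B d \<tau> u))\<^sup>2))) (bcoord B d \<tau> (vscale B s \<zeta>)) V"
proof -
  interpret homogeneous_metric "\<lambda>u. (F (bpoint B d \<tau> u))\<^sup>2" nonzero_coords
    by (rule homogeneous_metric_finsler[OF F spc])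
  let ?x = "snd c (proj B \<zeta>)"
  let ?L = "\<lambda>u. complex_of_real (ln (1 / (cmod s)\<^sup>2 * (F (bpoint B d \<tau> u))\<^sup>2))"
  note inv = chart_facts(3)[OF manifold c(1)]
  obtain W where W: "open W" "proj B \<zeta> \<in> W" "\<And>z. z \<in> W \<Longrightarrow> proj B (\<phi> z) = z" and \<phi>0: "\<phi> (proj B \<zeta>) = \<zeta>"
    and hol: "\<And>i. holo_on (\<lambda>x. snd \<tau> (\<phi> (chart_inv c x)) $ i) (snd c ` (W \<inter> fst c \<inter> fst \<tau>))"
    using \<phi> c(1) \<tau> unfolding local_sections_def by blast
  define U where "U = W \<inter> fst c \<inter> patch"
  define N0 where "N0 = snd c ` U"
  define \<Phi> where "\<Phi> x = bcoord B d \<tau> (vscale B s (\<phi> (chart_inv c x)))" for x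
  have "open U" unfolding U_def
    by (intro open_Int W open_patch chart_facts(1)[OF manifold c(1)])
  then have "open N0" unfolding N0_def
    by (rule chart_facts(4)[OF manifold c(1)]) (auto simp: U_def)
  have in_U: "chart_inv c x \<in> U" if "x \<in> N0" for x
    using that inv unfolding N0_def U_def by auto
  have x0: "?x \<in> N0" using W(2) c(2) p(1) by (auto simp: N0_def U_def)
  have pr: "proj B (\<phi> (chart_inv c x)) = chart_inv c x" if "x \<in> N0" for x
    using in_U[OF that] W(3) by (simp add: U_def)
  have pt: "proj B (\<phi> (chart_inv c x)) \<in> patch" if "x \<in> N0" for x
    using in_U[OF that] pr[OF that] by (simp add: U_def)
  have \<Phi>_base: "\<Phi> x $ Inl \<alpha> = snd d (chart_inv c x) $ \<alpha>" if "x \<in> N0" for x \<alpha>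
    by (simp add: \<Phi>_def bcoord_def proj_vscale pr[OF that])
  have \<Phi>_fiber: "\<Phi> x $ Inr i = s * snd \<tau> (\<phi> (chart_inv c x)) $ i" if "x \<in> N0" for x i
    using pt[OF that] by (simp add: \<Phi>_def bcoord_def triv_vscale[OF \<tau>] patch_def)
  have trans: "holo_on (\<lambda>x. snd d (chart_inv c x) $ \<alpha>) N0" for \<alpha>
    unfolding N0_def by (rule holo_on_transition[OF c(1)]) (auto simp: U_def patch_def)
  have "holo_on (\<lambda>x. s * snd \<tau> (\<phi> (chart_inv c x)) $ i) N0" for i
    by (intro holo_on_mult holo_on_const holo_on_subset[OF hol]) (auto simp: N0_def U_def patch_def)
  then have \<Phi>_holo0: "holo_on (\<lambda>x. \<Phi> x $ b) N0" for b
    using trans holo_on_cong[OF \<open>open N0\<close> \<Phi>_base] holo_on_cong[OF \<open>open N0\<close> \<Phi>_fiber]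
    by (cases b) auto
  have \<Phi>0: "\<Phi> ?x = bcoord B d \<tau> (vscale B s \<zeta>)"
    by (simp add: \<Phi>_def inv[OF c(2)] \<phi>0)
  \<comment> \<open>Where \<open>\<Phi>\<close> stays off the zero section, \<open>G\<close> is
    smooth and positive, so its logarithm can be differentiated.\<close>
  define N where "N = N0 \<inter> \<Phi> -` nonzero_coords"
  have "continuous_on N0 \<Phi>"
    using has_derivative_continuous[OF holo_map_has_derivative[OF \<Phi>_holo0]]
    by (intro continuous_at_imp_continuous_on) blast
  then have N: "open N" unfolding N_def
    by (rule continuous_open_preimage[OF _ \<open>open N0\<close> open_nonzero_coords])
  have xN: "?x \<in> N"
    using x0 bcoord_vscale_nonzero[OF p s] by (simp add: N_def \<Phi>0)
  have \<Phi>_holo: "holo_on (\<lambda>x. \<Phi> x $ b) N" for b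
    by (rule holo_on_subset[OF \<Phi>_holo0]) (simp add: N_def)
  define V where "V = (\<chi> b. \<Sum>\<gamma>\<in>UNIV. wirt \<gamma> (\<lambda>x. \<Phi> x $ b) ?x * v c $ \<gamma>)"
  have "ddbar c (\<lambda>z. ln ((F (\<phi> z))\<^sup>2)) (proj B \<zeta>) (v c) = levi (\<lambda>x. ?L (\<Phi> x)) ?x (v c)"
    unfolding ddbar_levi
  proof (rule levi_cong[OF N xN])
    fix y assume "y \<in> N"
    then have y: "y \<in> N0" by (simp add: N_def)
    have "bpoint B d \<tau> (\<Phi> y) = vscale B s (\<phi> (chart_inv c y))"
      unfolding \<Phi>_def using pt[OF y] by (intro bpoint_bcoord) (simp add: proj_vscale)
    moreover have "F (vscale B s (\<phi> (chart_inv c y))) = cmod s * F (\<phi> (chart_inv c y))"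
      using F unfolding finsler_metric_def by blast
    ultimately show "complex_of_real (ln ((F (\<phi> (chart_inv c y)))\<^sup>2)) = ?L (\<Phi> y)"
      using s by (simp add: power_mult_distrib)
  qed
  also have "\<dots> = levi ?L (\<Phi> ?x) V"
    unfolding V_def
  proof (rule levi_holo_comp[OF N xN \<Phi>_holo, where \<Omega> = nonzero_coords])
    show "\<Phi> y \<in> nonzero_coords" if "y \<in> N" for y using that by (simp add: N_def)
    have GD: "(\<lambda>u. (F (bpoint B d \<tau> u))\<^sup>2) differentiable (at u)" if "u \<in> nonzero_coords" for u
      by (rule smooth_on_differentiable[OF smooth that])
    show "?L differentiable (at u)" if "u \<in> nonzero_coords" for u
      using s by (intro wirt_ln(1)[OF GD[OF that] pos[OF that]]) simp
    show "wirt_bar b ?L differentiable (at u)" if "u \<in> nonzero_coords" for b u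
      using s diff(3)[OF that]
      by (intro levi_ln(1)[OF open_domain that GD pos]) (simp_all add: g_def[abs_def])
  qed
  finally have eq: "ddbar c (\<lambda>z. ln ((F (\<phi> z))\<^sup>2)) (proj B \<zeta>) (v c) = levi ?L (bcoord B d \<tau> (vscale B s \<zeta>)) V"
    by (simp only: \<Phi>0)
  show thesis
  proof (rule that[OF _ _ eq])
    \<comment> \<open>The base components of \<open>\<Phi>\<close> are the coordinate change from
      \<open>c\<close> to \<open>d\<close>, so \<open>V\<close> lies over \<open>v d\<close>
      whatever the section.\<close>
    show "\<forall>\<alpha>. V $ Inl \<alpha> = v d $ \<alpha>"
      using wirt_cong(1)[OF \<open>open N0\<close> x0 \<Phi>_base] tangent_vector_transition[OF v c] p(1)
      by (simp add: V_def patch_def)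
    show "\<forall>i. V $ Inr i = (\<Sum>\<gamma>\<in>UNIV. wirt \<gamma> (\<lambda>x. s * snd \<tau> (\<phi> (chart_inv c x)) $ i) ?x * v c $ \<gamma>)"
      using wirt_cong(1)[OF \<open>open N0\<close> x0 \<Phi>_fiber] by (simp add: V_def)
  qed
qed

text \<open>Affine fiber coordinates with slopes \<open>A i \<alpha> / s\<close>, so that the
  section multiplied by \<open>s\<close> has slopes \<open>A\<close>. Any first-order behaviour at
  the point can be prescribed in this way, in particular that of the minimizing lift.\<close>

lemma affine_section:
  assumes p: "proj B \<zeta> \<in> patch" "s \<noteq> 0"
  obtains \<phi> where "\<phi> \<in> local_sections B \<zeta>"
    "\<forall>z\<in>patch. \<forall>i. s * snd \<tau> (\<phi> z) $ i
      = s * snd \<tau> \<zeta> $ i + (\<Sum>\<alpha>\<in>UNIV. A i \<alpha> * (snd d z $ \<alpha> - snd d (proj B \<zeta>) $ \<alpha>))"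
proof -
  define u :: "'x \<Rightarrow> complex^('n + 'r)" where
    "u z = (\<chi> a. case a of Inl \<alpha> \<Rightarrow> snd d z $ \<alpha>
      | Inr i \<Rightarrow> snd \<tau> \<zeta> $ i + (\<Sum>\<alpha>\<in>UNIV. A i \<alpha> / s * (snd d z $ \<alpha> - snd d (proj B \<zeta>) $ \<alpha>)))" for z
  define \<phi> where "\<phi> z = bpoint B d \<tau> (u z)" for z
  have \<phi>: "proj B (\<phi> z) = z" "bcoord B d \<tau> (\<phi> z) = u z" if "z \<in> patch" for z
  proof -
    have "\<And>\<alpha>. u z $ Inl \<alpha> = snd d z $ \<alpha>" by (simp add: u_def)
    from bcoord_surj[OF that this]
    obtain e where "proj B e = z" "bcoord B d \<tau> e = u z" "bpoint B d \<tau> (u z) = e"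
      by blast
    then show "proj B (\<phi> z) = z" "bcoord B d \<tau> (\<phi> z) = u z" by (simp_all add: \<phi>_def)
  qed
  have fiber: "snd \<tau> (\<phi> z) $ i
      = snd \<tau> \<zeta> $ i + (\<Sum>\<alpha>\<in>UNIV. A i \<alpha> / s * (snd d z $ \<alpha> - snd d (proj B \<zeta>) $ \<alpha>))" if "z \<in> patch" for z i
    using arg_cong[OF \<phi>(2)[OF that], of "\<lambda>u. u $ Inr i"] by (simp add: bcoord_def u_def)
  show thesis
  proof (rule that[of \<phi>])
    show "\<forall>z\<in>patch. \<forall>i. s * snd \<tau> (\<phi> z) $ i = s * snd \<tau> \<zeta> $ i
        + (\<Sum>\<alpha>\<in>UNIV. A i \<alpha> * (snd d z $ \<alpha> - snd d (proj B \<zeta>) $ \<alpha>))"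
      using p(2) by (simp add: fiber distrib_left sum_distrib_left)
    have "u (proj B \<zeta>) = bcoord B d \<tau> \<zeta>"
      by (simp add: u_def bcoord_def vec_eq_iff split: sum.split)
    then have "\<phi> (proj B \<zeta>) = \<zeta>" using bpoint_bcoord[OF p(1)] by (simp add: \<phi>_def)
    \<comment> \<open>The section is affine only with respect to \<open>d\<close> and
      \<open>\<tau>\<close>, while \<open>local_sections\<close> asks for holomorphy in all charts
      and trivializations; the transition matrices and coordinate changes provide it.\<close>
    moreover have "holo_on (\<lambda>x. snd \<sigma> (\<phi> (chart_inv c x)) $ i) (snd c ` (patch \<inter> fst c \<inter> fst \<sigma>))"
      if c: "c \<in> charts B" and \<sigma>: "\<sigma> \<in> trivs B" for c \<sigma> i
    proof -
      let ?N = "snd c ` (patch \<inter> fst c \<inter> fst \<sigma>)"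
      note inv = chart_facts(3)[OF manifold c]
      have "open ?N"
        by (intro chart_facts(4)[OF manifold c] open_Int open_patch chart_facts(1)[OF manifold c] open_triv[OF \<sigma>]) auto
      obtain t :: "'x \<Rightarrow> complex^'r^'r" where
        t: "\<And>e. proj B e \<in> fst \<tau> \<inter> fst \<sigma> \<Longrightarrow> snd \<sigma> e = t (proj B e) *v snd \<tau> e"
        and t_holo: "\<And>i j. holo_on (\<lambda>x. t (chart_inv c x) $ i $ j) (snd c ` (fst c \<inter> fst \<tau> \<inter> fst \<sigma>))"
        using holomorphic \<tau> \<sigma> c unfolding holomorphic_vector_bundle_def by meson
      have "snd \<sigma> (\<phi> (chart_inv c x)) $ i = (\<Sum>j\<in>UNIV. t (chart_inv c x) $ i $ j *
          (snd \<tau> \<zeta> $ j + (\<Sum>\<alpha>\<in>UNIV. A j \<alpha> / s * (snd d (chart_inv c x) $ \<alpha> + - snd d (proj B \<zeta>) $ \<alpha>))))"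
        if "x \<in> ?N" for x
      proof -
        have x: "chart_inv c x \<in> patch" "chart_inv c x \<in> fst \<sigma>" using that inv by auto
        then have "snd \<sigma> (\<phi> (chart_inv c x)) = t (chart_inv c x) *v snd \<tau> (\<phi> (chart_inv c x))"
          using t[of "\<phi> (chart_inv c x)"] \<phi>(1)[OF x(1)] by (simp add: patch_def)
        then show ?thesis by (simp add: matrix_vector_mult_def fiber[OF x(1)])
      qed
      moreover have "holo_on (\<lambda>x. \<Sum>j\<in>UNIV. t (chart_inv c x) $ i $ j *
          (snd \<tau> \<zeta> $ j + (\<Sum>\<alpha>\<in>UNIV. A j \<alpha> / s * (snd d (chart_inv c x) $ \<alpha> + - snd d (proj B \<zeta>) $ \<alpha>)))) ?N"
        by (intro holo_on_sum holo_on_mult holo_on_add holo_on_const holo_on_transition c holo_on_subset[OF t_holo])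
          (auto simp: patch_def)
      ultimately show ?thesis using holo_on_cong[OF \<open>open ?N\<close>] by (metis (no_types, lifting))
    qed
    ultimately show "\<phi> \<in> local_sections B \<zeta>"
      unfolding local_sections_def using p(1) open_patch(1) \<phi>(1) by blast
  qed
qed

end

text \<open>\<open>w\<close> stands for an arbitrary lift of \<open>v\<close>, so the equality
  includes independence of the lift. Reality is asserted separately because \<open>Re\<close> in the
  second part would hide an imaginary part.\<close>

theorem lemma5p1:
  fixes B :: "('x::t2_space, 'e::topological_space, 'n::finite, 'r::finite) hbundle"
    and F :: "'e \<Rightarrow> real"
    and z\<^sub>0 :: 'x
    and v :: "('x, 'n) chart \<Rightarrow> complex^'n"
    and \<zeta> :: 'e
    and c d :: "('x, 'n) chart"
    and \<tau> :: "('x, 'e, 'r) triv"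
    and k :: 'r
    and w :: "complex^('n + 'r)"
  assumes "compact (UNIV :: 'x set)"
    and "holomorphic_vector_bundle B"
    and "finsler_metric B F"
    and "strongly_pseudoconvex B F"
    and "tangent_vector (charts B) z\<^sub>0 v"
    and "proj B \<zeta> = z\<^sub>0" and "\<not> is_zero_vec B \<zeta>"
    and "c \<in> charts B" and "z\<^sub>0 \<in> fst c"
    and "d \<in> charts B" and "\<tau> \<in> trivs B" and "bline B \<zeta> \<in> ppatch B d \<tau> k"
    and "\<forall>\<alpha>. w $ Inl \<alpha> = v d $ \<alpha>"
  shows "kobayashi_curvature B F d \<tau> k (bline B \<zeta>) w \<in> \<real> \<and>
         K_curv B F c v \<zeta> = ereal (Re (kobayashi_curvature B F d \<tau> k (bline B \<zeta>) w))"
proof -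
  interpret bundle_patch B d \<tau> by unfold_locales (rule assms)+
  interpret homogeneous_metric "\<lambda>u. (F (bpoint B d \<tau> u))\<^sup>2" nonzero_coords
    by (rule homogeneous_metric_finsler[OF assms(3,4)])
  note z0 = \<open>proj B \<zeta> = z\<^sub>0\<close>
  note coord = bline_coord[OF assms(12)]
  \<comment> \<open>Scaling by \<open>s\<close> gives the representative with coordinate
    \<open>k\<close> equal to 1, where \<open>kobayashi_curvature\<close> is evaluated.\<close>
  define s where "s = 1 / snd \<tau> \<zeta> $ k"
  define u where "u = bcoord B d \<tau> (vscale B s \<zeta>)"
  let ?L = "\<lambda>u. complex_of_real (ln (1 / (cmod s)\<^sup>2 * (F (bpoint B d \<tau> u))\<^sup>2))"
  let ?K = "kobayashi_curvature B F d \<tau> k (bline B \<zeta>) w"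
  have s: "s \<noteq> 0" using coord(2) by (simp add: s_def)
  have u: "u \<in> nonzero_coords" unfolding u_def by (rule bcoord_vscale_nonzero[OF coord(1,2) s])
  have u_fiber: "u $ Inr i = s * snd \<tau> \<zeta> $ i" for i
    using coord(1) by (simp add: u_def bcoord_def triv_vscale[OF assms(11)] patch_def)
  have "fix_coord k u = u"
    using coord(2) by (simp add: fix_coord_def vec_eq_iff u_fiber s_def)
  have K_eq: "?K = (\<Sum>a\<in>- {Inr k}. \<Sum>b\<in>- {Inr k}. line_block (hess (fix_coord k u))
      (chern_curvature (\<lambda>x. hess (fix_coord k x)) a b u) (fib u) * w $ a * cnj (w $ b))"
  proof -
    have "pullback_metric B F d \<tau> k = (\<lambda>x. hess (fix_coord k x))"
      by (rule ext) (simp add: pullback_metric_def fiber_hessian_def hess_def gg_def g_def[abs_def] fix_coord_def)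
    moreover have "pcoord B d \<tau> k (bline B \<zeta>) = u" using coord(3) by (simp add: u_def s_def)
    ultimately show ?thesis by (simp add: kobayashi_curvature_def Let_def fib_def)
  qed
  have \<kappa>: "1 / (cmod s)\<^sup>2 > 0" using s by simp
  obtain V A where V: "\<forall>\<alpha>. V $ Inl \<alpha> = w $ Inl \<alpha>" "\<forall>i. V $ Inr i = (\<Sum>\<alpha>\<in>UNIV. A i \<alpha> * w $ Inl \<alpha>)"
    and K: "?K = - levi ?L u V" "?K \<in> \<real>"
    and min: "\<forall>V'. (\<forall>\<alpha>. V' $ Inl \<alpha> = w $ Inl \<alpha>) \<longrightarrow> Re (levi ?L u V) \<le> Re (levi ?L u V')"
    using kobayashi_levi[OF u \<open>fix_coord k u = u\<close> \<kappa>, of w, folded K_eq] by blast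
  have tv: "tangent_vector (charts B) (proj B \<zeta>) v" "proj B \<zeta> \<in> fst c" using assms(5,9) z0 by simp_all
  note levi_section = ddbar_section[OF assms(3,4) tv(1) assms(8) tv(2) coord(1,2) s, folded u_def]
  let ?D = "\<lambda>\<phi>. ereal (Re (ddbar c (\<lambda>z. ln ((F (\<phi> z))\<^sup>2)) (proj B \<zeta>) (v c)))"
  have "(INF \<phi>\<in>local_sections B \<zeta>. ?D \<phi>) = ereal (Re (levi ?L u V))"
  proof (rule antisym)
    show "ereal (Re (levi ?L u V)) \<le> (INF \<phi>\<in>local_sections B \<zeta>. ?D \<phi>)"
    proof (rule INF_greatest)
      fix \<phi> assume "\<phi> \<in> local_sections B \<zeta>"
      then show "ereal (Re (levi ?L u V)) \<le> ?D \<phi>"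
      proof (rule levi_section)
        fix V' assume "\<forall>\<alpha>. V' $ Inl \<alpha> = v d $ \<alpha>"
          and D: "ddbar c (\<lambda>z. ln ((F (\<phi> z))\<^sup>2)) (proj B \<zeta>) (v c) = levi ?L u V'"
        then have "Re (levi ?L u V) \<le> Re (levi ?L u V')"
          using min[rule_format, of V'] assms(13) by metis
        then show ?thesis unfolding D by simp
      qed
    qed
    \<comment> \<open>Slopes taken from the minimizing lift give a section whose tangent vector is
      that lift, so the infimum is attained.\<close>
    obtain \<phi> where \<phi>: "\<phi> \<in> local_sections B \<zeta>" and \<phi>_eq: "\<forall>z\<in>patch. \<forall>i. s * snd \<tau> (\<phi> z) $ i
        = s * snd \<tau> \<zeta> $ i + (\<Sum>\<alpha>\<in>UNIV. A i \<alpha> * (snd d z $ \<alpha> - snd d (proj B \<zeta>) $ \<alpha>))"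
      using affine_section[OF coord(1) s, of A] by blast
    from levi_section[OF \<phi>] obtain V' where V': "\<forall>\<alpha>. V' $ Inl \<alpha> = v d $ \<alpha>"
      "\<forall>i. V' $ Inr i = (\<Sum>\<gamma>\<in>UNIV. wirt \<gamma> (\<lambda>x. s * snd \<tau> (\<phi> (chart_inv c x)) $ i) (snd c (proj B \<zeta>)) * v c $ \<gamma>)"
      and D: "ddbar c (\<lambda>z. ln ((F (\<phi> z))\<^sup>2)) (proj B \<zeta>) (v c) = levi ?L u V'" by blast
    have "V' $ Inr i = V $ Inr i" for i
    proof -
      let ?x = "snd c (proj B \<zeta>)"
      let ?f = "\<lambda>\<alpha> x. snd d (chart_inv c x) $ \<alpha>"
      let ?N = "snd c ` (fst c \<inter> patch)"
      have N: "open ?N"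
        by (intro chart_facts(4)[OF manifold assms(8)] open_Int open_patch chart_facts(1)[OF manifold assms(8)]) auto
      have x: "?x \<in> ?N" using tv(2) coord(1) by blast
      have f: "?f \<alpha> differentiable (at ?x)" for \<alpha>
        using x by (intro holo_onD(3)[OF holo_on_transition[OF assms(8)]]) (auto simp: patch_def)
      have f': "wirt \<gamma> (\<lambda>y. ?f \<alpha> y - r) ?x = wirt \<gamma> (?f \<alpha>) ?x" for \<gamma> \<alpha> r
        using wirt_add(1)[OF f differentiable_const, of \<gamma> \<alpha> "- r"] by simp
      have "s * snd \<tau> (\<phi> (chart_inv c y)) $ i
          = s * snd \<tau> \<zeta> $ i + (\<Sum>\<alpha>\<in>UNIV. A i \<alpha> * (?f \<alpha> y - snd d (proj B \<zeta>) $ \<alpha>))" if "y \<in> ?N" for y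
        using that \<phi>_eq chart_facts(3)[OF manifold assms(8)] by auto
      then have "wirt \<gamma> (\<lambda>x. s * snd \<tau> (\<phi> (chart_inv c x)) $ i) ?x
          = wirt \<gamma> (\<lambda>y. s * snd \<tau> \<zeta> $ i + (\<Sum>\<alpha>\<in>UNIV. A i \<alpha> * (?f \<alpha> y - snd d (proj B \<zeta>) $ \<alpha>))) ?x" for \<gamma>
        by (rule wirt_cong(1)[OF N x])
      also have "\<dots> \<gamma> = (\<Sum>\<alpha>\<in>UNIV. A i \<alpha> * wirt \<gamma> (?f \<alpha>) ?x)" for \<gamma>
        using f by (simp add: wirt_add wirt_sum wirt_cmult f')
      finally have "V' $ Inr i = (\<Sum>\<gamma>\<in>UNIV. \<Sum>\<alpha>\<in>UNIV. A i \<alpha> * (wirt \<gamma> (?f \<alpha>) ?x * v c $ \<gamma>))"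
        by (simp add: V'(2) sum_distrib_right mult.assoc)
      \<comment> \<open>Derivatives are taken in the chart \<open>c\<close>, slopes are given in
        \<open>d\<close>; the Jacobian of the coordinate change turns \<open>v c\<close> into
        \<open>v d\<close>, the base part of \<open>w\<close>.\<close>
      also have "\<dots> = (\<Sum>\<alpha>\<in>UNIV. A i \<alpha> * v d $ \<alpha>)"
        using coord(1) by (subst sum.swap)
          (simp add: tangent_vector_transition[OF tv(1) assms(8) tv(2)] patch_def sum_distrib_left)
      finally show ?thesis using V(2) assms(13) by simp
    qed
    then have "V' $ a = V $ a" for a using V(1) V'(1) assms(13) by (cases a) simp_all
    then have "V' = V" by (simp add: vec_eq_iff)
    then have "?D \<phi> = ereal (Re (levi ?L u V))" using D by simp
    then show "(INF \<phi>\<in>local_sections B \<zeta>. ?D \<phi>) \<le> ereal (Re (levi ?L u V))"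
      using INF_lower[OF \<phi>, of ?D] by simp
  qed
  then have "K_curv B F c v \<zeta> = ereal (Re ?K)"
    unfolding K_curv_def K(1) by simp
  then show ?thesis using K(2) by blast
qed

end
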